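(* Let $k\in\mathbb{N}$ with $k\geq 3$. There exists $c>0$ such that for every $\alpha>0$ the following hold (where "almost all ... on $n$ vertices have property $P$" means that the proportion of such labelled objects on vertex set $[n]$ having property $P$ tends to $1$ as $n\to\infty$). (i) Almost all $C_k$-free oriented graphs on $n$ vertices have between $cn/\log n$ and $\alpha n^2$ backwards edges in a transitive-optimal ordering. (ii) Almost all $C_k$-free digraphs on $n$ vertices have at least $cn/\log n$ backwards edges in a transitive-optimal ordering. Moreover, (a) if $k$ is even then almost all $C_k$-free digraphs on $n$ vertices have at most $\alpha n^2$ backwards edges in a transitive-optimal ordering; (b) if $k$ is odd then almost all $C_k$-free digraphs on $n$ vertices can be made into a subgraph of a transitive-bipartite blow up by changing at most $\alpha n^2$ edges.
   Context: A digraph is a pair $(V,E)$ with $E$ a set of ordered pairs of distinct vertices (edges in both directions between a pair are allowed, no loops, no parallel edges in the same direction); an oriented graph is a digraph with at most one edge between any two vertices. $C_k$ is the directed cycle on $k$ vertices; $H$-free means containing no (not necessarily induced) copy of $H$. $\log$ denotes $\log_2$. Given a digraph $G$ with vertex labels $1,\dots,n$ and an ordering $\sigma:[n]\to[n]$ (a bijection), a backwards edge with respect to $\sigma$ is an edge directed from $i$ to $j$ with $\sigma(i)>\sigma(j)$. A transitive-optimal ordering of $G$ is an ordering minimising the number of backwards edges. A digraph $G=(V,E)$ is a transitive-bipartite blow up if $V$ admits a partition $A_1,\dots,A_t$ such that each $G[A_i]$ is either a single vertex or a complete balanced bipartite digraph (all edges in both directions between the two classes), and for all $i<j$ the edges between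 $A_i$ and $A_j$ are precisely all edges directed from $A_i$ to $A_j$. "Changing" an edge means adding, deleting, or reversing its orientation. *)

theory Defs
  imports Complex_Main "HOL-Library.Disjoint_Sets" "Graph_Theory.Graph_Theory"
begin

text \<open>
  Digraphs are loop-free \<^typ>\<open>'a pair_pre_digraph\<close>s: the arcs form a set of ordered pairs, so
  there are no parallel arcs in the same direction, while opposite arcs are allowed.
\<close>

definition digraphs_on :: "nat \<Rightarrow> nat pair_pre_digraph set" where
  "digraphs_on n = {G. pair_digraph G \<and> pverts G = {1..n}}"

definition oriented :: "'a pair_pre_digraph \<Rightarrow> bool" where
  "oriented G \<longleftrightarrow> (\<forall>u v. (u, v) \<in> parcs G \<longrightarrow> (v, u) \<notin> parcs G)"

definition directed_cycle :: "nat \<Rightarrow> nat pair_pre_digraph" where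
  "directed_cycle k = \<lparr> pverts = {0..<k}, parcs = {(i, (i + 1) mod k) | i. i < k} \<rparr>"

definition contains_copy :: "('a, 'b) pre_digraph \<Rightarrow> ('c, 'd) pre_digraph \<Rightarrow> bool" where
  "contains_copy G H \<longleftrightarrow> (\<exists>K. subgraph K G \<and> digraph_iso H K)"

definition cycle_free :: "nat \<Rightarrow> 'a pair_pre_digraph \<Rightarrow> bool" where
  "cycle_free k G \<longleftrightarrow> \<not> contains_copy (with_proj G) (with_proj (directed_cycle k))"

definition cycle_free_digraphs :: "nat \<Rightarrow> nat \<Rightarrow> nat pair_pre_digraph set" where
  "cycle_free_digraphs k n = {G \<in> digraphs_on n. cycle_free k G}"

definition cycle_free_oriented_graphs :: "nat \<Rightarrow> nat \<Rightarrow> nat pair_pre_digraph set" where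
  "cycle_free_oriented_graphs k n = {G \<in> digraphs_on n. oriented G \<and> cycle_free k G}"

text \<open>
  \<open>F n\<close> is the class of labelled objects on the vertex set \<open>{1..n}\<close>. The property may depend
  on \<open>n\<close>.
\<close>

definition almost_all :: "(nat \<Rightarrow> 'a set) \<Rightarrow> (nat \<Rightarrow> 'a \<Rightarrow> bool) \<Rightarrow> bool" where
  "almost_all F P \<longleftrightarrow>
    (\<lambda>n. real (card {G \<in> F n. P n G}) / real (card (F n))) \<longlonglongrightarrow> 1"

definition backwards_edges :: "nat pair_pre_digraph \<Rightarrow> (nat \<Rightarrow> nat) \<Rightarrow> (nat \<times> nat) set" where
  "backwards_edges G \<sigma> = {(i, j) \<in> parcs G. \<sigma> i > \<sigma> j}"

definition transitive_optimal :: "nat \<Rightarrow> nat pair_pre_digraph \<Rightarrow> (nat \<Rightarrow> nat) \<Rightarrow> bool" where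
  "transitive_optimal n G \<sigma> \<longleftrightarrow>
    is_arg_min (\<lambda>\<tau>. card (backwards_edges G \<tau>)) (\<lambda>\<tau>. bij_betw \<tau> {1..n} {1..n}) \<sigma>"

text \<open>
  A bipartite digraph is balanced if the sizes of its two classes differ by at most one.
\<close>

definition complete_balanced_bipartite :: "('a, 'b) pre_digraph \<Rightarrow> bool" where
  "complete_balanced_bipartite G \<longleftrightarrow>
    (\<exists>a b. a \<le> b \<and> b \<le> a + 1 \<and> complete_bipartite_digraph a b G)"

definition transitive_bipartite_blow_up :: "'a pair_pre_digraph \<Rightarrow> bool" where
  "transitive_bipartite_blow_up G \<longleftrightarrow> pair_digraph G \<and>
    (\<exists>(t::nat) A. (\<Union>i\<in>{1..t}. A i) = pverts G \<and> disjoint_family_on A {1..t} \<and>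
      (\<forall>i\<in>{1..t}. A i \<noteq> {} \<and>
        (card (A i) = 1 \<or> complete_balanced_bipartite (induce_subgraph (with_proj G) (A i)))) \<and>
      (\<forall>i\<in>{1..t}. \<forall>j\<in>{1..t}. i < j \<longrightarrow>
        parcs G \<inter> (A i \<times> A j \<union> A j \<times> A i) = A i \<times> A j))"

text \<open>
  One edge change: adding, deleting, or reversing an arc. An arc whose opposite is already
  present cannot be reversed, since that would create parallel arcs.
\<close>

definition edge_change :: "('a pair_pre_digraph \<times> 'a pair_pre_digraph) set" where
  "edge_change = {(G, H). pverts H = pverts G \<and>
    ((\<exists>u\<in>pverts G. \<exists>v\<in>pverts G. u \<noteq> v \<and> (u, v) \<notin> parcs G \<and> parcs H = insert (u, v) (parcs G)) \<or>
     (\<exists>e\<in>parcs G. parcs H = parcs G - {e}) \<or>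
     (\<exists>u v. (u, v) \<in> parcs G \<and> (v, u) \<notin> parcs G \<and>
        parcs H = insert (v, u) (parcs G - {(u, v)})))}"

text \<open>
  The blow up is taken on the same vertex set as the digraph, whence \<^const>\<open>spanning\<close>.
\<close>

definition near_blow_up_subgraph :: "'a pair_pre_digraph \<Rightarrow> real \<Rightarrow> bool" where
  "near_blow_up_subgraph G x \<longleftrightarrow>
    (\<exists>m H B. real m \<le> x \<and> (G, H) \<in> edge_change ^^ m \<and>
      transitive_bipartite_blow_up B \<and> spanning (with_proj H) (with_proj B))"

end

theory Submission
  imports Defs "HOL-Analysis.Analysis" "HOL-Real_Asymp.Real_Asymp"
begin

text \<open>
  The proof replaces regularity arguments by containers for closed walks. If \<open>A\<close> contains few closed
  walks of length \<open>k\<close>, then all but few arcs of \<open>A\<close> lie in the complement \<open>D\<close> of boundedly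
  many rectangles \<open>U \<times> W\<close>, and \<open>D\<close> itself has few closed walks: the positions of a walk are
  moved from \<open>A\<close> to \<open>D\<close> one at a time, and a rectangle is put into the complement as long as
  many of its pairs close up many walks. Hence every \<open>C\<^sub>k\<close>-free digraph lies, up to \<open>\<epsilon>n\<^sup>2\<close>
  arcs, in one of only \<open>2\<^bsup>O(n)\<^esup>\<close> containers.

  Cloning vertices (Cauchy--Schwarz) shows that also degenerate closed walks are rare in a container:
  double edges if \<open>k\<close> is even, triangles with a double edge if \<open>k\<close> is odd. So a container
  has at most \<open>(1/2 + o(1))n\<^sup>2\<close> arcs, and close to this bound almost every triple of vertices
  spans what it would span in a transitive-bipartite blow up; comparing the vertices with boundedly
  many random pivots then yields the blow up. The remaining containers are too small to matter, as
  the transitive tournament alone provides \<open>2\<^bsup>n(n-1)/2\<^esup>\<close> graphs.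

  For the lower bound let \<open>a\<close> be the number of acyclic digraphs. At most \<open>a\<cdot>2\<^bsup>O(cn)\<^esup>\<close>
  digraphs have an ordering with fewer than \<open>cn/log n\<close> backwards edges. On the other hand, planting
  cycles of length \<open>k + 1\<close> on disjoint blocks of consecutive vertices of a topological ordering
  produces at least \<open>a\<cdot>2\<^bsup>\<Omega>(n)\<^esup>\<close> oriented graphs without \<open>C\<^sub>k\<close>.
\<close>

section \<open>Containers for closed walks\<close>

text \<open>Closed walks, unlike cycles, can be averaged over: a digraph without the cycle has at
  most k^2 n^(k-1) closed walks of length k, all of them degenerate, and this vanishing density
  passes to a container, whereas the absence of cycles does not. Rectangles are the right building
  blocks because one of them costs only 2n bits, so boundedly many are negligible against
  2^(\<omega> n^2).

  A triangle away from double edges carries closed walks only of lengths divisible by 3, so cloning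
  does not reach it. But there the digraph is close to a tournament, in which most closed walks of
  length l extend to many of length l + 1; hence few walks of length k force few triangles.

  The scale n/log n arises because choosing cn/log n arcs among n^2 pairs gives about 2^(2cn) sets,
  which has to stay below the factor 2^(\<Omega>(n)) gained by planting. That factor depends only on
  k, so c is fixed before \<alpha>. Planted cycles have length k + 1 since k steps on such a cycle
  never close up, and they can be decoded as strong components.\<close>

definition tuples :: "'a set \<Rightarrow> nat \<Rightarrow> 'a list set" where
  "tuples V k = {xs. set xs \<subseteq> V \<and> length xs = k}"

text \<open>Each position has its own arc set, so that hybrid walks, running partly in the container
  and partly in the original digraph, can be counted.\<close>

definition walk_of :: "(nat \<Rightarrow> ('a \<times> 'a) set) \<Rightarrow> 'a list \<Rightarrow> bool" where
  "walk_of E xs \<longleftrightarrow> (\<forall>i<length xs. (xs ! i, xs ! (Suc i mod length xs)) \<in> E i)"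

abbreviation closed_walk :: "('a \<times> 'a) set \<Rightarrow> 'a list \<Rightarrow> bool" where
  "closed_walk D \<equiv> walk_of (\<lambda>_. D)"

definition walks :: "'a set \<Rightarrow> ('a \<times> 'a) set \<Rightarrow> nat \<Rightarrow> 'a list set" where
  "walks V D k = {xs \<in> tuples V k. closed_walk D xs}"

lemma finite_tuples [simp, intro]: "finite V \<Longrightarrow> finite (tuples V k)"
  unfolding tuples_def using finite_lists_length_eq by auto

lemma card_tuples: "finite V \<Longrightarrow> card (tuples V k) = card V ^ k"
  unfolding tuples_def using card_lists_length_eq by auto

lemma finite_walks [simp, intro]: "finite V \<Longrightarrow> finite (walks V D k)"
  by (simp add: walks_def)

lemma walks_mono: "D \<subseteq> D' \<Longrightarrow> walks V D k \<subseteq> walks V D' k"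
  by (auto simp: walks_def walk_of_def)

lemma tuples_update: "xs \<in> tuples V k \<Longrightarrow> u \<in> V \<Longrightarrow> xs[i := u] \<in> tuples V k"
  using set_update_subset_insert[of xs i u] by (auto simp: tuples_def)

lemma tuples_nth: "xs \<in> tuples V k \<Longrightarrow> i < k \<Longrightarrow> xs ! i \<in> V"
  by (auto simp: tuples_def)

text \<open>Exchanging the fresh vertex with the \<open>i\<close>-th entry is an involution on pairs
  of a tuple and a vertex.\<close>

lemma sum_swap_tuple:
  fixes F :: "'a list \<Rightarrow> 'a \<Rightarrow> 'b::comm_monoid_add"
  assumes "i < k"
  shows "(\<Sum>xs\<in>tuples V k. \<Sum>u\<in>V. F xs u) = (\<Sum>xs\<in>tuples V k. \<Sum>u\<in>V. F (xs[i := u]) (xs ! i))"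
  unfolding sum.cartesian_product
  by (rule sum.reindex_bij_witness[where
        i = "\<lambda>(xs, u). (xs[i := u], xs ! i)" and j = "\<lambda>(xs, u). (xs[i := u], xs ! i)"])
    (use assms in \<open>auto simp: tuples_update tuples_nth, auto simp: tuples_def\<close>)

lemma sum_update_tuple:
  fixes g :: "'a list \<Rightarrow> nat"
  assumes "i < k"
  shows "(\<Sum>xs\<in>tuples V k. \<Sum>u\<in>V. g (xs[i := u])) = card V * (\<Sum>xs\<in>tuples V k. g xs)"
proof -
  have "(\<Sum>xs\<in>tuples V k. \<Sum>u\<in>V. g (xs[i := u])) = (\<Sum>xs\<in>tuples V k. \<Sum>u\<in>V. g xs)"
    by (rule sum_swap_tuple[OF assms, where F = "\<lambda>xs u. g xs", symmetric])
  then show ?thesis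
    by (simp add: sum_distrib_left)
qed

lemma card_eq_sum_of_bool:
  "finite A \<Longrightarrow> card {x \<in> A. P x} = (\<Sum>x\<in>A. of_bool (P x))"
  by (simp add: Int_def)

text \<open>The arc between the two replaced positions is left free by \<open>UNIV\<close>, so that
  intersecting with an arc set counts the walks using that set there. The result does not depend on
  the two entries of \<open>xs\<close> that are overwritten.\<close>

definition completions ::
  "'a set \<Rightarrow> (nat \<Rightarrow> ('a \<times> 'a) set) \<Rightarrow> nat \<Rightarrow> 'a list \<Rightarrow> ('a \<times> 'a) set" where
  "completions V E j xs = {(u, v). u \<in> V \<and> v \<in> V \<and>
     walk_of (E(j := UNIV)) (xs[j := u, Suc j mod length xs := v])}"

lemma walk_of_upd:
  assumes "j < length xs"
  shows "walk_of (E(j := A)) xs \<longleftrightarrow>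
    walk_of (E(j := UNIV)) xs \<and> (xs ! j, xs ! (Suc j mod length xs)) \<in> A"
  using assms by (auto simp: walk_of_def)

lemma Suc_mod_neq:
  assumes "2 \<le> k" "j < k" shows "Suc j mod k \<noteq> j"
  using assms by (cases "Suc j = k") auto

text \<open>Double counting: the two overwritten entries of the tuple are forgotten, and each of
  them contributes a factor \<open>card V\<close>.\<close>

lemma sum_card_completions:
  assumes "finite V" "2 \<le> k" "j < k"
  shows "(\<Sum>xs\<in>tuples V k. card (completions V E j xs \<inter> A)) =
    card V * (card V * card {xs \<in> tuples V k. walk_of (E(j := A)) xs})"
proof -
  let ?j = "Suc j mod k"
  let ?g = "\<lambda>xs. of_bool (walk_of (E(j := A)) xs) :: nat"
  have j: "?j < k" "?j \<noteq> j"
    using assms Suc_mod_neq by auto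
  have *: "card (completions V E j xs \<inter> A) = (\<Sum>u\<in>V. \<Sum>v\<in>V. ?g (xs[j := u, ?j := v]))"
    if "xs \<in> tuples V k" for xs
  proof -
    have "completions V E j xs \<inter> A = {(u,v) \<in> V \<times> V. walk_of (E(j := A)) (xs[j := u, ?j := v])}"
      using that assms j
      by (auto simp: completions_def tuples_def walk_of_upd[where A = A])
    also have "\<dots> = {p \<in> V \<times> V. walk_of (E(j := A)) (xs[j := fst p, ?j := snd p])}"
      by auto
    also have "card \<dots> = (\<Sum>p\<in>V \<times> V. of_bool (walk_of (E(j := A)) (xs[j := fst p, ?j := snd p])))"
      using assms by (intro card_eq_sum_of_bool) auto
    finally show ?thesis
      unfolding sum.cartesian_product case_prod_beta .
  qed
  have "(\<Sum>xs\<in>tuples V k. card (completions V E j xs \<inter> A)) =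
      (\<Sum>xs\<in>tuples V k. \<Sum>u\<in>V. \<Sum>v\<in>V. ?g (xs[j := u, ?j := v]))"
    using * by simp
  also have "\<dots> = card V * (\<Sum>xs\<in>tuples V k. \<Sum>v\<in>V. ?g (xs[?j := v]))"
    using sum_update_tuple[OF assms(3), where g = "\<lambda>xs. \<Sum>v\<in>V. ?g (xs[?j := v])"] by simp
  also have "\<dots> = card V * (card V * (\<Sum>xs\<in>tuples V k. ?g xs))"
    using sum_update_tuple[OF j(1), where g = ?g] by simp
  finally show ?thesis
    using assms by (simp add: card_eq_sum_of_bool)
qed

text \<open>
  Since \<open>k \<ge> 3\<close>, no arc of the walk other than the one in position \<open>j\<close> meets both new vertices.
\<close>

lemma completions_rectangle:
  assumes "3 \<le> k" "j < k" "length xs = k"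
  shows "completions V E j xs = fst ` completions V E j xs \<times> snd ` completions V E j xs"
proof -
  define j' where "j' = Suc j mod k"
  have j: "j' < k" "j' \<noteq> j"
    using assms Suc_mod_neq by (auto simp: j'_def)
  have step: "(ys ! i, ys ! (Suc i mod k)) \<in> (E(j := UNIV)) i"
    if "(u, v) \<in> completions V E j xs" "ys = xs[j := u, j' := v]" "i < k" for u v ys i
    using that assms by (auto simp: completions_def walk_of_def j'_def)
  have "(u, v') \<in> completions V E j xs"
    if uv: "(u, v) \<in> completions V E j xs" and uv': "(u', v') \<in> completions V E j xs" for u v u' v'
  proof -
    define ys where "ys = xs[j := u, j' := v']"
    have same: "ys ! i = xs[j := u', j' := v'] ! i" if "i \<noteq> j" for i
      using that j assms by (cases "i = j'") (simp_all add: ys_def)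
    have "(ys ! i, ys ! (Suc i mod k)) \<in> (E(j := UNIV)) i" if i: "i < k" for i
    proof (cases "i = j")
      case ij: False
      show ?thesis
      proof (cases "i = j'")
        case True
        have "Suc i mod k \<noteq> j"
        proof
          assume "Suc i mod k = j"
          moreover have "Suc i mod k = (j + 2) mod k"
            using True by (simp add: j'_def mod_Suc_eq)
          ultimately have "(j + 2) mod k = j"
            by simp
          then show False
            using assms(1,2) by (cases "j + 2 < k") (auto simp: le_mod_geq)
        qed
        then have "ys ! (Suc i mod k) = xs[j := u', j' := v'] ! (Suc i mod k)"
          using same[of "Suc i mod k"] by blast
        moreover have "ys ! i = xs[j := u', j' := v'] ! i"
          using same[of i] ij by blast
        ultimately have *: "ys ! i = xs[j := u', j' := v'] ! i"
          "ys ! (Suc i mod k) = xs[j := u', j' := v'] ! (Suc i mod k)"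
          by blast+
        show ?thesis
          unfolding * by (rule step[OF uv' refl i])
      next
        case ne: False
        have "Suc i mod k \<noteq> j'"
        proof
          assume "Suc i mod k = j'"
          then have "i = j"
            using i assms(2) unfolding j'_def by (metis Suc_inject Suc_lessI mod_less mod_self nat.distinct(1))
          with ij show False ..
        qed
        then have *: "ys ! i = xs[j := u, j' := v] ! i"
          "ys ! (Suc i mod k) = xs[j := u, j' := v] ! (Suc i mod k)"
          using ne by (simp_all add: ys_def)
        show ?thesis
          unfolding * by (rule step[OF uv refl i])
      qed
    qed simp
    then have "walk_of (E(j := UNIV)) ys"
      using assms(3) by (simp add: walk_of_def ys_def)
    then show ?thesis
      using uv uv' assms by (auto simp: completions_def ys_def j'_def)
  qed
  then show ?thesis
    by (force simp: image_iff)
qed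


section \<open>Removing rectangles of completions, one position at a time\<close>

definition rectangles :: "('a set \<times> 'a set) set \<Rightarrow> ('a \<times> 'a) set" where
  "rectangles R = (\<Union>(U, W)\<in>R. U \<times> W)"

lemma rectangles_Un: "rectangles (R \<union> R') = rectangles R \<union> rectangles R'"
  by (auto simp: rectangles_def)

text \<open>Position \<open>j\<close> is moved from \<open>E j\<close> into \<open>D\<close>. A
  tuple is bad if its completions meet \<open>E j\<close> often; by double counting few tuples are
  bad. Among the good tuples, rectangles of completions are collected as long as each covers
  \<delta> n^2 new pairs of \<open>D\<close>, hence at most 1/\<delta> of them. Afterwards a good
  tuple has few completions left in \<open>D\<close>, the bad tuples contribute at most the share
  \<epsilon>/\<delta>', and each removed rectangle costs \<open>E j\<close> at most \<delta>' n^2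
  arcs because it comes from a good tuple.\<close>

lemma container_step:
  fixes \<delta> \<delta>' \<epsilon> :: real
  assumes V: "finite V" "V \<noteq> {}" and k: "3 \<le> k" "j < k"
    and D: "D \<subseteq> V \<times> V" and pos: "\<delta> > 0" "\<delta>' > 0"
    and few: "card {xs \<in> tuples V k. walk_of E xs} \<le> \<epsilon> * card V ^ k"
  shows "\<exists>R. R \<subseteq> Pow V \<times> Pow V \<and> card R \<le> 1 / \<delta> \<and>
    card (E j \<inter> rectangles R) \<le> \<delta>' / \<delta> * (card V)\<^sup>2 \<and>
    card {xs \<in> tuples V k. walk_of (E(j := D - rectangles R)) xs} \<le> (\<delta> + \<epsilon> / \<delta>') * card V ^ k"
proof -
  define n where "n = card V"
  have n: "0 < n"
    using V by (simp add: n_def card_gt_0_iff)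
  define K where "K = completions V E j"
  define T where "T = tuples V k"
  have finT: "finite T" and cardT: "card T = n ^ k"
    using V by (simp_all add: T_def card_tuples n_def)
  have K_sub: "K xs \<subseteq> V \<times> V" for xs
    by (auto simp: K_def completions_def)
  have finK: "finite (K xs)" for xs
    by (rule finite_subset[OF K_sub]) (use V in auto)
  have finD: "finite D"
    using D V finite_subset by blast
  define bad where "bad = {xs \<in> T. card (K xs \<inter> E j) > \<delta>' * n\<^sup>2}"
  have "card bad * (\<delta>' * n\<^sup>2) = (\<Sum>xs\<in>bad. \<delta>' * n\<^sup>2)"
    by simp
  also have "\<dots> \<le> (\<Sum>xs\<in>bad. real (card (K xs \<inter> E j)))"
    by (intro sum_mono) (auto simp: bad_def)
  also have "\<dots> \<le> (\<Sum>xs\<in>T. real (card (K xs \<inter> E j)))"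
    by (intro sum_mono2) (auto simp: bad_def finT)
  also have "\<dots> = real (\<Sum>xs\<in>T. card (K xs \<inter> E j))"
    by simp
  also have "\<dots> = n\<^sup>2 * real (card {xs \<in> T. walk_of E xs})"
    using V(1) k sum_card_completions[of V k j E "E j"]
    by (simp add: T_def K_def n_def power2_eq_square fun_upd_triv)
  also have "\<dots> \<le> n\<^sup>2 * (\<epsilon> * n ^ k)"
    using few by (intro mult_left_mono) (auto simp: T_def n_def)
  finally have "n\<^sup>2 * (card bad * \<delta>') \<le> n\<^sup>2 * (\<epsilon> * n ^ k)"
    by (simp add: algebra_simps)
  then have "card bad * \<delta>' \<le> \<epsilon> * n ^ k"
    using n by simp
  then have bad: "card bad \<le> \<epsilon> / \<delta>' * n ^ k"
    using pos by (simp add: field_simps)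
  \<comment> \<open>A family of maximal size with this property stands for the finished greedy
    process.\<close>
  define P where "P R \<longleftrightarrow> R \<subseteq> T - bad \<and> \<delta> * n\<^sup>2 * card R \<le> card (D \<inter> (\<Union>xs\<in>R. K xs))" for R
  have "P {}"
    by (simp add: P_def)
  moreover have "\<forall>R. P R \<longrightarrow> card R < Suc (card T)"
    using finT by (auto simp: P_def less_Suc_eq_le intro!: card_mono)
  ultimately obtain R where R: "P R" and max: "\<And>R'. P R' \<Longrightarrow> card R' \<le> card R"
    using ex_has_greatest_nat[of P "{}" card] by blast
  have finR: "finite R"
    using R finT finite_subset by (auto simp: P_def)
  define D' where "D' = D - (\<Union>xs\<in>R. K xs)"
  have good: "card (K xs \<inter> D') \<le> \<delta> * n\<^sup>2" if "xs \<in> T - bad" for xs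
  proof (rule ccontr)
    assume *: "\<not> ?thesis"
    have "0 \<le> \<delta> * n\<^sup>2"
      using pos by simp
    with * have "card (K xs \<inter> D') \<noteq> 0"
      by linarith
    then have "K xs \<inter> D' \<noteq> {}"
      by force
    then have xs: "xs \<notin> R"
      by (auto simp: D'_def)
    have "D \<inter> (\<Union>xs\<in>insert xs R. K xs) = (D \<inter> (\<Union>xs\<in>R. K xs)) \<union> (K xs \<inter> D')"
      by (auto simp: D'_def)
    also have "card \<dots> = card (D \<inter> (\<Union>xs\<in>R. K xs)) + card (K xs \<inter> D')"
      using finD finK by (intro card_Un_disjoint) (auto simp: D'_def)
    finally have "P (insert xs R)"
      using R * that finR xs by (auto simp: P_def algebra_simps)
    from max[OF this] show False
      using finR xs by simp
  qed
  have "\<delta> * n\<^sup>2 * card R \<le> card (D \<inter> (\<Union>xs\<in>R. K xs))"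
    using R by (simp add: P_def)
  also have "\<dots> \<le> card (V \<times> V)"
    using V D by (intro of_nat_mono card_mono) auto
  also have "\<dots> = n\<^sup>2"
    by (simp add: n_def power2_eq_square card_cartesian_product)
  finally have "real (n\<^sup>2) * (\<delta> * card R) \<le> real (n\<^sup>2) * 1"
    by (simp add: mult_ac)
  then have "\<delta> * card R \<le> 1"
    by (rule mult_left_le_imp_le) (use n in simp)
  then have cardR: "card R \<le> 1 / \<delta>"
    using pos by (simp add: field_simps)
  have "card (E j \<inter> (\<Union>xs\<in>R. K xs)) \<le> (\<Sum>xs\<in>R. card (K xs \<inter> E j))"
  proof -
    have "E j \<inter> (\<Union>xs\<in>R. K xs) = (\<Union>xs\<in>R. K xs \<inter> E j)"
      by auto
    then show ?thesis
      using card_UN_le[OF finR, of "\<lambda>xs. K xs \<inter> E j"] by simp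
  qed
  then have "real (card (E j \<inter> (\<Union>xs\<in>R. K xs))) \<le> (\<Sum>xs\<in>R. real (card (K xs \<inter> E j)))"
    by (metis of_nat_le_iff of_nat_sum)
  also have "\<dots> \<le> (\<Sum>xs\<in>R. \<delta>' * n\<^sup>2)"
    using R by (intro sum_mono) (auto simp: P_def bad_def not_less)
  also have "\<dots> = real (card R) * (\<delta>' * n\<^sup>2)"
    by simp
  also have "\<dots> \<le> (1 / \<delta>) * (\<delta>' * n\<^sup>2)"
    using cardR pos by (intro mult_right_mono) auto
  finally have lost: "card (E j \<inter> (\<Union>xs\<in>R. K xs)) \<le> \<delta>' / \<delta> * n\<^sup>2"
    by simp
  have "n\<^sup>2 * real (card {xs \<in> T. walk_of (E(j := D')) xs}) = (\<Sum>xs\<in>T. real (card (K xs \<inter> D')))"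
    using V(1) k sum_card_completions[of V k j E D', THEN arg_cong[of _ _ real]]
    by (simp add: T_def K_def n_def power2_eq_square)
  also have "\<dots> = (\<Sum>xs\<in>T - bad. real (card (K xs \<inter> D'))) + (\<Sum>xs\<in>bad. real (card (K xs \<inter> D')))"
    by (intro sum.subset_diff) (auto simp: bad_def finT)
  also have "\<dots> \<le> (\<Sum>xs\<in>T - bad. \<delta> * n\<^sup>2) + (\<Sum>xs\<in>bad. n\<^sup>2)"
  proof (intro add_mono)
    show "(\<Sum>xs\<in>T - bad. real (card (K xs \<inter> D'))) \<le> (\<Sum>xs\<in>T - bad. \<delta> * n\<^sup>2)"
      by (intro sum_mono good)
    have "card (K xs \<inter> D') \<le> n\<^sup>2" for xs
    proof -
      have "card (K xs \<inter> D') \<le> card (V \<times> V)"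
        using K_sub V by (intro card_mono) auto
      then show ?thesis
        by (simp add: n_def power2_eq_square card_cartesian_product)
    qed
    then show "(\<Sum>xs\<in>bad. real (card (K xs \<inter> D'))) \<le> (\<Sum>xs\<in>bad. n\<^sup>2)"
      unfolding of_nat_sum by (intro sum_mono) (metis of_nat_le_iff)
  qed
  also have "\<dots> \<le> n ^ k * (\<delta> * n\<^sup>2) + \<epsilon> / \<delta>' * n ^ k * n\<^sup>2"
  proof (intro add_mono)
    have "card (T - bad) \<le> n ^ k"
      using cardT finT by (metis Diff_subset card_mono)
    then have "real (card (T - bad)) \<le> real (n ^ k)"
      by (rule of_nat_mono)
    then have "real (card (T - bad)) * (\<delta> * n\<^sup>2) \<le> real (n ^ k) * (\<delta> * n\<^sup>2)"
      using pos by (intro mult_right_mono) auto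
    then show "(\<Sum>xs\<in>T - bad. \<delta> * n\<^sup>2) \<le> n ^ k * (\<delta> * n\<^sup>2)"
      by simp
    have "real (card bad) * n\<^sup>2 \<le> \<epsilon> / \<delta>' * n ^ k * n\<^sup>2"
      by (intro mult_right_mono bad) simp
    then show "real (\<Sum>xs\<in>bad. n\<^sup>2) \<le> \<epsilon> / \<delta>' * n ^ k * n\<^sup>2"
      by simp
  qed
  also have "\<dots> = n\<^sup>2 * ((\<delta> + \<epsilon> / \<delta>') * n ^ k)"
    by (simp add: algebra_simps)
  finally have "real (n\<^sup>2) * real (card {xs \<in> T. walk_of (E(j := D')) xs})
      \<le> real (n\<^sup>2) * ((\<delta> + \<epsilon> / \<delta>') * n ^ k)"
    by simp
  then have walks: "card {xs \<in> T. walk_of (E(j := D')) xs} \<le> (\<delta> + \<epsilon> / \<delta>') * n ^ k"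
    by (rule mult_left_le_imp_le) (use n in simp)
  define rect where "rect xs = (fst ` K xs, snd ` K xs)" for xs
  have rect: "rectangles (rect ` R) = (\<Union>xs\<in>R. K xs)"
  proof -
    have "fst ` K xs \<times> snd ` K xs = K xs" if "xs \<in> R" for xs
      using that R completions_rectangle[OF k, of xs V E] by (auto simp: P_def T_def tuples_def K_def)
    then show ?thesis
      by (auto simp: rectangles_def rect_def)
  qed
  show ?thesis
  proof (intro exI[of _ "rect ` R"] conjI)
    show "rect ` R \<subseteq> Pow V \<times> Pow V"
      using K_sub by (force simp: rect_def)
    show "card (rect ` R) \<le> 1 / \<delta>"
      using cardR card_image_le[OF finR, of rect] by linarith
  qed (use lost walks in \<open>simp_all add: rect n_def T_def D'_def\<close>)
qed


lemma walk_of_mono: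
  assumes "walk_of E xs" "\<And>i. i < length xs \<Longrightarrow> E i \<subseteq> E' i"
  shows "walk_of E' xs"
  using assms by (fastforce simp: walk_of_def)

text \<open>Rectangles added for a later position only shrink the complement, so the walks through
  the positions moved earlier stay rare. Positions from \<open>j\<close> on still use
  \<open>A\<close>, which is why the loss of \<open>E j\<close> in \<open>container_step\<close> is
  a loss of arcs of \<open>A\<close>.\<close>

lemma container_mixed:
  fixes k j :: nat and \<epsilon> :: real
  assumes k: "3 \<le> k" and "j \<le> k" "\<epsilon> > 0"
  shows "\<exists>\<epsilon>0::real. \<epsilon>0 > 0 \<and> (\<exists>L. \<forall>V::'a set. \<forall>A. finite V \<longrightarrow> V \<noteq> {} \<longrightarrow>
    card (walks V A k) \<le> \<epsilon>0 * card V ^ k \<longrightarrow>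
    (\<exists>R. R \<subseteq> Pow V \<times> Pow V \<and> card R \<le> L \<and> card (A \<inter> rectangles R) \<le> \<epsilon> * (card V)\<^sup>2 \<and>
      card {xs \<in> tuples V k. walk_of (\<lambda>i. if i < j then V \<times> V - rectangles R else A) xs}
        \<le> \<epsilon> * card V ^ k))"
  using assms(2,3)
proof (induction j arbitrary: \<epsilon>)
  case 0
  have "\<exists>R. R \<subseteq> Pow V \<times> Pow V \<and> card R \<le> 0 \<and> card (A \<inter> rectangles R) \<le> \<epsilon> * (card V)\<^sup>2 \<and>
      card {xs \<in> tuples V k. walk_of (\<lambda>i. if i < 0 then V \<times> V - rectangles R else A) xs}
        \<le> \<epsilon> * card V ^ k"
    if "card (walks V A k) \<le> \<epsilon> * card V ^ k" for V :: "'a set" and A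
    using that 0 by (intro exI[of _ "{}"]) (simp add: walks_def rectangles_def)
  then show ?case
    by (intro exI[of _ \<epsilon>] exI[of _ "0::nat"] conjI allI impI 0(2)) assumption
next
  case (Suc j)
  \<comment> \<open>The constants make \<delta>, the loss \<delta>'/\<delta> and the share
    \<epsilon>1/\<delta>' of bad tuples at most \<epsilon>/2 each; the other half of the loss is
    left to the previous positions.\<close>
  define \<delta> where "\<delta> = \<epsilon> / 2"
  define \<delta>' where "\<delta>' = \<delta> * (\<epsilon> / 2)"
  define \<epsilon>1 where "\<epsilon>1 = min (\<epsilon> / 2) (\<delta>' * (\<epsilon> / 2))"
  have pos: "\<delta> > 0" "\<delta>' > 0" "\<epsilon>1 > 0"
    using Suc.prems by (simp_all add: \<delta>_def \<delta>'_def \<epsilon>1_def)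
  have \<epsilon>1: "\<epsilon>1 \<le> \<epsilon> / 2" "\<epsilon>1 / \<delta>' \<le> \<epsilon> / 2" "\<delta>' / \<delta> = \<epsilon> / 2"
    using pos by (simp_all add: \<epsilon>1_def \<delta>'_def min_def field_simps)
  obtain \<epsilon>0 :: real and L where \<epsilon>0: "\<epsilon>0 > 0" and
    IH: "\<forall>V::'a set. \<forall>A. finite V \<longrightarrow> V \<noteq> {} \<longrightarrow> card (walks V A k) \<le> \<epsilon>0 * card V ^ k \<longrightarrow>
      (\<exists>R. R \<subseteq> Pow V \<times> Pow V \<and> card R \<le> L \<and> card (A \<inter> rectangles R) \<le> \<epsilon>1 * (card V)\<^sup>2 \<and>
      card {xs \<in> tuples V k. walk_of (\<lambda>i. if i < j then V \<times> V - rectangles R else A) xs}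
        \<le> \<epsilon>1 * card V ^ k)"
    using Suc.IH[OF Suc_leD[OF Suc.prems(1)] pos(3)] by (elim exE conjE) (rule that)
  show ?case
  proof (intro exI[of _ \<epsilon>0] exI[of _ "L + nat \<lceil>1 / \<delta>\<rceil>"] conjI allI impI \<epsilon>0)
    fix V :: "'a set" and A
    assume V: "finite V" "V \<noteq> {}" "card (walks V A k) \<le> \<epsilon>0 * card V ^ k"
    from IH[rule_format, OF this] obtain R where R: "R \<subseteq> Pow V \<times> Pow V" "card R \<le> L"
      "card (A \<inter> rectangles R) \<le> \<epsilon>1 * (card V)\<^sup>2" and
      few: "card {xs \<in> tuples V k. walk_of (\<lambda>i. if i < j then V \<times> V - rectangles R else A) xs}
        \<le> \<epsilon>1 * card V ^ k"
      by blast
    define D where "D = V \<times> V - rectangles R"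
    define E where "E = (\<lambda>i. if i < j then D else A)"
    have "\<exists>R'. R' \<subseteq> Pow V \<times> Pow V \<and> card R' \<le> 1 / \<delta> \<and>
      card (E j \<inter> rectangles R') \<le> \<delta>' / \<delta> * (card V)\<^sup>2 \<and>
      card {xs \<in> tuples V k. walk_of (E(j := D - rectangles R')) xs} \<le> (\<delta> + \<epsilon>1 / \<delta>') * card V ^ k"
    proof (rule container_step[OF V(1,2) k])
      show "card {xs \<in> tuples V k. walk_of E xs} \<le> \<epsilon>1 * card V ^ k"
        unfolding E_def D_def by (rule few)
    qed (use Suc.prems pos in \<open>auto simp: D_def\<close>)
    then obtain R' where R': "R' \<subseteq> Pow V \<times> Pow V" "card R' \<le> 1 / \<delta>"
      "card (A \<inter> rectangles R') \<le> \<epsilon> / 2 * (card V)\<^sup>2"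
      "card {xs \<in> tuples V k. walk_of (E(j := D - rectangles R')) xs} \<le> (\<delta> + \<epsilon>1 / \<delta>') * card V ^ k"
      using \<epsilon>1(3) by (auto simp: E_def)
    show "\<exists>R. R \<subseteq> Pow V \<times> Pow V \<and> card R \<le> L + nat \<lceil>1 / \<delta>\<rceil> \<and>
      card (A \<inter> rectangles R) \<le> \<epsilon> * (card V)\<^sup>2 \<and>
      card {xs \<in> tuples V k. walk_of (\<lambda>i. if i < Suc j then V \<times> V - rectangles R else A) xs}
        \<le> \<epsilon> * card V ^ k"
    proof (intro exI[of _ "R \<union> R'"] conjI)
      show "R \<union> R' \<subseteq> Pow V \<times> Pow V"
        using R R' by simp
      have "card R' \<le> nat \<lceil>1 / \<delta>\<rceil>"
        using R'(2) by linarith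
      then show "card (R \<union> R') \<le> L + nat \<lceil>1 / \<delta>\<rceil>"
        using card_Un_le[of R R'] R(2) by linarith
      have "card (A \<inter> rectangles (R \<union> R')) \<le> card (A \<inter> rectangles R) + card (A \<inter> rectangles R')"
        unfolding rectangles_Un Int_Un_distrib by (rule card_Un_le)
      moreover have "\<epsilon>1 * (card V)\<^sup>2 \<le> \<epsilon> / 2 * (card V)\<^sup>2"
        by (intro mult_right_mono \<epsilon>1) simp
      ultimately have "card (A \<inter> rectangles (R \<union> R')) \<le> \<epsilon> / 2 * (card V)\<^sup>2 + \<epsilon> / 2 * (card V)\<^sup>2"
        using R(3) R'(3) by linarith
      then show "card (A \<inter> rectangles (R \<union> R')) \<le> \<epsilon> * (card V)\<^sup>2"
        by simp
      have "{xs \<in> tuples V k. walk_of (\<lambda>i. if i < Suc j then V \<times> V - rectangles (R \<union> R') else A) xs}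
          \<subseteq> {xs \<in> tuples V k. walk_of (E(j := D - rectangles R')) xs}"
        by (auto simp: E_def D_def rectangles_Un elim!: walk_of_mono split: if_splits)
      then have "card {xs \<in> tuples V k. walk_of (\<lambda>i. if i < Suc j then V \<times> V - rectangles (R \<union> R') else A) xs}
          \<le> card {xs \<in> tuples V k. walk_of (E(j := D - rectangles R')) xs}"
        using V(1) by (intro card_mono) auto
      also have "\<dots> \<le> (\<delta> + \<epsilon>1 / \<delta>') * card V ^ k"
        by (rule R')
      also have "\<delta> + \<epsilon>1 / \<delta>' \<le> \<epsilon>"
        using \<epsilon>1(2) unfolding \<delta>_def by linarith
      then have "(\<delta> + \<epsilon>1 / \<delta>') * card V ^ k \<le> \<epsilon> * card V ^ k"
        by (intro mult_right_mono) auto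
      finally show "card {xs \<in> tuples V k. walk_of (\<lambda>i. if i < Suc j then V \<times> V - rectangles (R \<union> R') else A) xs}
          \<le> \<epsilon> * card V ^ k"
        by simp
    qed
  qed
qed

lemma container:
  fixes k :: nat and \<epsilon> :: real
  assumes "3 \<le> k" "\<epsilon> > 0"
  shows "\<exists>\<epsilon>0::real. \<epsilon>0 > 0 \<and> (\<exists>L. \<forall>V::'a set. \<forall>A. finite V \<longrightarrow> V \<noteq> {} \<longrightarrow>
    card (walks V A k) \<le> \<epsilon>0 * card V ^ k \<longrightarrow>
    (\<exists>R. R \<subseteq> Pow V \<times> Pow V \<and> card R \<le> L \<and> card (A \<inter> rectangles R) \<le> \<epsilon> * (card V)\<^sup>2 \<and>
      card (walks V (V \<times> V - rectangles R) k) \<le> \<epsilon> * card V ^ k))"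
proof -
  have "{xs \<in> tuples V k. walk_of (\<lambda>i. if i < k then D else A) xs} = walks V D k" for V :: "'a set" and D A
    by (auto simp: walks_def walk_of_def tuples_def)
  then show ?thesis
    using container_mixed[OF assms(1) order_refl assms(2), where 'a = 'a] by simp
qed

section \<open>Cloning vertices: degenerate closed walks\<close>

lemma card_clone:
  assumes V: "finite V" "V \<noteq> {}" and i: "i < r"
  shows "(card {\<phi> \<in> tuples V r. P \<phi>})\<^sup>2 * card V \<le>
    card {(\<phi>, u). \<phi> \<in> tuples V r \<and> u \<in> V \<and> P \<phi> \<and> P (\<phi>[i := u])} * card V ^ r"
proof -
  define n where "n = card V"
  have n: "0 < n"
    using V by (simp add: n_def card_gt_0_iff)
  define p where "p \<phi> = (of_bool (P \<phi>) :: nat)" for \<phi>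
  define a where "a \<phi> = (\<Sum>u\<in>V. p (\<phi>[i := u]))" for \<phi>
  have ok: "card {\<phi> \<in> tuples V r. P \<phi>} = (\<Sum>\<phi>\<in>tuples V r. p \<phi>)"
    unfolding p_def using V by (simp add: card_eq_sum_of_bool)
  have "{(\<phi>, u). \<phi> \<in> tuples V r \<and> u \<in> V \<and> P \<phi> \<and> P (\<phi>[i := u])} =
      {q \<in> tuples V r \<times> V. P (fst q) \<and> P ((fst q)[i := snd q])}"
    by auto
  then have "card {(\<phi>, u). \<phi> \<in> tuples V r \<and> u \<in> V \<and> P \<phi> \<and> P (\<phi>[i := u])} =
      (\<Sum>q\<in>tuples V r \<times> V. p (fst q) * p ((fst q)[i := snd q]))"
    using V card_eq_sum_of_bool[of "tuples V r \<times> V" "\<lambda>q. P (fst q) \<and> P ((fst q)[i := snd q])"]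
    by (simp add: p_def of_bool_conj)
  also have "\<dots> = (\<Sum>\<phi>\<in>tuples V r. p \<phi> * a \<phi>)"
    unfolding a_def sum_distrib_left sum.cartesian_product case_prod_beta ..
  finally have cl: "card {(\<phi>, u). \<phi> \<in> tuples V r \<and> u \<in> V \<and> P \<phi> \<and> P (\<phi>[i := u])} =
      (\<Sum>\<phi>\<in>tuples V r. p \<phi> * a \<phi>)" .
  have a_upd: "a (\<phi>[i := u]) = a \<phi>" for \<phi> u
    by (simp add: a_def)
  have sum_a: "(\<Sum>\<phi>\<in>tuples V r. a \<phi>) = n * (\<Sum>\<phi>\<in>tuples V r. p \<phi>)"
    unfolding a_def n_def by (rule sum_update_tuple[OF i])
  have "(\<Sum>\<phi>\<in>tuples V r. (a \<phi>)\<^sup>2) = (\<Sum>\<phi>\<in>tuples V r. \<Sum>u\<in>V. p (\<phi>[i := u]) * a (\<phi>[i := u]))"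
    unfolding a_upd by (simp add: a_def power2_eq_square sum_distrib_right)
  also have "\<dots> = n * (\<Sum>\<phi>\<in>tuples V r. p \<phi> * a \<phi>)"
    unfolding n_def by (rule sum_update_tuple[OF i])
  finally have sum_a2: "(\<Sum>\<phi>\<in>tuples V r. (a \<phi>)\<^sup>2) = n * (\<Sum>\<phi>\<in>tuples V r. p \<phi> * a \<phi>)" .
  \<comment> \<open>Cauchy-Schwarz for \<open>a \<phi>\<close>, the number of good values of entry
    \<open>i\<close> when the other entries are fixed.\<close>
  have "(\<Sum>\<phi>\<in>tuples V r. real (a \<phi>))\<^sup>2 \<le> (\<Sum>\<phi>\<in>tuples V r. (real (a \<phi>))\<^sup>2) * card (tuples V r)"
    by (rule sum_squared_le_sum_of_squares)
  then have "real ((\<Sum>\<phi>\<in>tuples V r. a \<phi>)\<^sup>2) \<le> real ((\<Sum>\<phi>\<in>tuples V r. (a \<phi>)\<^sup>2) * card (tuples V r))"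
    by simp
  then have "(\<Sum>\<phi>\<in>tuples V r. a \<phi>)\<^sup>2 \<le> (\<Sum>\<phi>\<in>tuples V r. (a \<phi>)\<^sup>2) * card (tuples V r)"
    by (simp only: of_nat_le_iff)
  then have "n * ((\<Sum>\<phi>\<in>tuples V r. p \<phi>)\<^sup>2 * n) \<le> n * ((\<Sum>\<phi>\<in>tuples V r. p \<phi> * a \<phi>) * n ^ r)"
    unfolding sum_a sum_a2 using V by (simp add: card_tuples n_def power2_eq_square mult_ac)
  then have "(\<Sum>\<phi>\<in>tuples V r. p \<phi>)\<^sup>2 * n \<le> (\<Sum>\<phi>\<in>tuples V r. p \<phi> * a \<phi>) * n ^ r"
    using n by simp
  then show ?thesis
    unfolding ok cl n_def .
qed

text \<open>
  A list \<open>x\<close> of length \<open>k\<close> over \<open>{..<r}\<close> prescribes which positions of a closed walk coincide.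
\<close>

definition pattern_walks :: "'a set \<Rightarrow> ('a \<times> 'a) set \<Rightarrow> nat list \<Rightarrow> nat \<Rightarrow> 'a list set" where
  "pattern_walks V D x r = {\<phi> \<in> tuples V r. closed_walk D (map ((!) \<phi>) x)}"

text \<open>Irreflexivity forbids equal vertices at neighbouring positions, so no neighbour of
  position \<open>b\<close> uses the index \<open>i\<close>. The arcs at \<open>b\<close> can
  therefore be taken from the walk with the clone \<open>u\<close>, and all others from the original
  walk.\<close>

lemma closed_walk_split:
  assumes irr: "irrefl D" and x: "set x \<subseteq> {..<r}" "length \<phi> = r"
    and ab: "b < length x" "x ! b = i"
    and ok: "closed_walk D (map ((!) \<phi>) x)" "closed_walk D (map ((!) (\<phi>[i := u])) x)"
  shows "closed_walk D (map ((!) (\<phi> @ [u])) (x[b := r]))"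
  unfolding walk_of_def
proof (intro allI impI)
  fix m assume m: "m < length (map ((!) (\<phi> @ [u])) (x[b := r]))"
  define m' where "m' = Suc m mod length x"
  have m: "m < length x"
    using m by simp
  then have m': "m' < length x"
    unfolding m'_def by (intro mod_less_divisor) linarith
  have lt: "x ! m < r" if "m < length x" for m
    using x that nth_mem[OF that] by blast
  have 1: "(\<phi> ! (x ! m), \<phi> ! (x ! m')) \<in> D"
    using ok(1) m m' by (auto simp: walk_of_def m'_def)
  have 2: "(\<phi>[i := u] ! (x ! m), \<phi>[i := u] ! (x ! m')) \<in> D"
    using ok(2) m m' by (auto simp: walk_of_def m'_def)
  have val: "(\<phi> @ [u]) ! (x[b := r] ! m) = (if m = b then u else \<phi> ! (x ! m))" if "m < length x" for m
    using that lt[OF that] x(2) by (auto simp: nth_append)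
  have upd: "\<phi>[i := u] ! (x ! m) = (if x ! m = i then u else \<phi> ! (x ! m))" if "m < length x" for m
    using lt[OF that] x(2) by auto
  have neq: "x ! m \<noteq> x ! m'"
    using 1 irr by (auto simp: irrefl_def)
  have "((\<phi> @ [u]) ! (x[b := r] ! m), (\<phi> @ [u]) ! (x[b := r] ! m')) \<in> D"
    unfolding val[OF m] val[OF m'] using 1 2 neq ab(2) unfolding upd[OF m] upd[OF m']
    by (auto split: if_splits)
  then show "(map ((!) (\<phi> @ [u])) (x[b := r]) ! m,
      map ((!) (\<phi> @ [u])) (x[b := r]) ! (Suc m mod length (map ((!) (\<phi> @ [u])) (x[b := r])))) \<in> D"
    using m m' by (simp add: m'_def)
qed

text \<open>A repeated index of the pattern is split in two by cloning, which at worst squares the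
  density. After \<open>k - r\<close> splits the pattern is injective and its walks are ordinary
  closed walks, so \<open>2 ^ (k - r)\<close> serves as exponent.\<close>

lemma pattern_walks_density:
  assumes "length x = k" "set x = {..<r}"
  shows "\<exists>e>0. \<forall>V::'a set. \<forall>D. finite V \<longrightarrow> V \<noteq> {} \<longrightarrow> irrefl D \<longrightarrow>
    (card (pattern_walks V D x r) / card V ^ r) ^ e \<le> card (walks V D k) / card V ^ k"
  using assms
proof (induction "k - r" arbitrary: x r)
  case 0
  have "card (set x) \<le> k"
    using card_length[of x] 0 by simp
  with 0 have r: "r = k"
    by simp
  have "card (pattern_walks V D x r) \<le> card (walks V D k)" if "finite V" for V :: "'a set" and D
  proof (rule card_inj_on_le)
    show "inj_on (\<lambda>\<phi>. map ((!) \<phi>) x) (pattern_walks V D x r)"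
    proof (rule inj_onI)
      fix \<phi> \<psi> assume *: "\<phi> \<in> pattern_walks V D x r" "\<psi> \<in> pattern_walks V D x r"
        "map ((!) \<phi>) x = map ((!) \<psi>) x"
      have "\<phi> ! j = \<psi> ! j" if "j < r" for j
        using that 0 *(3) by (simp add: map_eq_conv)
      then show "\<phi> = \<psi>"
        using * by (auto simp: list_eq_iff_nth_eq pattern_walks_def tuples_def)
    qed
    show "(\<lambda>\<phi>. map ((!) \<phi>) x) ` pattern_walks V D x r \<subseteq> walks V D k"
    proof (rule image_subsetI)
      fix \<phi> assume \<phi>: "\<phi> \<in> pattern_walks V D x r"
      have "\<phi> ! j \<in> V" if "j \<in> set x" for j
        using \<phi> that 0(3) tuples_nth[of \<phi> V r j] by (simp add: pattern_walks_def)
      then show "map ((!) \<phi>) x \<in> walks V D k"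
        using \<phi> 0(2) by (simp add: walks_def tuples_def pattern_walks_def image_subset_iff)
    qed
  qed (use that in auto)
  then show ?case
    unfolding r by (intro exI[of _ 1]) (auto intro!: divide_right_mono)
next
  case (Suc d)
  have "\<not> distinct x"
    using Suc.hyps(2) Suc.prems by (metis card_lessThan distinct_card diff_is_0_eq' nat.distinct(1) order_refl)
  then obtain a b where ab: "a < length x" "b < length x" "a \<noteq> b" "x ! a = x ! b"
    by (auto simp: distinct_conv_nth)
  \<comment> \<open>Occurrence \<open>b\<close> gets the fresh index \<open>r\<close>, while the old
    index survives at \<open>a\<close>; so the new pattern uses all of
    \<open>{..<Suc r}\<close>.\<close>
  define x' where "x' = x[b := r]"
  have "set x' = {..<Suc r}"
  proof
    show "set x' \<subseteq> {..<Suc r}"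
      using set_update_subset_insert[of x b r] Suc.prems by (auto simp: x'_def)
    have "j \<in> set x'" if j: "j < r" for j
    proof -
      obtain c where c: "c < length x" "x ! c = j"
        using Suc.prems j by (metis in_set_conv_nth lessThan_iff)
      define c' where "c' = (if c = b then a else c)"
      have "c' < length x'" "x' ! c' = j"
        using c ab by (auto simp: c'_def x'_def)
      then show ?thesis
        by (metis nth_mem)
    qed
    moreover have "r \<in> set x'"
      unfolding x'_def by (rule set_update_memI[OF ab(2)])
    ultimately show "{..<Suc r} \<subseteq> set x'"
      by (auto simp: less_Suc_eq)
  qed
  moreover have "d = k - Suc r" "length x' = k"
    using Suc.hyps(2) Suc.prems by (auto simp: x'_def)
  ultimately obtain e where e: "e > 0" and IH: "\<forall>V::'a set. \<forall>D. finite V \<longrightarrow> V \<noteq> {} \<longrightarrow> irrefl D \<longrightarrow>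
    (card (pattern_walks V D x' (Suc r)) / card V ^ (Suc r)) ^ e \<le> card (walks V D k) / card V ^ k"
    using Suc.hyps(1)[of "Suc r" x'] by blast
  show ?case
  proof (intro exI[of _ "2 * e"] conjI allI impI)
    fix V :: "'a set" and D :: "('a \<times> 'a) set"
    assume V: "finite V" "V \<noteq> {}" and irr: "irrefl D"
    define n where "n = card V"
    have n: "0 < n"
      using V by (simp add: n_def card_gt_0_iff)
    define i where "i = x ! b"
    define P where "P \<phi> = closed_walk D (map ((!) \<phi>) x)" for \<phi> :: "'a list"
    have i: "i < r"
      using Suc.prems ab nth_mem[OF ab(2)] by (auto simp: i_def)
    have "card {(\<phi>, u). \<phi> \<in> tuples V r \<and> u \<in> V \<and> P \<phi> \<and> P (\<phi>[i := u])} \<le> card (pattern_walks V D x' (Suc r))"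
    proof (rule card_inj_on_le)
      show "inj_on (\<lambda>(\<phi>, u). \<phi> @ [u]) {(\<phi>, u). \<phi> \<in> tuples V r \<and> u \<in> V \<and> P \<phi> \<and> P (\<phi>[i := u])}"
        by (auto simp: inj_on_def)
      show "(\<lambda>(\<phi>, u). \<phi> @ [u]) ` {(\<phi>, u). \<phi> \<in> tuples V r \<and> u \<in> V \<and> P \<phi> \<and> P (\<phi>[i := u])}
          \<subseteq> pattern_walks V D x' (Suc r)"
      proof clarsimp
        fix \<phi> u assume *: "\<phi> \<in> tuples V r" "u \<in> V" "P \<phi>" "P (\<phi>[i := u])"
        have "closed_walk D (map ((!) (\<phi> @ [u])) (x[b := r]))"
          using * ab Suc.prems by (intro closed_walk_split[OF irr]) (auto simp: tuples_def P_def i_def)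
        then show "\<phi> @ [u] \<in> pattern_walks V D x' (Suc r)"
          using * by (auto simp: pattern_walks_def tuples_def x'_def)
      qed
      show "finite (pattern_walks V D x' (Suc r))"
        using V by (simp add: pattern_walks_def)
    qed
    then have "(card (pattern_walks V D x r))\<^sup>2 * n \<le> card (pattern_walks V D x' (Suc r)) * n ^ r"
      using card_clone[OF V i, of P] mult_le_mono1[of _ _ "n ^ r"] unfolding pattern_walks_def P_def n_def
      by (meson order_trans)
    then have "real ((card (pattern_walks V D x r))\<^sup>2 * n) \<le> real (card (pattern_walks V D x' (Suc r)) * n ^ r)"
      by (rule of_nat_mono)
    then have "(card (pattern_walks V D x r) / n ^ r)\<^sup>2 \<le> card (pattern_walks V D x' (Suc r)) / n ^ Suc r"
      using n by (simp add: field_simps power2_eq_square)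
    then have "((card (pattern_walks V D x r) / n ^ r)\<^sup>2) ^ e \<le> (card (pattern_walks V D x' (Suc r)) / n ^ Suc r) ^ e"
      by (intro power_mono) auto
    also have "\<dots> \<le> card (walks V D k) / n ^ k"
      using IH[rule_format, OF V irr] by (simp add: n_def)
    finally show "(card (pattern_walks V D x r) / card V ^ r) ^ (2 * e) \<le> card (walks V D k) / card V ^ k"
      by (simp add: power_mult n_def)
  qed (use e in simp)
qed

section \<open>Double edges, triangles and the number of arcs\<close>

definition both_ways :: "('a \<times> 'a) set \<Rightarrow> ('a \<times> 'a) set" where
  "both_ways D = {(u, v). (u, v) \<in> D \<and> (v, u) \<in> D}"

definition nonadjacent :: "('a \<times> 'a) set \<Rightarrow> ('a \<times> 'a) set" where
  "nonadjacent D = {(u, v). (u, v) \<notin> D \<and> (v, u) \<notin> D}"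

lemma both_ways_sym: "(u, v) \<in> both_ways D \<longleftrightarrow> (v, u) \<in> both_ways D"
  by (auto simp: both_ways_def)

text \<open>Inclusion-exclusion for \<open>D\<close> and its converse. This is where the density 1/2
  comes from: only double edges lift the number of arcs above half of all pairs. Without loops, the
  diagonal counts as nonadjacent.\<close>

lemma card_square_eq:
  assumes "finite S"
  shows "2 * card (D \<inter> S \<times> S) + card (nonadjacent D \<inter> S \<times> S) = (card S)\<^sup>2 + card (both_ways D \<inter> S \<times> S)"
proof -
  have "card (D \<inter> S \<times> S) = card (D\<inverse> \<inter> S \<times> S)"
    by (rule bij_betw_same_card[of prod.swap]) (auto intro!: bij_betw_byWitness[where f' = prod.swap])
  then have "2 * card (D \<inter> S \<times> S) = card (D \<inter> S \<times> S) + card (D\<inverse> \<inter> S \<times> S)"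
    by simp
  also have "\<dots> = card (D \<inter> S \<times> S \<union> D\<inverse> \<inter> S \<times> S) + card ((D \<inter> S \<times> S) \<inter> (D\<inverse> \<inter> S \<times> S))"
    using assms by (intro card_Un_Int) auto
  also have "(D \<inter> S \<times> S) \<inter> (D\<inverse> \<inter> S \<times> S) = both_ways D \<inter> S \<times> S"
    by (auto simp: both_ways_def)
  finally have 1: "2 * card (D \<inter> S \<times> S) =
    card (D \<inter> S \<times> S \<union> D\<inverse> \<inter> S \<times> S) + card (both_ways D \<inter> S \<times> S)" .
  have "card (D \<inter> S \<times> S \<union> D\<inverse> \<inter> S \<times> S) + card (nonadjacent D \<inter> S \<times> S) =
      card ((D \<inter> S \<times> S \<union> D\<inverse> \<inter> S \<times> S) \<union> (nonadjacent D \<inter> S \<times> S))"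
    using assms by (intro card_Un_disjoint[symmetric]) (auto simp: nonadjacent_def)
  also have "(D \<inter> S \<times> S \<union> D\<inverse> \<inter> S \<times> S) \<union> (nonadjacent D \<inter> S \<times> S) = S \<times> S"
    by (auto simp: nonadjacent_def)
  finally show ?thesis
    using 1 by (simp add: card_cartesian_product power2_eq_square)
qed

lemma closed_walk_3: "closed_walk D [a, b, c] \<longleftrightarrow> (a, b) \<in> D \<and> (b, c) \<in> D \<and> (c, a) \<in> D"
proof -
  have "(\<forall>i<3. P i) \<longleftrightarrow> P 0 \<and> P 1 \<and> P (2::nat)" for P
    by (auto simp: less_Suc_eq numeral_3_eq_3 numeral_2_eq_2)
  from this[of "\<lambda>i. ([a, b, c] ! i, [a, b, c] ! (Suc i mod 3)) \<in> D"]
  have "(\<forall>i<3. ([a, b, c] ! i, [a, b, c] ! (Suc i mod 3)) \<in> D) \<longleftrightarrow> (a, b) \<in> D \<and> (b, c) \<in> D \<and> (c, a) \<in> D"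
    by simp
  moreover have "length [a, b, c] = 3"
    by simp
  ultimately show ?thesis
    unfolding walk_of_def by metis
qed

locale arc_set =
  fixes V :: "'a set" and D :: "('a \<times> 'a) set"
  assumes fin: "finite V" and sub: "D \<subseteq> V \<times> V" and irr: "irrefl D"
begin

lemma finD [simp, intro]: "finite D"
  using fin sub finite_subset by blast

lemma no_loop: "(v, v) \<notin> D"
  using irr by (simp add: irrefl_def)

text \<open>In a blow up, if \<open>u\<close> and \<open>v\<close> are joined both ways, every other
  \<open>w\<close> has exactly one of the arcs from \<open>w\<close> to \<open>u\<close> and from
  \<open>v\<close> to \<open>w\<close>. Excess and deficit count the two ways of violating this; the
  excess counts triangles on a double edge.\<close>

definition excess :: "'a \<Rightarrow> 'a \<Rightarrow> nat" where
  "excess u v = card {w \<in> V. (w, u) \<in> D \<and> (v, w) \<in> D}"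

definition deficit :: "'a \<Rightarrow> 'a \<Rightarrow> nat" where
  "deficit u v = card {w \<in> V. (w, u) \<notin> D \<and> (v, w) \<notin> D}"

lemma in_out_degree:
  assumes "finite S"
  shows "card {w \<in> S. (w, u) \<in> D} + card {w \<in> S. (v, w) \<in> D} + card {w \<in> S. (w, u) \<notin> D \<and> (v, w) \<notin> D}
    = card S + card {w \<in> S. (w, u) \<in> D \<and> (v, w) \<in> D}"
proof -
  have "card {w \<in> S. (w, u) \<in> D} + card {w \<in> S. (v, w) \<in> D} =
      card ({w \<in> S. (w, u) \<in> D} \<union> {w \<in> S. (v, w) \<in> D}) + card ({w \<in> S. (w, u) \<in> D} \<inter> {w \<in> S. (v, w) \<in> D})"
    using assms by (intro card_Un_Int) auto
  moreover have "card ({w \<in> S. (w, u) \<in> D} \<union> {w \<in> S. (v, w) \<in> D}) + card {w \<in> S. (w, u) \<notin> D \<and> (v, w) \<notin> D} =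
      card (({w \<in> S. (w, u) \<in> D} \<union> {w \<in> S. (v, w) \<in> D}) \<union> {w \<in> S. (w, u) \<notin> D \<and> (v, w) \<notin> D})"
    using assms by (intro card_Un_disjoint[symmetric]) auto
  moreover have "({w \<in> S. (w, u) \<in> D} \<union> {w \<in> S. (v, w) \<in> D}) \<union> {w \<in> S. (w, u) \<notin> D \<and> (v, w) \<notin> D} = S"
    by auto
  moreover have "{w \<in> S. (w, u) \<in> D} \<inter> {w \<in> S. (v, w) \<in> D} = {w \<in> S. (w, u) \<in> D \<and> (v, w) \<in> D}"
    by auto
  ultimately show ?thesis
    by simp
qed

text \<open>The arcs between \<open>T\<close> and the pair are grouped into those entering
  \<open>u\<close> or leaving \<open>v\<close>, and those entering \<open>v\<close> or leaving
  \<open>u\<close>. By \<open>in_out_degree\<close> each group has \<open>card T\<close> plus excess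
  minus deficit elements. The set \<open>C\<close> absorbs the arcs inside the pair when
  \<open>T\<close> avoids the pair.\<close>

lemma card_arcs_delete_pair:
  assumes T: "finite T"
    and sub': "D \<inter> S \<times> S \<subseteq> C \<union> (D \<inter> S' \<times> S') \<union> {(w, z) \<in> D. w \<in> T \<and> z \<in> {u, v} \<or> z \<in> T \<and> w \<in> {u, v}}"
    and C: "finite C"
  shows "card (D \<inter> S \<times> S) + card {w \<in> T. (w, u) \<notin> D \<and> (v, w) \<notin> D} + card {w \<in> T. (w, v) \<notin> D \<and> (u, w) \<notin> D}
    \<le> card C + card (D \<inter> S' \<times> S') + 2 * card T
      + card {w \<in> T. (w, u) \<in> D \<and> (v, w) \<in> D} + card {w \<in> T. (w, v) \<in> D \<and> (u, w) \<in> D}"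
proof -
  let ?I = "\<lambda>x. {w \<in> T. (w, x) \<in> D}" and ?O = "\<lambda>x. {w \<in> T. (x, w) \<in> D}"
  have "D \<inter> S \<times> S \<subseteq> C \<union> (D \<inter> S' \<times> S') \<union> ((\<lambda>w. (w, u)) ` ?I u \<union> Pair v ` ?O v) \<union> ((\<lambda>w. (w, v)) ` ?I v \<union> Pair u ` ?O u)"
    using sub' by fastforce
  then have "card (D \<inter> S \<times> S) \<le>
      card (C \<union> (D \<inter> S' \<times> S') \<union> ((\<lambda>w. (w, u)) ` ?I u \<union> Pair v ` ?O v) \<union> ((\<lambda>w. (w, v)) ` ?I v \<union> Pair u ` ?O u))"
    using T C by (intro card_mono) auto
  also have "\<dots> \<le> card C + card (D \<inter> S' \<times> S') + (card (?I u) + card (?O v)) + (card (?I v) + card (?O u))"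
    by (intro order_trans[OF card_Un_le] add_mono order_trans[OF card_image_le] order_refl)
      (use T C in auto)
  finally show ?thesis
    using in_out_degree[OF T, of u v] in_out_degree[OF T, of v u] by linarith
qed

text \<open>Induction by deleting a double edge of small excess. If s vertices remain, at most 2s +
  2 + 2\<theta> arcs are lost, and 2s + 2 is exactly the growth of s^2/2 when two vertices are
  added. Once all double edges lie in \<open>C\<close>, \<open>card_square_eq\<close> gives the
  bound.\<close>

lemma arcs_upper_bound:
  fixes \<theta> :: real
  assumes "S \<subseteq> V" "finite C" "0 \<le> \<theta>"
    and C: "\<And>u v. (u, v) \<in> both_ways D \<Longrightarrow> (u, v) \<notin> C \<Longrightarrow> excess u v + excess v u \<le> 2 * \<theta>"
  shows "card (D \<inter> S \<times> S) \<le> (card S)\<^sup>2 / 2 + \<theta> * card S + card C"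
  using assms(1)
proof (induction "card S" arbitrary: S rule: less_induct)
  case less
  have finS: "finite S"
    using less.prems fin finite_subset by blast
  show ?case
  proof (cases "both_ways D \<inter> S \<times> S \<subseteq> C")
    case True
    then have "card (both_ways D \<inter> S \<times> S) \<le> card C"
      by (intro card_mono assms)
    then have "2 * card (D \<inter> S \<times> S) \<le> (card S)\<^sup>2 + card C"
      using card_square_eq[OF finS, of D] by linarith
    then have "real (2 * card (D \<inter> S \<times> S)) \<le> real ((card S)\<^sup>2 + card C)"
      by (rule of_nat_mono)
    moreover have "0 \<le> \<theta> * card S"
      using assms by simp
    ultimately show ?thesis
      by simp
  next
    case False
    then obtain u v where uv: "(u, v) \<in> both_ways D" "u \<in> S" "v \<in> S" "(u, v) \<notin> C"
      by auto
    have ne: "u \<noteq> v"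
      using uv(1) no_loop by (auto simp: both_ways_def)
    define S' where "S' = S - {u, v}"
    have S: "S' \<subseteq> V" "finite S'" "S = insert u (insert v S')" "u \<notin> S'" "v \<notin> S'"
      using less.prems finS uv by (auto simp: S'_def)
    have cardS: "card S = Suc (Suc (card S'))"
      using S ne by simp
    have "card (D \<inter> S \<times> S) + card {w \<in> S'. (w, u) \<notin> D \<and> (v, w) \<notin> D} + card {w \<in> S'. (w, v) \<notin> D \<and> (u, w) \<notin> D}
      \<le> card {(u, v), (v, u)} + card (D \<inter> S' \<times> S') + 2 * card S'
        + card {w \<in> S'. (w, u) \<in> D \<and> (v, w) \<in> D} + card {w \<in> S'. (w, v) \<in> D \<and> (u, w) \<in> D}"
      using S no_loop by (intro card_arcs_delete_pair) auto
    moreover have "card {w \<in> S'. (w, u) \<in> D \<and> (v, w) \<in> D} \<le> excess u v"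
      "card {w \<in> S'. (w, v) \<in> D \<and> (u, w) \<in> D} \<le> excess v u"
      unfolding excess_def using S fin by (auto intro!: card_mono)
    moreover have "card {(u, v), (v, u)} = 2"
      using ne by simp
    ultimately have "card (D \<inter> S \<times> S) \<le> card (D \<inter> S' \<times> S') + 2 * card S' + 2 + (excess u v + excess v u)"
      by linarith
    then have "real (card (D \<inter> S \<times> S)) \<le> real (card (D \<inter> S' \<times> S') + 2 * card S' + 2 + (excess u v + excess v u))"
      by (rule of_nat_mono)
    also have "\<dots> = real (card (D \<inter> S' \<times> S')) + 2 * card S' + 2 + real (excess u v + excess v u)"
      by simp
    also have "\<dots> \<le> ((card S')\<^sup>2 / 2 + \<theta> * card S' + card C) + 2 * card S' + 2 + 2 * \<theta>"
      using less.hyps[of S'] S cardS C[OF uv(1,4)] by (intro add_mono) auto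
    also have "\<dots> = (card S)\<^sup>2 / 2 + \<theta> * card S + card C"
      unfolding cardS by (simp add: power2_eq_square algebra_simps)
    finally show ?thesis .
  qed
qed

text \<open>At most 4qn pairs meet the 2q vertices deleted so far, so \<open>X\<close> still has a
  pair disjoint from them. Large deficits make each deletion cheap; many cheap deletions will
  contradict the upper bound for the remaining vertices.\<close>

lemma delete_deficient_pairs:
  fixes \<theta> \<mu> :: real
  assumes X: "X \<subseteq> both_ways D"
    and exc: "\<And>u v. (u, v) \<in> X \<Longrightarrow> excess u v + excess v u \<le> 2 * \<theta>"
    and dfc: "\<And>u v. (u, v) \<in> X \<Longrightarrow> deficit u v + deficit v u \<ge> \<mu>"
    and "4 * q * card V < card X"
  shows "\<exists>S\<subseteq>V. card S + 2 * q = card V \<and>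
    card D \<le> card (D \<inter> S \<times> S) + q * (2 * card V + 2 * \<theta> - \<mu>)"
  using assms(4)
proof (induction q)
  case 0
  have "D \<inter> V \<times> V = D"
    using sub by auto
  then show ?case
    by (intro exI[of _ V]) simp
next
  case (Suc q)
  have "4 * q * card V < card X"
    using Suc.prems by (simp add: algebra_simps)
  with Suc.IH obtain S where S: "S \<subseteq> V" "card S + 2 * q = card V"
    "card D \<le> card (D \<inter> S \<times> S) + q * (2 * card V + 2 * \<theta> - \<mu>)"
    by blast
  have finS: "finite S"
    using S fin finite_subset by blast
  have "\<not> X \<subseteq> (V - S) \<times> V \<union> V \<times> (V - S)"
  proof
    assume "X \<subseteq> (V - S) \<times> V \<union> V \<times> (V - S)"
    then have "card X \<le> card ((V - S) \<times> V \<union> V \<times> (V - S))"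
      using fin by (intro card_mono) auto
    also have "\<dots> \<le> card (V - S) * card V + card V * card (V - S)"
      by (rule order_trans[OF card_Un_le]) (simp add: card_cartesian_product)
    also have "card (V - S) = 2 * q"
      using S finS by (simp add: card_Diff_subset)
    finally show False
      using Suc.prems by (simp add: algebra_simps)
  qed
  then obtain u v where uv: "(u, v) \<in> X" "u \<in> S" "v \<in> S"
    using X sub by (auto simp: both_ways_def)
  have ne: "u \<noteq> v"
    using uv(1) no_loop X by (auto simp: both_ways_def)
  define S' where "S' = S - {u, v}"
  have S': "S' \<subseteq> V" "S = insert u (insert v S')" "u \<notin> S'" "v \<notin> S'" "finite S'"
    using S finS uv by (auto simp: S'_def)
  \<comment> \<open>With all of \<open>V\<close> in the role of \<open>T\<close>, the arcs inside
    the pair are covered too, and the full deficits, which are counted over \<open>V\<close>,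
    appear.\<close>
  have "card (D \<inter> S \<times> S) + card {w \<in> V. (w, u) \<notin> D \<and> (v, w) \<notin> D} + card {w \<in> V. (w, v) \<notin> D \<and> (u, w) \<notin> D}
    \<le> card ({} :: ('a \<times> 'a) set) + card (D \<inter> S' \<times> S') + 2 * card V
      + card {w \<in> V. (w, u) \<in> D \<and> (v, w) \<in> D} + card {w \<in> V. (w, v) \<in> D \<and> (u, w) \<in> D}"
    using S S' uv fin by (intro card_arcs_delete_pair) auto
  then have "card (D \<inter> S \<times> S) + (deficit u v + deficit v u) \<le>
      card (D \<inter> S' \<times> S') + 2 * card V + (excess u v + excess v u)"
    unfolding excess_def deficit_def by simp
  then have "real (card (D \<inter> S \<times> S) + (deficit u v + deficit v u)) \<le>
      real (card (D \<inter> S' \<times> S') + 2 * card V + (excess u v + excess v u))"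
    by (rule of_nat_mono)
  then have "card (D \<inter> S \<times> S) \<le> card (D \<inter> S' \<times> S') + (2 * card V + 2 * \<theta> - \<mu>)"
    using exc[OF uv(1)] dfc[OF uv(1)] by simp
  then have "card D \<le> card (D \<inter> S' \<times> S') + Suc q * (2 * card V + 2 * \<theta> - \<mu>)"
    using S(3) by (simp add: algebra_simps)
  moreover have "card S = Suc (Suc (card S'))"
    using S' ne by simp
  ultimately show ?case
    using S S' by (intro exI[of _ S']) auto
qed


section \<open>Triples that do not fit a blow up\<close>

definition unbalanced :: "('a \<times> 'a \<times> 'a) set" where
  "unbalanced = {(u, v, w). (u, v) \<in> both_ways D \<and> w \<in> V \<and> ((w, u) \<in> D \<longleftrightarrow> (v, w) \<in> D)}"

definition split_nonadjacent :: "('a \<times> 'a \<times> 'a) set" where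
  "split_nonadjacent = {(v, w, x). v \<in> V \<and> w \<in> V \<and> x \<in> V \<and> (v, w) \<in> nonadjacent D \<and>
     \<not> (((x, v) \<in> D \<longleftrightarrow> (x, w) \<in> D) \<and> ((v, x) \<in> D \<longleftrightarrow> (w, x) \<in> D))}"

definition triangles :: "('a \<times> 'a \<times> 'a) set" where
  "triangles = {(a, b, c). (a, b) \<in> D \<and> (b, c) \<in> D \<and> (c, a) \<in> D}"

definition double_degree :: "'a \<Rightarrow> nat" where
  "double_degree v = card {u \<in> V. (v, u) \<in> both_ways D}"

lemma finite_both_ways [simp]: "finite (both_ways D)"
  by (rule finite_subset[of _ D]) (auto simp: both_ways_def)

lemma both_ways_V: "(u, v) \<in> both_ways D \<Longrightarrow> u \<in> V \<and> v \<in> V"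
  using sub by (auto simp: both_ways_def)

lemma finite_triples [simp]: "finite unbalanced" "finite split_nonadjacent" "finite triangles"
proof -
  have "finite (V \<times> V \<times> V)"
    using fin by simp
  then show "finite unbalanced" "finite split_nonadjacent" "finite triangles"
    by (rule finite_subset[rotated], use sub in \<open>auto simp: unbalanced_def split_nonadjacent_def triangles_def both_ways_def\<close>)+
qed

text \<open>Let \<open>u\<close> be doubly joined to \<open>v\<close>. If \<open>w\<close> is
  balanced over this double edge, then \<open>u\<close> is doubly joined to \<open>w\<close> as
  well, because \<open>v\<close> and \<open>w\<close> are nonadjacent; and if \<open>x\<close> is
  balanced over both double edges, it sees \<open>v\<close> and \<open>w\<close> alike. So every
  such \<open>u\<close> turns a split triple into one of six unbalanced triples.\<close>

lemma sum_double_degree_split_nonadjacent: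
  "(\<Sum>(v, w, x)\<in>split_nonadjacent. double_degree v) \<le> 6 * (card unbalanced * card V)"
proof -
  let ?B = "unbalanced"
  define Q where "Q = (SIGMA p:split_nonadjacent. {u \<in> V. (fst p, u) \<in> both_ways D})"
  have "(\<Sum>(v, w, x)\<in>split_nonadjacent. double_degree v) = card Q"
    unfolding Q_def using fin by (subst card_SigmaI) (auto simp: double_degree_def case_prod_beta)
  also have "\<dots> \<le> card
      (((\<lambda>((u, v, w), x). ((v, w, x), u)) ` (?B \<times> V) \<union> (\<lambda>((v, u, w), x). ((v, w, x), u)) ` (?B \<times> V)) \<union>
       ((\<lambda>((u, v, x), w). ((v, w, x), u)) ` (?B \<times> V) \<union> (\<lambda>((v, u, x), w). ((v, w, x), u)) ` (?B \<times> V)) \<union>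
       ((\<lambda>((u, w, x), v). ((v, w, x), u)) ` (?B \<times> V) \<union> (\<lambda>((w, u, x), v). ((v, w, x), u)) ` (?B \<times> V)))"
  proof (rule card_mono)
    show "Q \<subseteq> ((\<lambda>((u, v, w), x). ((v, w, x), u)) ` (?B \<times> V) \<union> (\<lambda>((v, u, w), x). ((v, w, x), u)) ` (?B \<times> V)) \<union>
       ((\<lambda>((u, v, x), w). ((v, w, x), u)) ` (?B \<times> V) \<union> (\<lambda>((v, u, x), w). ((v, w, x), u)) ` (?B \<times> V)) \<union>
       ((\<lambda>((u, w, x), v). ((v, w, x), u)) ` (?B \<times> V) \<union> (\<lambda>((w, u, x), v). ((v, w, x), u)) ` (?B \<times> V))"
    proof
      fix q assume "q \<in> Q"
      then obtain v w x u where q: "q = ((v, w, x), u)" "(v, w, x) \<in> split_nonadjacent"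
        "u \<in> V" "(v, u) \<in> both_ways D"
        by (auto simp: Q_def)
      then have V: "v \<in> V" "w \<in> V" "x \<in> V"
        by (auto simp: split_nonadjacent_def)
      have "(u, v, w) \<in> ?B \<or> (v, u, w) \<in> ?B \<or> (u, v, x) \<in> ?B \<or> (v, u, x) \<in> ?B \<or>
          (u, w, x) \<in> ?B \<or> (w, u, x) \<in> ?B"
        using q(2-4) by (simp add: split_nonadjacent_def unbalanced_def both_ways_def nonadjacent_def) blast
      moreover have "q \<in> (\<lambda>((u, v, w), x). ((v, w, x), u)) ` (?B \<times> V)" if "(u, v, w) \<in> ?B"
        using q V that by (intro image_eqI[of _ _ "((u, v, w), x)"]) simp_all
      moreover have "q \<in> (\<lambda>((v, u, w), x). ((v, w, x), u)) ` (?B \<times> V)" if "(v, u, w) \<in> ?B"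
        using q V that by (intro image_eqI[of _ _ "((v, u, w), x)"]) simp_all
      moreover have "q \<in> (\<lambda>((u, v, x), w). ((v, w, x), u)) ` (?B \<times> V)" if "(u, v, x) \<in> ?B"
        using q V that by (intro image_eqI[of _ _ "((u, v, x), w)"]) simp_all
      moreover have "q \<in> (\<lambda>((v, u, x), w). ((v, w, x), u)) ` (?B \<times> V)" if "(v, u, x) \<in> ?B"
        using q V that by (intro image_eqI[of _ _ "((v, u, x), w)"]) simp_all
      moreover have "q \<in> (\<lambda>((u, w, x), v). ((v, w, x), u)) ` (?B \<times> V)" if "(u, w, x) \<in> ?B"
        using q V that by (intro image_eqI[of _ _ "((u, w, x), v)"]) simp_all
      moreover have "q \<in> (\<lambda>((w, u, x), v). ((v, w, x), u)) ` (?B \<times> V)" if "(w, u, x) \<in> ?B"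
        using q V that by (intro image_eqI[of _ _ "((w, u, x), v)"]) simp_all
      ultimately show "q \<in> ((\<lambda>((u, v, w), x). ((v, w, x), u)) ` (?B \<times> V) \<union> (\<lambda>((v, u, w), x). ((v, w, x), u)) ` (?B \<times> V)) \<union>
       ((\<lambda>((u, v, x), w). ((v, w, x), u)) ` (?B \<times> V) \<union> (\<lambda>((v, u, x), w). ((v, w, x), u)) ` (?B \<times> V)) \<union>
       ((\<lambda>((u, w, x), v). ((v, w, x), u)) ` (?B \<times> V) \<union> (\<lambda>((w, u, x), v). ((v, w, x), u)) ` (?B \<times> V))"
        unfolding Un_iff by argo
    qed
  qed (use fin in auto)
  also have "\<dots> \<le> (card (?B \<times> V) + card (?B \<times> V)) + (card (?B \<times> V) + card (?B \<times> V)) +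
      (card (?B \<times> V) + card (?B \<times> V))"
    by (intro order_trans[OF card_Un_le] add_mono card_image_le) (use fin in auto)
  finally show ?thesis
    by (simp add: card_cartesian_product)
qed

text \<open>Split triples whose first vertex has large double degree are counted through their many
  extensions by double edges. Splitting is symmetric in the two nonadjacent vertices, so only pairs
  inside \<open>L\<close> are left, and those are bounded trivially.\<close>

lemma card_split_nonadjacent:
  fixes \<delta> :: real
  assumes "0 < \<delta>"
  defines "L \<equiv> {v \<in> V. double_degree v < \<delta>}"
  shows "card split_nonadjacent \<le> 12 / \<delta> * card unbalanced * card V + card (nonadjacent D \<inter> L \<times> L) * card V"
proof -
  let ?Y = split_nonadjacent
  define Y1 where "Y1 = {p \<in> ?Y. fst p \<notin> L}"
  have finL: "finite L"
    using fin by (simp add: L_def)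
  have "card Y1 * \<delta> = (\<Sum>p\<in>Y1. \<delta>)"
    by simp
  also have "\<dots> \<le> (\<Sum>p\<in>Y1. real (double_degree (fst p)))"
    by (intro sum_mono) (auto simp: Y1_def L_def split_nonadjacent_def)
  also have "\<dots> \<le> (\<Sum>p\<in>?Y. real (double_degree (fst p)))"
    by (intro sum_mono2) (auto simp: Y1_def)
  also have "\<dots> = real (\<Sum>(v, w, x)\<in>?Y. double_degree v)"
    by (simp add: case_prod_beta)
  also have "\<dots> \<le> real (6 * (card unbalanced * card V))"
    by (intro of_nat_mono sum_double_degree_split_nonadjacent)
  finally have Y1: "card Y1 \<le> 6 / \<delta> * card unbalanced * card V"
    using assms by (simp add: field_simps)
  have "?Y \<subseteq> Y1 \<union> (\<lambda>(v, w, x). (w, v, x)) ` Y1 \<union> (\<lambda>((v, w), x). (v, w, x)) ` ((nonadjacent D \<inter> L \<times> L) \<times> V)"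
  proof
    fix p assume p: "p \<in> ?Y"
    obtain v w x where vwx: "p = (v, w, x)"
      by (cases p)
    have "(w, v, x) \<in> ?Y"
      using p by (auto simp: vwx split_nonadjacent_def nonadjacent_def)
    then have "p \<in> (\<lambda>(v, w, x). (w, v, x)) ` Y1" if "w \<notin> L"
      using that by (intro image_eqI[of _ _ "(w, v, x)"]) (simp_all add: vwx Y1_def)
    moreover have "p \<in> Y1" if "v \<notin> L"
      using that p by (simp add: vwx Y1_def)
    moreover have "p \<in> (\<lambda>((v, w), x). (v, w, x)) ` ((nonadjacent D \<inter> L \<times> L) \<times> V)" if "v \<in> L" "w \<in> L"
      using that p by (intro image_eqI[of _ _ "((v, w), x)"]) (simp_all add: vwx split_nonadjacent_def)
    ultimately show "p \<in> Y1 \<union> (\<lambda>(v, w, x). (w, v, x)) ` Y1 \<union> (\<lambda>((v, w), x). (v, w, x)) ` ((nonadjacent D \<inter> L \<times> L) \<times> V)"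
      unfolding Un_iff by argo
  qed
  then have "card ?Y \<le> card (Y1 \<union> (\<lambda>(v, w, x). (w, v, x)) ` Y1 \<union> (\<lambda>((v, w), x). (v, w, x)) ` ((nonadjacent D \<inter> L \<times> L) \<times> V))"
    using fin finL by (intro card_mono) (auto simp: Y1_def)
  also have "\<dots> \<le> card Y1 + card Y1 + card ((nonadjacent D \<inter> L \<times> L) \<times> V)"
    by (intro order_trans[OF card_Un_le] add_mono card_image_le order_refl) (use fin finL in \<open>auto simp: Y1_def\<close>)
  finally have "real (card ?Y) \<le> real (card Y1 + card Y1 + card ((nonadjacent D \<inter> L \<times> L) \<times> V))"
    by (rule of_nat_mono)
  then have "real (card ?Y) \<le> 2 * card Y1 + card (nonadjacent D \<inter> L \<times> L) * card V"
    by (simp add: card_cartesian_product)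
  moreover have "2 * card Y1 \<le> 12 / \<delta> * card unbalanced * card V"
    using mult_left_mono[OF Y1, of 2] by simp
  ultimately show ?thesis
    by linarith
qed

text \<open>Subtracting the identity \<open>card_square_eq\<close> for \<open>V - L\<close> from
  that for \<open>V\<close> isolates the nonadjacent pairs inside \<open>L\<close>: double edges not
  inside \<open>V - L\<close> have an end in \<open>L\<close> and are few, and the arcs inside
  \<open>V - L\<close> are bounded by assumption. In a dense digraph, the part of low double degree
  is thus nearly a tournament.\<close>

lemma card_nonadjacent_low:
  fixes \<delta> \<kappa> :: real
  assumes "0 \<le> \<delta>"
  defines "L \<equiv> {v \<in> V. double_degree v < \<delta>}"
  assumes upper: "card (D \<inter> (V - L) \<times> (V - L)) \<le> (card (V - L))\<^sup>2 / 2 + \<kappa>"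
  shows "card (nonadjacent D \<inter> L \<times> L) \<le> (real (card V))\<^sup>2 - 2 * real (card D) + 2 * \<kappa> + 2 * (\<delta> * card V)"
proof -
  define H where "H = V - L"
  have finH: "finite H" "finite L"
    using fin by (simp_all add: H_def L_def)
  have "card (nonadjacent D \<inter> L \<times> L) + card (nonadjacent D \<inter> H \<times> H) =
      card (nonadjacent D \<inter> L \<times> L \<union> nonadjacent D \<inter> H \<times> H)"
    using finH by (intro card_Un_disjoint[symmetric]) (auto simp: H_def)
  also have "\<dots> \<le> card (nonadjacent D \<inter> V \<times> V)"
    using fin by (intro card_mono) (auto simp: H_def L_def)
  finally have 1: "card (nonadjacent D \<inter> L \<times> L) + card (nonadjacent D \<inter> H \<times> H) \<le> card (nonadjacent D \<inter> V \<times> V)" .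
  define M where "M = (SIGMA v:L. {u \<in> V. (v, u) \<in> both_ways D})"
  have "card M = (\<Sum>v\<in>L. double_degree v)"
    unfolding M_def double_degree_def using finH fin by (intro card_SigmaI) auto
  then have "real (card M) = (\<Sum>v\<in>L. real (double_degree v))"
    by simp
  also have "\<dots> \<le> (\<Sum>v\<in>L. \<delta>)"
    by (intro sum_mono) (auto simp: L_def)
  also have "\<dots> \<le> \<delta> * card V"
    using assms(1) fin by (simp add: L_def mult.commute mult_left_mono card_mono)
  finally have M: "card M \<le> \<delta> * card V" .
  have finM: "finite M"
    using finH fin by (auto simp: M_def)
  have "both_ways D \<inter> V \<times> V \<subseteq> both_ways D \<inter> H \<times> H \<union> M \<union> prod.swap ` M"
  proof
    fix p assume p: "p \<in> both_ways D \<inter> V \<times> V"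
    obtain u v where uv: "p = (u, v)"
      by (cases p)
    have "(v, u) \<in> both_ways D"
      using p uv by (simp add: both_ways_sym)
    then have "p \<in> prod.swap ` M" if "v \<in> L"
      using that p by (intro image_eqI[of _ _ "(v, u)"]) (simp_all add: uv M_def)
    moreover have "p \<in> M" if "u \<in> L"
      using that p by (simp add: uv M_def)
    moreover have "p \<in> both_ways D \<inter> H \<times> H" if "u \<notin> L" "v \<notin> L"
      using that p by (simp add: uv H_def)
    ultimately show "p \<in> both_ways D \<inter> H \<times> H \<union> M \<union> prod.swap ` M"
      unfolding Un_iff by argo
  qed
  then have "card (both_ways D \<inter> V \<times> V) \<le> card (both_ways D \<inter> H \<times> H \<union> M \<union> prod.swap ` M)"
    using finM finH by (intro card_mono) auto
  also have "\<dots> \<le> card (both_ways D \<inter> H \<times> H) + card M + card M"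
    by (intro order_trans[OF card_Un_le] add_mono card_image_le order_refl finM)
  finally have 2: "card (both_ways D \<inter> V \<times> V) \<le> card (both_ways D \<inter> H \<times> H) + 2 * card M"
    by simp
  have "D \<inter> V \<times> V = D"
    using sub by auto
  then have "2 * card D + card (nonadjacent D \<inter> V \<times> V) = (card V)\<^sup>2 + card (both_ways D \<inter> V \<times> V)"
    using card_square_eq[OF fin, of D] by simp
  moreover note card_square_eq[OF finH(1), of D]
  ultimately have "2 * card D + card (nonadjacent D \<inter> L \<times> L) + (card H)\<^sup>2
      \<le> (card V)\<^sup>2 + 2 * card M + 2 * card (D \<inter> H \<times> H)"
    using 1 2 by linarith
  then have "real (2 * card D + card (nonadjacent D \<inter> L \<times> L) + (card H)\<^sup>2)
      \<le> real ((card V)\<^sup>2 + 2 * card M + 2 * card (D \<inter> H \<times> H))"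
    by (rule of_nat_mono)
  then show ?thesis
    using M upper unfolding H_def[symmetric] by (simp add: field_simps)
qed

text \<open>A triangle with a vertex outside \<open>L\<close> extends in at least \<delta> ways by a
  double edge at that vertex; the factor 3 is for the rotation that brings it to the front.\<close>

lemma card_triangles:
  fixes \<delta> :: real
  assumes "0 < \<delta>"
  defines "L \<equiv> {v \<in> V. double_degree v < \<delta>}"
  shows "card triangles \<le> 3 / \<delta> * card {(a, b, c, d). (a, b, c) \<in> triangles \<and> (a, d) \<in> both_ways D}
    + card (walks L (D \<inter> L \<times> L) 3)"
proof -
  let ?Q = "{(a, b, c, d). (a, b, c) \<in> triangles \<and> (a, d) \<in> both_ways D}"
  define Y where "Y = {p \<in> triangles. fst p \<notin> L}"
  have finL: "finite L"
    using fin by (simp add: L_def)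
  have "card Y * \<delta> = (\<Sum>p\<in>Y. \<delta>)"
    by simp
  also have "\<dots> \<le> (\<Sum>p\<in>Y. real (double_degree (fst p)))"
    using sub by (intro sum_mono) (auto simp: Y_def L_def triangles_def)
  also have "\<dots> \<le> (\<Sum>p\<in>triangles. real (double_degree (fst p)))"
    by (intro sum_mono2) (auto simp: Y_def)
  also have "\<dots> = real (card (SIGMA p:triangles. {u \<in> V. (fst p, u) \<in> both_ways D}))"
    using fin by (subst card_SigmaI) (auto simp: double_degree_def)
  also have "card (SIGMA p:triangles. {u \<in> V. (fst p, u) \<in> both_ways D}) = card ?Q"
    by (rule bij_betw_same_card[where f = "\<lambda>((a, b, c), d). (a, b, c, d)"])
      (auto intro!: bij_betw_byWitness[where f' = "\<lambda>(a, b, c, d). ((a, b, c), d)"] dest: both_ways_V)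
  finally have Y: "card Y \<le> 1 / \<delta> * card ?Q"
    using assms by (simp add: field_simps)
  have finY: "finite Y"
    by (simp add: Y_def)
  have "triangles \<subseteq> Y \<union> (\<lambda>(b, c, a). (a, b, c)) ` Y \<union> (\<lambda>(c, a, b). (a, b, c)) ` Y \<union>
      (\<lambda>xs. (xs ! 0, xs ! 1, xs ! 2)) ` walks L (D \<inter> L \<times> L) 3"
  proof
    fix p assume p: "p \<in> triangles"
    obtain a b c where abc: "p = (a, b, c)"
      by (cases p)
    have V: "a \<in> V" "b \<in> V" "c \<in> V"
      using p sub by (auto simp: abc triangles_def)
    have rot: "(b, c, a) \<in> triangles" "(c, a, b) \<in> triangles"
      using p by (auto simp: abc triangles_def)
    have "p \<in> Y" if "a \<notin> L"
      using that p by (simp add: abc Y_def)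
    moreover have "p \<in> (\<lambda>(b, c, a). (a, b, c)) ` Y" if "b \<notin> L"
      using that rot by (intro image_eqI[of _ _ "(b, c, a)"]) (simp_all add: abc Y_def)
    moreover have "p \<in> (\<lambda>(c, a, b). (a, b, c)) ` Y" if "c \<notin> L"
      using that rot by (intro image_eqI[of _ _ "(c, a, b)"]) (simp_all add: abc Y_def)
    moreover have "p \<in> (\<lambda>xs. (xs ! 0, xs ! 1, xs ! 2)) ` walks L (D \<inter> L \<times> L) 3"
      if "a \<in> L" "b \<in> L" "c \<in> L"
    proof (rule image_eqI[of _ _ "[a, b, c]"])
      show "[a, b, c] \<in> walks L (D \<inter> L \<times> L) 3"
        using that p by (simp add: closed_walk_3 walks_def tuples_def abc triangles_def)
    qed (simp add: abc)
    ultimately show "p \<in> Y \<union> (\<lambda>(b, c, a). (a, b, c)) ` Y \<union> (\<lambda>(c, a, b). (a, b, c)) ` Y \<union>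
      (\<lambda>xs. (xs ! 0, xs ! 1, xs ! 2)) ` walks L (D \<inter> L \<times> L) 3"
      unfolding Un_iff by argo
  qed
  then have "card triangles \<le> card (Y \<union> (\<lambda>(b, c, a). (a, b, c)) ` Y \<union> (\<lambda>(c, a, b). (a, b, c)) ` Y \<union>
      (\<lambda>xs. (xs ! 0, xs ! 1, xs ! 2)) ` walks L (D \<inter> L \<times> L) 3)"
    using finY finL by (intro card_mono) auto
  also have "\<dots> \<le> card Y + card Y + card Y + card (walks L (D \<inter> L \<times> L) 3)"
    by (intro order_trans[OF card_Un_le] add_mono card_image_le order_refl finY finite_walks finL)
  finally have "real (card triangles) \<le> real (card Y + card Y + card Y + card (walks L (D \<inter> L \<times> L) 3))"
    by (rule of_nat_mono)
  then show ?thesis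
    using Y by simp
qed

end

section \<open>Lengthening closed walks in near-tournaments\<close>

lemma square_le_linear:
  fixes s a z :: real
  assumes "s\<^sup>2 \<le> 2 * a * s + z" "0 \<le> a" "0 \<le> z"
  shows "s \<le> 2 * a + sqrt z"
proof (rule ccontr)
  assume *: "\<not> ?thesis"
  have "sqrt z * sqrt z < s * (s - 2 * a)"
    by (rule mult_strict_mono') (use * assms in auto)
  then show False
    using assms by (simp add: power2_eq_square algebra_simps)
qed

lemma closed_walk_insert:
  assumes xs: "closed_walk D xs" "i < length xs"
    and v: "(xs ! i, v) \<in> D" "(v, xs ! (Suc i mod length xs)) \<in> D"
  shows "closed_walk D (take (Suc i) xs @ v # drop (Suc i) xs)"
  unfolding walk_of_def
proof (intro allI impI)
  define l where "l = length xs"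
  define ys where "ys = take (Suc i) xs @ v # drop (Suc i) xs"
  have len: "length ys = Suc l"
    using xs by (simp add: ys_def l_def)
  have lo: "ys ! m = xs ! m" if "m \<le> i" for m
    using that xs by (simp add: ys_def nth_append)
  have mid: "ys ! Suc i = v"
    using xs by (simp add: ys_def nth_append)
  have hi: "ys ! Suc m = xs ! m" if "i < m" "m < l" for m
    using that xs by (simp add: ys_def nth_append l_def Suc_diff_le)
  have arc: "(xs ! m, xs ! (Suc m mod l)) \<in> D" if "m < l" for m
    using xs(1) that by (simp add: walk_of_def l_def)
  fix m assume "m < length (take (Suc i) xs @ v # drop (Suc i) xs)"
  then have m: "m < Suc l"
    using len by (simp add: ys_def)
  have i: "i < l"
    using xs by (simp add: l_def)
  have "(ys ! m, ys ! (Suc m mod Suc l)) \<in> D"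
  proof -
    consider "m < i" | "m = i" | "m = Suc i" | "Suc i < m"
      by linarith
    then show ?thesis
    proof cases
      case 1
      then show ?thesis
        using arc[of m] i by (simp add: lo)
    next
      case 2
      then show ?thesis
        using v(1) i by (simp add: lo mid)
    next
      case 3
      show ?thesis
      proof (cases "Suc i = l")
        case True
        have "ys ! m = v" "Suc m mod Suc l = 0" "Suc i mod length xs = 0"
          using 3 True mid by (simp_all add: l_def)
        then show ?thesis
          using v(2) lo[of 0] by simp
      next
        case False
        then show ?thesis
          using 3 v(2) i hi[of "Suc i"] mid by (simp add: l_def)
      qed
    next
      case 4
      then obtain m' where m': "m = Suc m'" "i < m'" "m' < l"
        using m by (cases m) auto
      show ?thesis
      proof (cases "Suc m' = l")
        case True
        have "ys ! m = xs ! m'" "Suc m mod Suc l = 0" "Suc m' mod l = 0"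
          using m' True hi[of m'] by simp_all
        then show ?thesis
          using arc[of m'] lo[of 0] m'(3) by simp
      next
        case False
        then show ?thesis
          using m' arc[of m'] hi[of m'] hi[of "Suc m'"] by simp
      qed
    qed
  qed
  then show "((take (Suc i) xs @ v # drop (Suc i) xs) ! m,
      (take (Suc i) xs @ v # drop (Suc i) xs) ! (Suc m mod length (take (Suc i) xs @ v # drop (Suc i) xs))) \<in> D"
    using len unfolding ys_def by simp
qed

context arc_set
begin

definition out_diff :: "'a \<Rightarrow> 'a \<Rightarrow> nat" where
  "out_diff u v = card {w \<in> V. ((u, w) \<in> D) \<noteq> ((v, w) \<in> D)}"

lemma card_restrict_eq_sum:
  assumes "finite S"
  shows "card (D \<inter> S \<times> S) = (\<Sum>v\<in>S. card {w \<in> S. (v, w) \<in> D})"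
proof -
  have "D \<inter> S \<times> S = (SIGMA v:S. {w \<in> S. (v, w) \<in> D})"
    by auto
  then show ?thesis
    using assms by (simp add: card_SigmaI)
qed

text \<open>
  In a near-tournament few vertices have almost the same out-neighbourhood: among the
  out-neighbours of \<open>u\<close> that do, almost all pairs would have to be joined both ways.
\<close>

lemma card_twins:
  fixes t z :: real
  assumes z: "card (nonadjacent D \<inter> V \<times> V) + card (both_ways D \<inter> V \<times> V) \<le> z" and t: "0 \<le> t"
  shows "card {v \<in> V. out_diff u v \<le> t} \<le> 6 * t + 3 * sqrt z"
proof -
  define S where "S = {v \<in> V. out_diff u v \<le> t}"
  define S' where "S' = {w \<in> S. (u, w) \<in> D}"
  have S: "S \<subseteq> V" "S' \<subseteq> S" "finite S" "finite S'"
    using fin by (auto simp: S_def S'_def)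
  have S'V: "S' \<subseteq> V"
    using S by blast
  have z0: "0 \<le> z"
    using z by linarith
  have restr: "card (nonadjacent D \<inter> U \<times> U) \<le> z" "card (both_ways D \<inter> U \<times> U) \<le> z" if "U \<subseteq> V" for U
  proof -
    have "card (nonadjacent D \<inter> U \<times> U) \<le> card (nonadjacent D \<inter> V \<times> V)"
      "card (both_ways D \<inter> U \<times> U) \<le> card (both_ways D \<inter> V \<times> V)"
      using that fin by (auto intro!: card_mono)
    then show "card (nonadjacent D \<inter> U \<times> U) \<le> z" "card (both_ways D \<inter> U \<times> U) \<le> z"
      using z by linarith+
  qed
  have id: "2 * real (card (D \<inter> U \<times> U)) + card (nonadjacent D \<inter> U \<times> U)
      = (real (card U))\<^sup>2 + card (both_ways D \<inter> U \<times> U)" if "U \<subseteq> V" for U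
    using card_square_eq[OF finite_subset[OF that fin], of D, THEN arg_cong[of _ _ real]] by simp
  have lower: "card S' - t \<le> card {w \<in> S'. (v, w) \<in> D}" and
    upper: "card {w \<in> S. (v, w) \<in> D} \<le> card S' + t" if v: "v \<in> S" for v
  proof -
    have od: "out_diff u v \<le> t"
      using v by (simp add: S_def)
    have "card S' \<le> card ({w \<in> S'. (v, w) \<in> D} \<union> {w \<in> V. ((u, w) \<in> D) \<noteq> ((v, w) \<in> D)})"
      using S fin by (intro card_mono) (auto simp: S'_def)
    also have "\<dots> \<le> card {w \<in> S'. (v, w) \<in> D} + out_diff u v"
      unfolding out_diff_def by (rule card_Un_le)
    finally show "card S' - t \<le> card {w \<in> S'. (v, w) \<in> D}"
      using od by linarith
    have "card {w \<in> S. (v, w) \<in> D} \<le> card (S' \<union> {w \<in> V. ((u, w) \<in> D) \<noteq> ((v, w) \<in> D)})"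
      using S fin by (intro card_mono) (auto simp: S'_def)
    also have "\<dots> \<le> card S' + out_diff u v"
      unfolding out_diff_def by (rule card_Un_le)
    finally show "card {w \<in> S. (v, w) \<in> D} \<le> card S' + t"
      using od by linarith
  qed
  have "card S' * (card S' - t) = (\<Sum>v\<in>S'. card S' - t)"
    by simp
  also have "\<dots> \<le> (\<Sum>v\<in>S'. real (card {w \<in> S'. (v, w) \<in> D}))"
    using lower S by (intro sum_mono) auto
  also have "\<dots> = card (D \<inter> S' \<times> S')"
    using S by (simp add: card_restrict_eq_sum)
  finally have "2 * (card S' * (card S' - t)) \<le> (real (card S'))\<^sup>2 + z"
    using id[OF S'V] restr(2)[OF S'V] by linarith
  then have "(real (card S'))\<^sup>2 \<le> 2 * t * card S' + z"
    by (simp add: power2_eq_square algebra_simps)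
  then have s': "card S' \<le> 2 * t + sqrt z"
    using t z0 by (rule square_le_linear)
  \<comment> \<open>Now the opposite estimate: every vertex of \<open>S\<close> sends its arcs
    within \<open>S\<close> into the small set \<open>S'\<close> up to \<open>t\<close> exceptions,
    whereas nearly half of all pairs in \<open>S\<close> have to be arcs.\<close>
  have "real (card (D \<inter> S \<times> S)) = (\<Sum>v\<in>S. real (card {w \<in> S. (v, w) \<in> D}))"
    using S by (simp add: card_restrict_eq_sum)
  also have "\<dots> \<le> (\<Sum>v\<in>S. card S' + t)"
    using upper by (intro sum_mono) auto
  also have "\<dots> = card S * (card S' + t)"
    by simp
  finally have "(real (card S))\<^sup>2 \<le> 2 * (card S' + t) * card S + z"
    using id[OF S(1)] restr(1)[OF S(1)] by (simp add: algebra_simps)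
  then have "card S \<le> 2 * (card S' + t) + sqrt z"
    using t z0 by (intro square_le_linear) auto
  then show ?thesis
    using s' by (simp add: S_def[symmetric])
qed

text \<open>A closed walk is lengthened by a vertex \<open>v\<close> that distinguishes its first
  two vertices. If \<open>v\<close> is joined to each vertex of the walk by exactly one arc, then
  somewhere on the way round an arc into \<open>v\<close> is followed by an arc out of
  \<open>v\<close>, and \<open>v\<close> can be inserted there. The exceptions are walks beginning
  with near-twins, few by \<open>card_twins\<close>, and pairs for which \<open>v\<close> is
  nonadjacent or doubly joined to a vertex of the walk.\<close>

lemma card_walks_step:
  fixes t z N :: real
  assumes z: "card (nonadjacent D \<inter> V \<times> V) + card (both_ways D \<inter> V \<times> V) \<le> z"
    and t: "0 < t" and l: "2 \<le> l" and N: "card V \<le> N"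
  shows "card (walks V D l) \<le> N ^ (l - 1) * (6 * t + 3 * sqrt z) +
    (l * card (walks V D (Suc l)) + l * (N ^ (l - 1) * z)) / t"
proof -
  let ?NS = "nonadjacent D \<inter> V \<times> V \<union> both_ways D \<inter> V \<times> V"
  let ?W = "walks V D l"
  have N0: "0 \<le> N"
    using N by linarith
  have z0: "0 \<le> z"
    using z by linarith
  have pw: "real (card V) ^ m \<le> N ^ m" for m
    using N by (intro power_mono) auto
  define C where "C = {xs \<in> tuples V l. out_diff (xs ! 0) (xs ! 1) \<le> t}"
  define E where "E = (SIGMA u:V. {v \<in> V. out_diff u v \<le> t})"
  have "card C \<le> card (E \<times> tuples V (l - 2))"
  proof (rule card_inj_on_le)
    show "inj_on (\<lambda>xs. ((xs ! 0, xs ! 1), drop 2 xs)) C"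
    proof (rule inj_onI)
      fix xs ys :: "'a list"
      assume *: "xs \<in> C" "ys \<in> C" "((xs ! 0, xs ! 1), drop 2 xs) = ((ys ! 0, ys ! 1), drop 2 ys)"
      have "xs = xs ! 0 # xs ! 1 # drop 2 xs" if "length xs \<ge> 2" for xs :: "'a list"
        using that by (cases xs; cases "tl xs") auto
      from this[of xs] this[of ys] show "xs = ys"
        using * l by (simp add: C_def tuples_def)
    qed
    show "(\<lambda>xs. ((xs ! 0, xs ! 1), drop 2 xs)) ` C \<subseteq> E \<times> tuples V (l - 2)"
      using l by (auto simp: C_def E_def tuples_def dest: in_set_dropD intro!: subsetD[OF _ nth_mem])
  qed (use fin in \<open>auto simp: E_def\<close>)
  also have "\<dots> = card V ^ (l - 2) * (\<Sum>u\<in>V. card {v \<in> V. out_diff u v \<le> t})"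
    using fin by (simp add: E_def card_cartesian_product card_tuples card_SigmaI)
  finally have "real (card C) \<le> real (card V ^ (l - 2) * (\<Sum>u\<in>V. card {v \<in> V. out_diff u v \<le> t}))"
    by (rule of_nat_mono)
  also have "\<dots> = real (card V) ^ (l - 2) * (\<Sum>u\<in>V. real (card {v \<in> V. out_diff u v \<le> t}))"
    by simp
  also have "\<dots> \<le> real (card V) ^ (l - 2) * (\<Sum>u\<in>V. 6 * t + 3 * sqrt z)"
    using t by (intro mult_left_mono sum_mono card_twins[OF z]) auto
  also have "\<dots> = real (card V) ^ Suc (l - 2) * (6 * t + 3 * sqrt z)"
    by simp
  also have "\<dots> \<le> N ^ Suc (l - 2) * (6 * t + 3 * sqrt z)"
    using t z0 by (intro mult_right_mono pw) auto
  also have "Suc (l - 2) = l - 1"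
    using l by simp
  finally have C: "card C \<le> N ^ (l - 1) * (6 * t + 3 * sqrt z)" .
  define Q where "Q = (SIGMA xs:?W. {w \<in> V. ((xs ! 0, w) \<in> D) \<noteq> ((xs ! 1, w) \<in> D)})"
  define A where "A i = {(xs, v). xs \<in> ?W \<and> v \<in> V \<and> (xs ! i, v) \<in> D \<and> (v, xs ! (Suc i mod l)) \<in> D}" for i
  define B where "B i = {(xs, v). xs \<in> tuples V l \<and> v \<in> V \<and> (xs ! i, v) \<in> ?NS}" for i
  have finWV: "finite (tuples V l \<times> V)"
    using fin by simp
  have finAB: "finite (A i)" "finite (B i)" for i
    by (rule finite_subset[OF _ finWV]; auto simp: A_def B_def walks_def)+
  have "Q \<subseteq> (\<Union>i<l. A i) \<union> (\<Union>i<l. B i)"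
  proof (rule subsetI)
    fix q assume "q \<in> Q"
    then obtain xs v where q: "q = (xs, v)" "xs \<in> ?W" "v \<in> V" "((xs ! 0, v) \<in> D) \<noteq> ((xs ! 1, v) \<in> D)"
      by (auto simp: Q_def)
    have xs: "xs \<in> tuples V l"
      using q by (simp add: walks_def)
    show "q \<in> (\<Union>i<l. A i) \<union> (\<Union>i<l. B i)"
    proof (cases "\<exists>i<l. (xs ! i, v) \<in> ?NS")
      case True
      then show ?thesis
        using q xs by (auto simp: B_def)
    next
      case False
      then have single: "(v, xs ! i) \<in> D \<longleftrightarrow> (xs ! i, v) \<notin> D" if "i < l" for i
        using that tuples_nth[OF xs that] q(3) by (auto simp: both_ways_def nonadjacent_def)
      have "\<exists>i<l. (xs ! i, v) \<in> D \<and> (xs ! (Suc i mod l), v) \<notin> D"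
      proof (cases "(xs ! 0, v) \<in> D")
        case True
        then show ?thesis
          using q(4) l by (intro exI[of _ 0]) auto
      next
        case no0: False
        show ?thesis
        proof (rule ccontr)
          assume *: "\<not> ?thesis"
          \<comment> \<open>Here \<open>xs ! 1\<close> sends an arc to \<open>v\<close>. If the
            direction never turned, all later vertices would do so, and round the end also
            \<open>xs ! 0\<close>.\<close>
          have "(xs ! i, v) \<in> D" if "1 \<le> i" "i < l" for i
            using that
          proof (induction i rule: dec_induct)
            case base
            then show ?case
              using q(4) no0 by simp
          next
            case (step i)
            then have "(xs ! (Suc i mod l), v) \<in> D"
              using * Suc_lessD by blast
            then show ?case
              using step.prems by simp
          qed
          from this[of "l - 1"] have "(xs ! (l - 1), v) \<in> D"
            using l by simp
          then have "(xs ! (Suc (l - 1) mod l), v) \<in> D"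
            using * l by (metis One_nat_def Suc_le_eq diff_less less_le_trans pos2 zero_less_one)
          then show False
            using no0 l by simp
        qed
      qed
      then obtain i where i: "i < l" "(xs ! i, v) \<in> D" "(xs ! (Suc i mod l), v) \<notin> D"
        by blast
      have "Suc i mod l < l"
        using i(1) by (intro mod_less_divisor) linarith
      then have "(v, xs ! (Suc i mod l)) \<in> D"
        using single i(3) by blast
      then show ?thesis
        using q i by (auto simp: A_def)
    qed
  qed
  then have "card Q \<le> card ((\<Union>i<l. A i) \<union> (\<Union>i<l. B i))"
    using finAB by (intro card_mono) auto
  also have "\<dots> \<le> (\<Sum>i<l. card (A i)) + (\<Sum>i<l. card (B i))"
    by (intro order_trans[OF card_Un_le] add_mono card_UN_le) auto
  also have "\<dots> \<le> (\<Sum>i<l. card (walks V D (Suc l))) + (\<Sum>i<l. card (?NS \<times> tuples V (l - 1)))"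
  proof (intro add_mono sum_mono)
    fix i assume "i \<in> {..<l}"
    then have i: "i < l"
      by simp
    show "card (A i) \<le> card (walks V D (Suc l))"
    proof (rule card_inj_on_le)
      show "inj_on (\<lambda>(xs, v). take (Suc i) xs @ v # drop (Suc i) xs) (A i)"
      proof (rule inj_onI, clarify)
        fix xs v ys w
        assume *: "(xs, v) \<in> A i" "(ys, w) \<in> A i"
          "take (Suc i) xs @ v # drop (Suc i) xs = take (Suc i) ys @ w # drop (Suc i) ys"
        have "length xs = length ys"
          using * by (simp add: A_def walks_def tuples_def)
        then have "take (Suc i) xs = take (Suc i) ys \<and> v # drop (Suc i) xs = w # drop (Suc i) ys"
          using *(3) by (subst (asm) append_eq_append_conv) auto
        then show "xs = ys \<and> v = w"
          by (metis append_take_drop_id list.inject)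
      qed
      show "(\<lambda>(xs, v). take (Suc i) xs @ v # drop (Suc i) xs) ` A i \<subseteq> walks V D (Suc l)"
      proof clarify
        fix xs v assume *: "(xs, v) \<in> A i"
        then have "length xs = l" "set xs \<subseteq> V" "closed_walk D xs" "v \<in> V"
          by (auto simp: A_def walks_def tuples_def)
        moreover from this * i have "closed_walk D (take (Suc i) xs @ v # drop (Suc i) xs)"
          by (intro closed_walk_insert) (auto simp: A_def)
        ultimately show "take (Suc i) xs @ v # drop (Suc i) xs \<in> walks V D (Suc l)"
          using i by (auto simp: walks_def tuples_def dest: in_set_takeD in_set_dropD)
      qed
    qed (use fin in simp)
    show "card (B i) \<le> card (?NS \<times> tuples V (l - 1))"
    proof (rule card_inj_on_le)
      show "inj_on (\<lambda>(xs, v). ((xs ! i, v), take i xs @ drop (Suc i) xs)) (B i)"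
      proof (rule inj_onI, clarify)
        fix xs v ys w
        assume *: "(xs, v) \<in> B i" "(ys, w) \<in> B i" "xs ! i = ys ! i"
          "take i xs @ drop (Suc i) xs = take i ys @ drop (Suc i) ys"
        have len: "length xs = l" "length ys = l"
          using * by (simp_all add: B_def tuples_def)
        then have "take i xs = take i ys \<and> drop (Suc i) xs = drop (Suc i) ys"
          using *(4) by (subst (asm) append_eq_append_conv) auto
        then show "xs = ys \<and> v = v"
          using *(3) len i by (metis id_take_nth_drop)
      qed
      show "(\<lambda>(xs, v). ((xs ! i, v), take i xs @ drop (Suc i) xs)) ` B i \<subseteq> ?NS \<times> tuples V (l - 1)"
        using i by (auto simp: B_def tuples_def subset_iff dest!: in_set_takeD in_set_dropD)
    qed (use fin in auto)
  qed
  also have "\<dots> = l * card (walks V D (Suc l)) + l * (card ?NS * card V ^ (l - 1))"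
    using fin by (simp add: card_cartesian_product card_tuples)
  finally have "real (card Q) \<le> real (l * card (walks V D (Suc l)) + l * (card ?NS * card V ^ (l - 1)))"
    by (rule of_nat_mono)
  also have "\<dots> \<le> l * card (walks V D (Suc l)) + l * (N ^ (l - 1) * z)"
  proof -
    have "card ?NS \<le> z"
      using z card_Un_le[of "nonadjacent D \<inter> V \<times> V" "both_ways D \<inter> V \<times> V"] by linarith
    then have "real (card V) ^ (l - 1) * real (card ?NS) \<le> N ^ (l - 1) * z"
      using pw N0 by (intro mult_mono) auto
    then have "l * (real (card V) ^ (l - 1) * real (card ?NS)) \<le> l * (N ^ (l - 1) * z)"
      by (intro mult_left_mono) auto
    then show ?thesis
      by (simp add: mult_ac)
  qed
  finally have Q: "card Q \<le> l * card (walks V D (Suc l)) + l * (N ^ (l - 1) * z)" .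
  define Y where "Y = {xs \<in> ?W. \<not> out_diff (xs ! 0) (xs ! 1) \<le> t}"
  have "card Y * t = (\<Sum>xs\<in>Y. t)"
    by simp
  also have "\<dots> \<le> (\<Sum>xs\<in>Y. real (out_diff (xs ! 0) (xs ! 1)))"
    by (intro sum_mono) (auto simp: Y_def)
  also have "\<dots> \<le> (\<Sum>xs\<in>?W. real (out_diff (xs ! 0) (xs ! 1)))"
    using fin by (intro sum_mono2) (auto simp: Y_def)
  also have "\<dots> = card Q"
    unfolding Q_def out_diff_def using fin by (subst card_SigmaI) auto
  finally have "card Y \<le> (l * card (walks V D (Suc l)) + l * (N ^ (l - 1) * z)) / t"
    using Q t by (simp add: field_simps)
  moreover have "card ?W \<le> card C + card Y"
    using fin by (intro order_trans[OF card_mono card_Un_le]) (auto simp: C_def Y_def walks_def)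
  ultimately show ?thesis
    using C by linarith
qed

end

section \<open>Reconstructing the blow up from pivots\<close>

lemma exists_le_average:
  fixes f :: "'a \<Rightarrow> real" and c :: real
  assumes "finite V" "V \<noteq> {}" "(\<Sum>t\<in>V. f t) \<le> card V * c"
  shows "\<exists>t\<in>V. f t \<le> c"
proof (rule ccontr)
  assume "\<not> ?thesis"
  then have "(\<Sum>t\<in>V. c) < (\<Sum>t\<in>V. f t)"
    using assms by (intro sum_strict_mono) auto
  then show False
    using assms by simp
qed

text \<open>A random pivot leaves at most the share 1 - \<xi> of the pairs in \<open>R\<close>
  unseparated and costs \<beta> on average. This is derandomised by conditional expectations: the
  next pivot keeps its own cost plus the weighted number of surviving pairs, with weight
  \<open>(1 - \<xi>) ^ m\<close> for the \<open>m\<close> pivots to come, at most average.\<close>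

lemma exists_pivots:
  fixes \<xi> \<beta> :: real and bad :: "'a \<Rightarrow> real"
  assumes V: "finite V" "V \<noteq> {}" and \<xi>: "\<xi> \<le> 1" and R: "finite R"
    and sep: "\<And>p. p \<in> R \<Longrightarrow> \<xi> * card V \<le> card {t \<in> V. sep t p}"
    and bad: "(\<Sum>t\<in>V. bad t) \<le> card V * \<beta>"
  shows "\<exists>ts. set ts \<subseteq> V \<and>
    card {p \<in> R. \<forall>t\<in>set ts. \<not> sep t p} + (\<Sum>t\<leftarrow>ts. bad t) \<le> (1 - \<xi>) ^ m * card R + m * \<beta>"
  using R sep
proof (induction m arbitrary: R)
  case 0
  then show ?case
    by (intro exI[of _ "[]"]) simp
next
  case (Suc m)
  define n where "n = card V"
  have "(\<Sum>t\<in>V. card {p \<in> R. \<not> sep t p}) = card (SIGMA t:V. {p \<in> R. \<not> sep t p})"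
    using V Suc.prems by (intro card_SigmaI[symmetric]) auto
  also have "\<dots> = card (SIGMA p:R. {t \<in> V. \<not> sep t p})"
    by (rule bij_betw_same_card[of prod.swap]) (auto intro!: bij_betw_byWitness[where f' = prod.swap])
  also have "\<dots> = (\<Sum>p\<in>R. card {t \<in> V. \<not> sep t p})"
    using V Suc.prems by (intro card_SigmaI) auto
  finally have "real (\<Sum>t\<in>V. card {p \<in> R. \<not> sep t p}) = real (\<Sum>p\<in>R. card {t \<in> V. \<not> sep t p})"
    by (rule arg_cong)
  then have "(\<Sum>t\<in>V. real (card {p \<in> R. \<not> sep t p})) = (\<Sum>p\<in>R. real (card {t \<in> V. \<not> sep t p}))"
    unfolding of_nat_sum .
  also have "\<dots> \<le> (\<Sum>p\<in>R. n * (1 - \<xi>))"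
  proof (rule sum_mono)
    fix p assume p: "p \<in> R"
    have "V = {t \<in> V. sep t p} \<union> {t \<in> V. \<not> sep t p}"
      by auto
    then have "n = card ({t \<in> V. sep t p} \<union> {t \<in> V. \<not> sep t p})"
      by (simp add: n_def)
    also have "\<dots> = card {t \<in> V. sep t p} + card {t \<in> V. \<not> sep t p}"
      using V by (intro card_Un_disjoint) auto
    finally show "real (card {t \<in> V. \<not> sep t p}) \<le> n * (1 - \<xi>)"
      using Suc.prems(2)[OF p] by (simp add: algebra_simps n_def)
  qed
  also have "\<dots> = n * ((1 - \<xi>) * card R)"
    by simp
  finally have 1: "(\<Sum>t\<in>V. real (card {p \<in> R. \<not> sep t p})) \<le> n * ((1 - \<xi>) * card R)" .
  have "(\<Sum>t\<in>V. (1 - \<xi>) ^ m * card {p \<in> R. \<not> sep t p} + bad t) =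
      (1 - \<xi>) ^ m * (\<Sum>t\<in>V. real (card {p \<in> R. \<not> sep t p})) + (\<Sum>t\<in>V. bad t)"
    by (simp add: sum.distrib sum_distrib_left)
  also have "\<dots> \<le> (1 - \<xi>) ^ m * (n * ((1 - \<xi>) * card R)) + card V * \<beta>"
    using \<xi> by (intro add_mono mult_left_mono 1 bad) auto
  also have "\<dots> = card V * ((1 - \<xi>) ^ Suc m * card R + \<beta>)"
    by (simp add: n_def algebra_simps)
  finally obtain t where t: "t \<in> V"
    "(1 - \<xi>) ^ m * card {p \<in> R. \<not> sep t p} + bad t \<le> (1 - \<xi>) ^ Suc m * card R + \<beta>"
    using exists_le_average[OF V] by blast
  obtain ts where ts: "set ts \<subseteq> V"
    "card {p \<in> {p \<in> R. \<not> sep t p}. \<forall>t\<in>set ts. \<not> sep t p} + (\<Sum>t\<leftarrow>ts. bad t) \<le>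
      (1 - \<xi>) ^ m * card {p \<in> R. \<not> sep t p} + m * \<beta>"
    using Suc.IH[of "{p \<in> R. \<not> sep t p}"] Suc.prems by auto
  have "{p \<in> {p \<in> R. \<not> sep t p}. \<forall>t\<in>set ts. \<not> sep t p} = {p \<in> R. \<forall>t\<in>set (t # ts). \<not> sep t p}"
    by auto
  then show ?case
    using t ts by (intro exI[of _ "t # ts"]) (simp add: algebra_simps)
qed

lemma card_UN_list_le: "card (\<Union>t\<in>set ts. X t) \<le> (\<Sum>t\<leftarrow>ts. card (X t))"
proof (induction ts)
  case (Cons t ts)
  then show ?case
    using card_Un_le[of "X t" "\<Union>t\<in>set ts. X t"] by simp
qed simp

section \<open>Consistent triples, and pivots that certify an arc\<close>

context arc_set
begin

definition single :: "'a \<Rightarrow> 'a \<Rightarrow> bool" where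
  "single u v \<longleftrightarrow> (u, v) \<in> D \<and> (v, u) \<notin> D"

text \<open>Treats double edges and nonadjacent pairs alike: in a blow up these are the pairs inside
  one class.\<close>

definition tied :: "'a \<Rightarrow> 'a \<Rightarrow> bool" where
  "tied u v \<longleftrightarrow> ((u, v) \<in> D \<longleftrightarrow> (v, u) \<in> D)"

text \<open>
  The relations on a triple that hold in a blow up: \<open>tied\<close> is an equivalence whose classes are
  modules of the strict order \<open>single\<close>, and within a class the two-way arcs form a complete
  bipartite graph.
\<close>

definition consistent :: "'a \<Rightarrow> 'a \<Rightarrow> 'a \<Rightarrow> bool" where
  "consistent t u v \<longleftrightarrow>
    (tied u v \<longrightarrow> (single t u \<longleftrightarrow> single t v) \<and> (tied t u \<longleftrightarrow> tied t v) \<and>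
      (tied t u \<longrightarrow> ((u, v) \<in> D \<longleftrightarrow> ((t, u) \<in> D) \<noteq> ((t, v) \<in> D)))) \<and>
    (single u v \<longrightarrow> (single t u \<longrightarrow> single t v) \<and> (tied t u \<longrightarrow> single t v))"

definition inconsistent :: "('a \<times> 'a \<times> 'a) set" where
  "inconsistent = {(t, u, v). t \<in> V \<and> u \<in> V \<and> v \<in> V \<and> \<not> consistent t u v}"

text \<open>A propositional check on the possible arcs of a triple: each violated relation exhibits
  an unbalanced double edge, two nonadjacent vertices that are not twins, or a cyclic
  triangle.\<close>

lemma inconsistent_cases:
  assumes "(t, u, v) \<in> inconsistent"
  shows "(t, u, v) \<in> unbalanced \<or> (u, t, v) \<in> unbalanced \<or> (t, v, u) \<in> unbalanced \<or>
    (v, t, u) \<in> unbalanced \<or> (u, v, t) \<in> unbalanced \<or> (v, u, t) \<in> unbalanced \<or>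
    (t, u, v) \<in> split_nonadjacent \<or> (t, v, u) \<in> split_nonadjacent \<or> (u, v, t) \<in> split_nonadjacent \<or>
    (t, u, v) \<in> triangles \<or> (t, v, u) \<in> triangles"
  using assms
  unfolding inconsistent_def consistent_def unbalanced_def split_nonadjacent_def triangles_def
    both_ways_def nonadjacent_def single_def tied_def mem_Collect_eq prod.case
  by argo

lemma card_inconsistent:
  "card inconsistent \<le> 6 * card unbalanced + 3 * card split_nonadjacent + 2 * card triangles"
proof -
  have "inconsistent \<subseteq>
      (\<lambda>(t, u, v). (t, u, v)) ` unbalanced \<union> (\<lambda>(u, t, v). (t, u, v)) ` unbalanced \<union>
      (\<lambda>(t, v, u). (t, u, v)) ` unbalanced \<union> (\<lambda>(v, t, u). (t, u, v)) ` unbalanced \<union>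
      (\<lambda>(u, v, t). (t, u, v)) ` unbalanced \<union> (\<lambda>(v, u, t). (t, u, v)) ` unbalanced \<union>
      (\<lambda>(t, u, v). (t, u, v)) ` split_nonadjacent \<union> (\<lambda>(t, v, u). (t, u, v)) ` split_nonadjacent \<union>
      (\<lambda>(u, v, t). (t, u, v)) ` split_nonadjacent \<union>
      (\<lambda>(t, u, v). (t, u, v)) ` triangles \<union> (\<lambda>(t, v, u). (t, u, v)) ` triangles" (is "_ \<subseteq> ?U")
  proof
    fix p assume p: "p \<in> inconsistent"
    obtain t u v where tuv: "p = (t, u, v)"
      by (cases p)
    note inconsistent_cases[OF p[unfolded tuv]]
    moreover have "p \<in> (\<lambda>(t, u, v). (t, u, v)) ` X" if "(t, u, v) \<in> X" for X
      using that by (intro image_eqI[of _ _ "(t, u, v)"]) (simp_all add: tuv)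
    moreover have "p \<in> (\<lambda>(u, t, v). (t, u, v)) ` X" if "(u, t, v) \<in> X" for X
      using that by (intro image_eqI[of _ _ "(u, t, v)"]) (simp_all add: tuv)
    moreover have "p \<in> (\<lambda>(t, v, u). (t, u, v)) ` X" if "(t, v, u) \<in> X" for X
      using that by (intro image_eqI[of _ _ "(t, v, u)"]) (simp_all add: tuv)
    moreover have "p \<in> (\<lambda>(v, t, u). (t, u, v)) ` X" if "(v, t, u) \<in> X" for X
      using that by (intro image_eqI[of _ _ "(v, t, u)"]) (simp_all add: tuv)
    moreover have "p \<in> (\<lambda>(u, v, t). (t, u, v)) ` X" if "(u, v, t) \<in> X" for X
      using that by (intro image_eqI[of _ _ "(u, v, t)"]) (simp_all add: tuv)
    moreover have "p \<in> (\<lambda>(v, u, t). (t, u, v)) ` X" if "(v, u, t) \<in> X" for X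
      using that by (intro image_eqI[of _ _ "(v, u, t)"]) (simp_all add: tuv)
    ultimately show "p \<in> ?U"
      unfolding Un_iff by meson
  qed
  then have "card inconsistent \<le> card ?U"
    by (intro card_mono) auto
  also have "\<dots> \<le> card unbalanced + card unbalanced + card unbalanced + card unbalanced +
      card unbalanced + card unbalanced + card split_nonadjacent + card split_nonadjacent +
      card split_nonadjacent + card triangles + card triangles"
    by (intro order_trans[OF card_Un_le] add_mono card_image_le) auto
  finally show ?thesis
    by simp
qed

text \<open>A pivot of this kind certifies the arc from \<open>u\<close> to \<open>v\<close>:
  strictly between them, it separates their keys; tied to \<open>v\<close>, it separates the keys or
  guarantees that colours are available.\<close>

definition between :: "'a \<Rightarrow> 'a \<Rightarrow> 'a \<Rightarrow> bool" where
  "between u v t \<longleftrightarrow> tied t v \<or> single u t \<and> single t v"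

text \<open>Let \<open>A u\<close> collect the \<open>v\<close> reached from \<open>u\<close> by a
  single arc with few vertices between. Any two elements of \<open>A u\<close> are tied or joined by
  a single arc, so one of them lies between \<open>u\<close> and the other; on average half of
  \<open>A u\<close> is therefore between, which gives the bound 2\<tau>. Arcs of \<open>D\<close>
  that are not single are tied, and then few vertices between means few vertices tied to
  \<open>v\<close>, which accounts for the third \<tau>.\<close>

lemma card_low_between:
  fixes \<tau> :: real
  assumes "0 \<le> \<tau>"
  shows "card {(u, v) \<in> D. card {t \<in> V. between u v t} < \<tau>} \<le> 3 * \<tau> * card V"
proof -
  define A where "A u = {v \<in> V. single u v \<and> card {t \<in> V. between u v t} < \<tau>}" for u
  define M where "M = {v \<in> V. card {t \<in> V. tied t v} < \<tau>}"
  have finA: "finite (A u)" for u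
    using fin by (simp add: A_def)
  have A: "card (A u) \<le> 2 * \<tau>" for u
  proof -
    define E where "E = (SIGMA v:A u. {w \<in> A u. tied w v \<or> single w v})"
    have finE: "finite E"
      using finA by (simp add: E_def)
    have "A u \<times> A u \<subseteq> E \<union> prod.swap ` E"
    proof
      fix p assume p: "p \<in> A u \<times> A u"
      obtain v w where vw: "p = (v, w)"
        by (cases p)
      have "p \<in> E" if "tied w v \<or> single w v"
        using that p by (simp add: vw E_def)
      moreover have "p \<in> prod.swap ` E" if "single v w"
        using that p by (intro image_eqI[of _ _ "(w, v)"]) (simp_all add: vw E_def)
      moreover have "tied w v \<or> single w v \<or> single v w"
        by (auto simp: tied_def single_def)
      ultimately show "p \<in> E \<union> prod.swap ` E"
        by blast
    qed
    then have "card (A u \<times> A u) \<le> card (E \<union> prod.swap ` E)"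
      using finE by (intro card_mono) auto
    also have "\<dots> \<le> card E + card E"
      by (intro order_trans[OF card_Un_le] add_mono card_image_le order_refl finE)
    finally have "card (A u) * card (A u) \<le> 2 * card E"
      by (simp add: card_cartesian_product)
    then have "real (card (A u) * card (A u)) \<le> real (2 * card E)"
      by (rule of_nat_mono)
    then have "real (card (A u)) * card (A u) \<le> 2 * real (card E)"
      by simp
    also have "real (card E) = (\<Sum>v\<in>A u. real (card {w \<in> A u. tied w v \<or> single w v}))"
      unfolding E_def using finA by (simp add: card_SigmaI)
    also have "\<dots> \<le> (\<Sum>v\<in>A u. \<tau>)"
    proof (rule sum_mono)
      fix v assume v: "v \<in> A u"
      have "card {w \<in> A u. tied w v \<or> single w v} \<le> card {t \<in> V. between u v t}"
        using fin by (intro card_mono) (auto simp: A_def between_def)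
      then show "real (card {w \<in> A u. tied w v \<or> single w v}) \<le> \<tau>"
        using v by (simp add: A_def)
    qed
    finally have "card (A u) * real (card (A u)) \<le> card (A u) * (2 * \<tau>)"
      by simp
    then show ?thesis
      using assms by (cases "card (A u) = 0") auto
  qed
  have "{(u, v) \<in> D. card {t \<in> V. between u v t} < \<tau>} \<subseteq>
      (SIGMA u:V. A u) \<union> prod.swap ` (SIGMA v:M. {t \<in> V. tied t v})"
  proof
    fix p assume p: "p \<in> {(u, v) \<in> D. card {t \<in> V. between u v t} < \<tau>}"
    then obtain u v where uv: "p = (u, v)" "(u, v) \<in> D" "card {t \<in> V. between u v t} < \<tau>"
      by auto
    then have V: "u \<in> V" "v \<in> V"
      using sub by auto
    show "p \<in> (SIGMA u:V. A u) \<union> prod.swap ` (SIGMA v:M. {t \<in> V. tied t v})"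
    proof (cases "single u v")
      case True
      then show ?thesis
        using uv V by (simp add: A_def)
    next
      case False
      have "card {t \<in> V. tied t v} \<le> card {t \<in> V. between u v t}"
        using fin by (intro card_mono) (auto simp: between_def)
      then have "v \<in> M"
        using uv V by (simp add: M_def)
      moreover have "tied u v"
        using False uv by (auto simp: single_def tied_def)
      ultimately show ?thesis
        using V by (intro UnI2 image_eqI[of _ _ "(v, u)"]) (simp_all add: uv)
    qed
  qed
  then have "card {(u, v) \<in> D. card {t \<in> V. between u v t} < \<tau>} \<le>
      card ((SIGMA u:V. A u) \<union> prod.swap ` (SIGMA v:M. {t \<in> V. tied t v}))"
    using fin finA by (intro card_mono) (auto simp: M_def)
  also have "\<dots> \<le> card (SIGMA u:V. A u) + card (SIGMA v:M. {t \<in> V. tied t v})"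
    using fin by (intro order_trans[OF card_Un_le] add_mono card_image_le order_refl) (auto simp: M_def)
  also have "\<dots> = (\<Sum>u\<in>V. card (A u)) + (\<Sum>v\<in>M. card {t \<in> V. tied t v})"
    using fin finA by (simp add: card_SigmaI M_def)
  finally have "real (card {(u, v) \<in> D. card {t \<in> V. between u v t} < \<tau>}) \<le>
      real ((\<Sum>u\<in>V. card (A u)) + (\<Sum>v\<in>M. card {t \<in> V. tied t v}))"
    by (rule of_nat_mono)
  also have "\<dots> = (\<Sum>u\<in>V. real (card (A u))) + (\<Sum>v\<in>M. real (card {t \<in> V. tied t v}))"
    by simp
  also have "\<dots> \<le> (\<Sum>u\<in>V. 2 * \<tau>) + (\<Sum>v\<in>M. \<tau>)"
    using A by (intro add_mono sum_mono) (auto simp: M_def)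
  also have "\<dots> = card V * (2 * \<tau>) + card M * \<tau>"
    by simp
  also have "\<dots> \<le> card V * (2 * \<tau>) + card V * \<tau>"
  proof -
    have "card M \<le> card V"
      using fin by (intro card_mono) (auto simp: M_def)
    then show ?thesis
      using assms by (intro add_left_mono mult_right_mono) auto
  qed
  finally show ?thesis
    by (simp add: algebra_simps)
qed

end

definition blow_up_arcs :: "('a \<Rightarrow> nat) \<Rightarrow> ('a \<Rightarrow> bool) \<Rightarrow> ('a \<times> 'a) set" where
  "blow_up_arcs f c = {(u, v). f u < f v \<or> f u = f v \<and> c u \<noteq> c v}"

context arc_set
begin

text \<open>
  Given pivots \<open>ts\<close>, a vertex is placed by the number of pivots preceding it and by whether it is
  tied to a pivot; in the latter case its colour is read off the first such pivot.
\<close>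

definition pivot_key :: "'a list \<Rightarrow> 'a \<Rightarrow> nat" where
  "pivot_key ts u = 2 * card {t \<in> set ts. single t u} + of_bool (\<exists>t\<in>set ts. tied t u)"

definition pivot_colour :: "'a list \<Rightarrow> 'a \<Rightarrow> bool" where
  "pivot_colour ts u \<longleftrightarrow> (\<exists>t\<in>set ts. tied t u) \<and> (hd (filter (\<lambda>t. tied t u) ts), u) \<in> D"

lemma arc_in_pivot_blow_up:
  assumes uv: "(u, v) \<in> D" and cons: "\<And>t. t \<in> set ts \<Longrightarrow> consistent t u v"
    and betw: "t0 \<in> set ts" "between u v t0"
  shows "(u, v) \<in> blow_up_arcs (pivot_key ts) (pivot_colour ts)"
proof (cases "tied u v")
  case True
  have s: "single t u \<longleftrightarrow> single t v" and e: "tied t u \<longleftrightarrow> tied t v" if "t \<in> set ts" for t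
    using cons[OF that] True by (auto simp: consistent_def)
  have "{t \<in> set ts. single t u} = {t \<in> set ts. single t v}"
    using s by auto
  then have key: "pivot_key ts u = pivot_key ts v"
    using e by (simp add: pivot_key_def cong: bex_cong)
  have filt: "filter (\<lambda>t. tied t u) ts = filter (\<lambda>t. tied t v) ts"
    using e by (intro filter_cong) auto
  define t where "t = hd (filter (\<lambda>t. tied t u) ts)"
  \<comment> \<open>Single arcs from pivots agree on a tied pair, so \<open>t0\<close> cannot lie
    strictly between \<open>u\<close> and \<open>v\<close>. It is tied to both, and hence some pivot
    decides the two colours.\<close>
  have "tied t0 v"
    using betw s[OF betw(1)] by (auto simp: between_def single_def)
  then have joined: "tied t0 u"
    using e betw by simp
  then have "filter (\<lambda>t. tied t u) ts \<noteq> []"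
    using betw(1) by (auto simp: filter_empty_conv)
  then have "t \<in> set (filter (\<lambda>t. tied t u) ts)"
    unfolding t_def by (rule hd_in_set)
  then have t: "t \<in> set ts" "tied t u"
    by auto
  then have "((t, u) \<in> D) \<noteq> ((t, v) \<in> D)"
    using cons[OF t(1)] True uv by (auto simp: consistent_def)
  moreover have "pivot_colour ts u = ((t, u) \<in> D)" "pivot_colour ts v = ((t, v) \<in> D)"
    using t e unfolding pivot_colour_def t_def filt by auto
  ultimately show ?thesis
    using key by (simp add: blow_up_arcs_def)
next
  case False
  then have uv': "single u v"
    using uv by (auto simp: single_def tied_def)
  have s: "single t u \<Longrightarrow> single t v" and e: "tied t u \<Longrightarrow> single t v" if "t \<in> set ts" for t
    using cons[OF that] uv' by (auto simp: consistent_def)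
  have excl: "\<not> (single t u \<and> tied t u)" "\<not> (single t u \<and> single u t)" for t
    by (auto simp: single_def tied_def)
  have sub': "{t \<in> set ts. single t u} \<subseteq> {t \<in> set ts. single t v}"
    using s by auto
  have strict: "card {t \<in> set ts. single t u} < card {t \<in> set ts. single t v}"
    if "t \<in> set ts" "single t v" "\<not> single t u" for t
    using that sub' by (intro psubset_card_mono) auto
  have "pivot_key ts u < pivot_key ts v"
  proof (cases "card {t \<in> set ts. single t u} < card {t \<in> set ts. single t v}")
    case True
    then show ?thesis
      by (simp add: pivot_key_def)
  next
    case no: False
    \<comment> \<open>A pivot tied to \<open>u\<close> would precede \<open>v\<close> but not
      \<open>u\<close> and so raise the count. With equal counts no pivot is tied to
      \<open>u\<close>, while \<open>t0\<close> is tied to \<open>v\<close>; the parity of the key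
      records this.\<close>
    have "\<not> tied t u" if "t \<in> set ts" for t
      using no strict[OF that] e[OF that] excl by blast
    moreover have "tied t0 v"
      using betw no strict[OF betw(1)] excl by (auto simp: between_def)
    moreover have "card {t \<in> set ts. single t u} \<le> card {t \<in> set ts. single t v}"
      using sub' by (intro card_mono) auto
    ultimately show ?thesis
      using betw(1) by (auto simp: pivot_key_def)
  qed
  then show ?thesis
    by (simp add: blow_up_arcs_def)
qed

text \<open>Three kinds of arcs are lost: those with too few vertices between, those without a pivot
  between, and those inconsistent with some pivot. The second loss falls and the third grows with
  the number \<open>m\<close> of pivots.\<close>

lemma exists_blow_up:
  fixes \<xi> :: real
  assumes "V \<noteq> {}" "0 \<le> \<xi>" "\<xi> \<le> 1"
  shows "\<exists>f c. card (D - blow_up_arcs f c) \<le>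
    (1 - \<xi>) ^ m * (card V)\<^sup>2 + m * (card inconsistent / card V) + 3 * \<xi> * (card V)\<^sup>2"
proof -
  define n where "n = real (card V)"
  have n: "0 < n"
    using assms(1) fin by (simp add: n_def card_gt_0_iff)
  define Low where "Low = {(u, v) \<in> D. card {t \<in> V. between u v t} < \<xi> * n}"
  define R where "R = D - Low"
  define X where "X t = {(u, v). u \<in> V \<and> v \<in> V \<and> \<not> consistent t u v}" for t
  have finX: "finite (X t)" for t
    by (rule finite_subset[of _ "V \<times> V"]) (use fin in \<open>auto simp: X_def\<close>)
  have finR: "finite R" "finite Low"
    by (auto simp: R_def Low_def intro: finite_subset[OF _ finD])
  have low: "card Low \<le> 3 * \<xi> * n\<^sup>2"
    using card_low_between[of "\<xi> * n"] assms n by (simp add: Low_def n_def power2_eq_square)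
  have "inconsistent = (SIGMA t:V. X t)"
    by (auto simp: inconsistent_def X_def)
  then have "card inconsistent = (\<Sum>t\<in>V. card (X t))"
    using fin finX by (simp add: card_SigmaI)
  then have sumX: "(\<Sum>t\<in>V. real (card (X t))) \<le> card V * (card inconsistent / n)"
    using n by (simp add: n_def)
  have "\<exists>ts. set ts \<subseteq> V \<and>
    card {p \<in> R. \<forall>t\<in>set ts. \<not> between (fst p) (snd p) t} + (\<Sum>t\<leftarrow>ts. real (card (X t)))
      \<le> (1 - \<xi>) ^ m * card R + m * (card inconsistent / n)"
  proof (rule exists_pivots[OF fin assms(1,3) finR(1) _ sumX])
    show "\<xi> * card V \<le> card {t \<in> V. between (fst p) (snd p) t}" if "p \<in> R" for p
      using that by (auto simp: R_def Low_def n_def case_prod_beta)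
  qed
  then obtain ts where ts: "set ts \<subseteq> V"
    "card {p \<in> R. \<forall>t\<in>set ts. \<not> between (fst p) (snd p) t} + (\<Sum>t\<leftarrow>ts. real (card (X t)))
      \<le> (1 - \<xi>) ^ m * card R + m * (card inconsistent / n)"
    by blast
  let ?B = "blow_up_arcs (pivot_key ts) (pivot_colour ts)"
  let ?R' = "{p \<in> R. \<forall>t\<in>set ts. \<not> between (fst p) (snd p) t}"
  have "D - ?B \<subseteq> ?R' \<union> (\<Union>t\<in>set ts. X t) \<union> Low"
  proof
    fix p assume p: "p \<in> D - ?B"
    obtain u v where uv: "p = (u, v)"
      by (cases p)
    show "p \<in> ?R' \<union> (\<Union>t\<in>set ts. X t) \<union> Low"
    proof (rule ccontr)
      assume *: "\<not> ?thesis"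
      then have "consistent t u v" if "t \<in> set ts" for t
        using that p uv sub by (auto simp: X_def)
      moreover obtain t0 where "t0 \<in> set ts" "between u v t0"
        using * p uv by (auto simp: R_def)
      ultimately have "p \<in> ?B"
        using arc_in_pivot_blow_up[of u v ts t0] p uv by auto
      with p show False
        by simp
    qed
  qed
  then have "card (D - ?B) \<le> card (?R' \<union> (\<Union>t\<in>set ts. X t) \<union> Low)"
    using finR finX by (intro card_mono) auto
  also have "\<dots> \<le> card ?R' + (\<Sum>t\<leftarrow>ts. card (X t)) + card Low"
    by (intro order_trans[OF card_Un_le] add_mono card_UN_list_le order_refl)
  finally have "real (card (D - ?B)) \<le> real (card ?R' + (\<Sum>t\<leftarrow>ts. card (X t)) + card Low)"
    by (rule of_nat_mono)
  also have "real (\<Sum>t\<leftarrow>ts. card (X t)) = (\<Sum>t\<leftarrow>ts. real (card (X t)))"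
    by (induction ts) auto
  then have "real (card ?R' + (\<Sum>t\<leftarrow>ts. card (X t)) + card Low) =
      real (card ?R') + (\<Sum>t\<leftarrow>ts. real (card (X t))) + real (card Low)"
    by simp
  also have "\<dots> \<le> (1 - \<xi>) ^ m * card R + m * (card inconsistent / n) + 3 * \<xi> * n\<^sup>2"
    using ts(2) low by linarith
  also have "\<dots> \<le> (1 - \<xi>) ^ m * n\<^sup>2 + m * (card inconsistent / n) + 3 * \<xi> * n\<^sup>2"
  proof -
    have "card R \<le> card (V \<times> V)"
      using fin sub by (intro card_mono) (auto simp: R_def)
    then have "real (card R) \<le> n\<^sup>2"
      by (simp add: n_def power2_eq_square card_cartesian_product flip: of_nat_mult)
    then show ?thesis
      using assms by (intro add_mono mult_left_mono) auto
  qed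
  finally show ?thesis
    by (auto simp: n_def)
qed

end

section \<open>Stability of dense digraphs with few closed walks\<close>

lemma closed_walk_upt:
  "closed_walk D (map f [0..<k]) \<longleftrightarrow> (\<forall>m<k. (f m, f (Suc m mod k)) \<in> D)"
proof -
  have "Suc m mod k < k" if "m < k" for m
    using that by (intro mod_less_divisor) linarith
  then show ?thesis
    by (auto simp: walk_of_def)
qed

lemma even_Suc_mod: "even k \<Longrightarrow> m < k \<Longrightarrow> even (Suc m mod k) \<longleftrightarrow> odd m"
  by (cases "Suc m = k") auto

text \<open>Induction from \<open>k\<close> down to \<open>l\<close> with
  \<open>card_walks_step\<close>. All bounds are relative to an ambient size \<open>N\<close>, which
  may exceed \<open>card V\<close>: the lemma is applied to the vertices of low double degree,
  possibly a tiny part of the digraph.\<close>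

lemma near_tournament_few_walks:
  fixes \<eta> :: real
  assumes "l \<le> k" "2 \<le> l" "0 < \<eta>"
  shows "\<exists>\<zeta>>0. \<forall>(V :: 'a set) D (N::real). arc_set V D \<longrightarrow> 0 < N \<longrightarrow> card V \<le> N \<longrightarrow>
    card (nonadjacent D \<inter> V \<times> V) + card (both_ways D \<inter> V \<times> V) \<le> \<zeta> * N\<^sup>2 \<longrightarrow>
    card (walks V D k) \<le> \<zeta> * N ^ k \<longrightarrow> card (walks V D l) \<le> \<eta> * N ^ l"
  using assms(1,3)
proof (induction arbitrary: \<eta> rule: inc_induct)
  case base
  then show ?case
    by (intro exI[of _ \<eta>]) simp
next
  case (step m)
  have m: "2 \<le> m"
    using assms step by simp
  \<comment> \<open>Near-twins then contribute \<eta>/4 through 6\<tau> and \<eta>/4 through the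
    square root, and the quotient by \<tau> N contributes \<eta>/2.\<close>
  define \<tau> where "\<tau> = \<eta> / 24"
  define \<eta>' where "\<eta>' = \<tau> * \<eta> / (4 * m)"
  have pos: "0 < \<tau>" "0 < \<eta>'"
    using step m by (simp_all add: \<tau>_def \<eta>'_def)
  obtain \<zeta>' where \<zeta>': "0 < \<zeta>'" and
    IH: "\<forall>(V :: 'a set) D (N::real). arc_set V D \<longrightarrow> 0 < N \<longrightarrow> card V \<le> N \<longrightarrow>
      card (nonadjacent D \<inter> V \<times> V) + card (both_ways D \<inter> V \<times> V) \<le> \<zeta>' * N\<^sup>2 \<longrightarrow>
      card (walks V D k) \<le> \<zeta>' * N ^ k \<longrightarrow> card (walks V D (Suc m)) \<le> \<eta>' * N ^ Suc m"
    using step.IH[OF pos(2)] by (elim exE conjE) (rule that)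
  define \<zeta> where "\<zeta> = min \<zeta>' (min \<eta>' ((\<eta> / 12)\<^sup>2))"
  have \<zeta>: "0 < \<zeta>" "\<zeta> \<le> \<zeta>'" "\<zeta> \<le> \<eta>'" "\<zeta> \<le> (\<eta> / 12)\<^sup>2"
    using \<zeta>' pos step.prems by (simp_all add: \<zeta>_def)
  show ?case
  proof (intro exI[of _ \<zeta>] conjI allI impI \<zeta>(1))
    fix V :: "'a set" and D and N :: real
    assume arc: "arc_set V D" and N: "0 < N" "card V \<le> N"
      and ns: "card (nonadjacent D \<inter> V \<times> V) + card (both_ways D \<inter> V \<times> V) \<le> \<zeta> * N\<^sup>2"
      and wk: "card (walks V D k) \<le> \<zeta> * N ^ k"
    interpret arc_set V D
      by (rule arc)
    have mono: "\<zeta> * N ^ j \<le> \<zeta>' * N ^ j" for j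
      using \<zeta> N by (intro mult_right_mono) auto
    have walks: "card (walks V D (Suc m)) \<le> \<eta>' * N ^ Suc m"
      using IH[rule_format, OF arc N order_trans[OF ns mono] order_trans[OF wk mono]] .
    have "card (walks V D m) \<le> N ^ (m - 1) * (6 * (\<tau> * N) + 3 * sqrt (\<zeta> * N\<^sup>2)) +
        (m * card (walks V D (Suc m)) + m * (N ^ (m - 1) * (\<zeta> * N\<^sup>2))) / (\<tau> * N)"
      using card_walks_step[OF ns _ m N(2), of "\<tau> * N"] pos N by simp
    also have "\<dots> \<le> N ^ (m - 1) * (\<eta> / 4 * N + \<eta> / 4 * N) + (\<eta> / 2 * N ^ m)"
    proof (intro add_mono mult_left_mono)
      show "6 * (\<tau> * N) \<le> \<eta> / 4 * N"
        by (simp add: \<tau>_def)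
      have "sqrt \<zeta> \<le> \<eta> / 12"
        using \<zeta> step.prems by (intro real_le_lsqrt) auto
      then have "3 * (sqrt \<zeta> * N) \<le> 3 * (\<eta> / 12 * N)"
        using N by (intro mult_left_mono mult_right_mono) auto
      then show "3 * sqrt (\<zeta> * N\<^sup>2) \<le> \<eta> / 4 * N"
        using N by (simp add: real_sqrt_mult)
      have Nm: "N ^ (m - 1) * N\<^sup>2 = N ^ Suc m"
        using m by (cases m) (auto simp: power2_eq_square)
      have "m * real (card (walks V D (Suc m))) + m * (N ^ (m - 1) * (\<zeta> * N\<^sup>2))
          \<le> m * (\<eta>' * N ^ Suc m) + m * (\<eta>' * N ^ Suc m)"
      proof (intro add_mono mult_left_mono walks)
        have "N ^ (m - 1) * (\<zeta> * N\<^sup>2) = \<zeta> * N ^ Suc m"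
          unfolding Nm[symmetric] by simp
        also have "\<dots> \<le> \<eta>' * N ^ Suc m"
          using \<zeta> N by (intro mult_right_mono) auto
        finally show "N ^ (m - 1) * (\<zeta> * N\<^sup>2) \<le> \<eta>' * N ^ Suc m" .
      qed auto
      also have "\<dots> = (\<eta> / 2 * N ^ m) * (\<tau> * N)"
        using m by (simp add: \<eta>'_def field_simps)
      finally show "(m * card (walks V D (Suc m)) + m * (N ^ (m - 1) * (\<zeta> * N\<^sup>2))) / (\<tau> * N) \<le> \<eta> / 2 * N ^ m"
        using pos N by (simp add: divide_le_eq)
    qed (use N in auto)
    also have "\<dots> = \<eta> * N ^ m"
      using m by (cases m) (auto simp: algebra_simps)
    finally show "card (walks V D m) \<le> \<eta> * N ^ m" .
  qed
qed

section \<open>Excess and deficit of double edges; degenerate walks as patterns\<close>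

context arc_set
begin

definition excess_sum :: nat where
  "excess_sum = (\<Sum>(u, v)\<in>both_ways D. excess u v)"

definition deficit_sum :: nat where
  "deficit_sum = (\<Sum>(u, v)\<in>both_ways D. deficit u v)"

lemma excess_sum_eq:
  "excess_sum = card {(u, v, w). (u, v) \<in> both_ways D \<and> w \<in> V \<and> (w, u) \<in> D \<and> (v, w) \<in> D}"
proof -
  have "excess_sum = card (SIGMA p:both_ways D. {w \<in> V. (w, fst p) \<in> D \<and> (snd p, w) \<in> D})"
    unfolding excess_sum_def excess_def using fin by (subst card_SigmaI) (auto simp: case_prod_beta)
  also have "\<dots> = card {(u, v, w). (u, v) \<in> both_ways D \<and> w \<in> V \<and> (w, u) \<in> D \<and> (v, w) \<in> D}"
    by (rule bij_betw_same_card[where f = "\<lambda>((u, v), w). (u, v, w)"])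
      (auto intro!: bij_betw_byWitness[where f' = "\<lambda>(u, v, w). ((u, v), w)"])
  finally show ?thesis .
qed

lemma deficit_sum_eq:
  "deficit_sum = card {(u, v, w). (u, v) \<in> both_ways D \<and> w \<in> V \<and> (w, u) \<notin> D \<and> (v, w) \<notin> D}"
proof -
  have "deficit_sum = card (SIGMA p:both_ways D. {w \<in> V. (w, fst p) \<notin> D \<and> (snd p, w) \<notin> D})"
    unfolding deficit_sum_def deficit_def using fin by (subst card_SigmaI) (auto simp: case_prod_beta)
  also have "\<dots> = card {(u, v, w). (u, v) \<in> both_ways D \<and> w \<in> V \<and> (w, u) \<notin> D \<and> (v, w) \<notin> D}"
    by (rule bij_betw_same_card[where f = "\<lambda>((u, v), w). (u, v, w)"])
      (auto intro!: bij_betw_byWitness[where f' = "\<lambda>(u, v, w). ((u, v), w)"])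
  finally show ?thesis .
qed

lemma card_unbalanced: "card unbalanced \<le> excess_sum + deficit_sum"
proof -
  have "unbalanced =
      {(u, v, w). (u, v) \<in> both_ways D \<and> w \<in> V \<and> (w, u) \<in> D \<and> (v, w) \<in> D} \<union>
      {(u, v, w). (u, v) \<in> both_ways D \<and> w \<in> V \<and> (w, u) \<notin> D \<and> (v, w) \<notin> D}"
    by (auto simp: unbalanced_def)
  then show ?thesis
    unfolding excess_sum_eq deficit_sum_eq by (simp add: card_Un_le)
qed

lemma sum_swap_both_ways: "(\<Sum>(u, v)\<in>both_ways D. f u v) = (\<Sum>(u, v)\<in>both_ways D. f v u)"
  by (rule sum.reindex_bij_witness[where i = prod.swap and j = prod.swap])
    (auto simp: both_ways_def)

lemma card_coarse:
  fixes \<theta> :: real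
  assumes "0 < \<theta>"
  shows "card {(u, v) \<in> both_ways D. \<not> excess u v + excess v u \<le> 2 * \<theta>} \<le> excess_sum / \<theta>"
proof -
  let ?C = "{(u, v) \<in> both_ways D. \<not> excess u v + excess v u \<le> 2 * \<theta>}"
  have "card ?C * (2 * \<theta>) = (\<Sum>p\<in>?C. 2 * \<theta>)"
    by simp
  also have "\<dots> \<le> (\<Sum>(u, v)\<in>?C. real (excess u v + excess v u))"
    by (intro sum_mono) auto
  also have "\<dots> \<le> (\<Sum>(u, v)\<in>both_ways D. real (excess u v + excess v u))"
    by (intro sum_mono2) auto
  also have "\<dots> = real (\<Sum>(u, v)\<in>both_ways D. excess u v) + real (\<Sum>(u, v)\<in>both_ways D. excess v u)"
    by (simp add: sum.distrib case_prod_beta)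
  also have "\<dots> = 2 * real excess_sum"
    using sum_swap_both_ways[of excess] by (simp add: excess_sum_def)
  finally show ?thesis
    using assms by (simp add: field_simps)
qed

lemma few_excess_upper_bound:
  fixes \<kappa> :: real
  assumes "0 < \<kappa>" "V \<noteq> {}" and few: "excess_sum \<le> \<kappa>\<^sup>2 / 4 * card V ^ 3" and S: "S \<subseteq> V"
  shows "card (D \<inter> S \<times> S) \<le> (card S)\<^sup>2 / 2 + \<kappa> * (card V)\<^sup>2"
proof -
  define n where "n = real (card V)"
  have n: "0 < n"
    using assms(2) fin by (simp add: n_def card_gt_0_iff)
  \<comment> \<open>This value equalises the errors: by Markov's inequality at most \<kappa> n^2 / 2
    pairs have larger excess, and \<theta> n is \<kappa> n^2 / 2 as well.\<close>
  define \<theta> where "\<theta> = \<kappa> / 2 * n"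
  have \<theta>: "0 < \<theta>"
    using n assms by (simp add: \<theta>_def)
  define C where "C = {(u, v) \<in> both_ways D. \<not> excess u v + excess v u \<le> 2 * \<theta>}"
  have "card C \<le> excess_sum / \<theta>"
    unfolding C_def by (rule card_coarse[OF \<theta>])
  also have "\<dots> \<le> \<kappa>\<^sup>2 / 4 * n ^ 3 / \<theta>"
    using few \<theta> by (intro divide_right_mono) (auto simp: n_def)
  also have "\<dots> = \<kappa> / 2 * n\<^sup>2"
    using n assms by (simp add: \<theta>_def field_simps power2_eq_square power3_eq_cube)
  finally have C: "card C \<le> \<kappa> / 2 * n\<^sup>2" .
  have "card (D \<inter> S \<times> S) \<le> (card S)\<^sup>2 / 2 + \<theta> * card S + card C"
  proof (rule arcs_upper_bound[OF S])
    show "finite C"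
      by (rule finite_subset[OF _ finite_both_ways]) (auto simp: C_def)
  qed (use \<theta> in \<open>auto simp: C_def\<close>)
  moreover have "\<theta> * card S \<le> \<theta> * n"
    using S fin \<theta> by (intro mult_left_mono) (auto simp: n_def card_mono)
  moreover have "\<theta> * n = \<kappa> / 2 * n\<^sup>2"
    by (simp add: \<theta>_def power2_eq_square)
  ultimately have "card (D \<inter> S \<times> S) \<le> (card S)\<^sup>2 / 2 + \<kappa> * n\<^sup>2"
    using C by linarith
  then show ?thesis
    by (simp add: n_def)
qed

text \<open>If many double edges had deficit of order \<mu> n, deleting about \<mu> n / 4 disjoint
  ones would lose so few arcs that the remaining vertices would span more arcs than
  \<open>upper\<close> allows.\<close>

lemma deficit_sum_bound:
  fixes \<mu> \<kappa> \<gamma> e :: real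
  assumes \<mu>: "0 < \<mu>" and n: "8 / \<mu> \<le> card V" "V \<noteq> {}"
    and dense: "(1 / 2 - \<gamma>) * (card V)\<^sup>2 \<le> card D"
    and upper: "\<And>S. S \<subseteq> V \<Longrightarrow> card (D \<inter> S \<times> S) \<le> (card S)\<^sup>2 / 2 + \<kappa> * (card V)\<^sup>2"
    and few: "excess_sum \<le> e * card V ^ 3" and small: "\<gamma> + \<kappa> < \<mu>\<^sup>2 / 32"
  shows "deficit_sum \<le> (2 * \<mu> + 8 * e / \<mu>) * card V ^ 3"
proof -
  define n where "n = real (card V)"
  have n0: "0 < n" and n8: "8 \<le> \<mu> * n"
    using n \<mu> fin by (simp_all add: n_def card_gt_0_iff field_simps)
  define \<theta> where "\<theta> = \<mu> / 8 * n"
  have \<theta>: "0 < \<theta>"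
    using n0 \<mu> by (simp add: \<theta>_def)
  define C where "C = {(u, v) \<in> both_ways D. \<not> excess u v + excess v u \<le> 2 * \<theta>}"
  define X where "X = {(u, v) \<in> both_ways D - C. \<mu> * n \<le> deficit u v + deficit v u}"
  have finCX: "finite C" "finite X"
    by (rule finite_subset[OF _ finite_both_ways]; auto simp: C_def X_def)+
  have "card C \<le> excess_sum / \<theta>"
    unfolding C_def by (rule card_coarse[OF \<theta>])
  also have "\<dots> \<le> e * n ^ 3 / \<theta>"
    using few \<theta> by (intro divide_right_mono) (auto simp: n_def)
  also have "\<dots> = 8 * e / \<mu> * n\<^sup>2"
    using n0 \<mu> by (simp add: \<theta>_def field_simps power2_eq_square power3_eq_cube)
  finally have C: "card C \<le> 8 * e / \<mu> * n\<^sup>2" .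
  have X: "card X \<le> \<mu> * n\<^sup>2"
  proof (rule ccontr)
    assume *: "\<not> ?thesis"
    \<comment> \<open>For q between x/2 and x the contradiction gains q(3x - 2q), at least x^2/2 =
      \<mu>^2 n^2 / 32, which is the threshold in \<open>small\<close>. The lower bound 8/\<mu> on
      the order makes x at least 2, so rounding down loses at most half of it.\<close>
    define x where "x = \<mu> * n / 4"
    define q where "q = nat \<lfloor>x\<rfloor>"
    have x: "2 \<le> x"
      using n8 by (simp add: x_def)
    have q: "real q \<le> x" "x / 2 \<le> q"
      using x unfolding q_def by linarith+
    have "real (4 * q * card V) = 4 * q * n"
      by (simp add: n_def)
    also have "\<dots> \<le> 4 * x * n"
      using q n0 by (intro mult_right_mono) auto
    also have "\<dots> = \<mu> * n\<^sup>2"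
      by (simp add: x_def power2_eq_square)
    finally have "real (4 * q * card V) < real (card X)"
      using * by linarith
    then have "4 * q * card V < card X"
      by (simp only: of_nat_less_iff)
    then obtain S where S: "S \<subseteq> V" "card S + 2 * q = card V"
      "card D \<le> card (D \<inter> S \<times> S) + q * (2 * card V + 2 * \<theta> - \<mu> * n)"
      using delete_deficient_pairs[of X \<theta> "\<mu> * n" q] by (auto simp: X_def C_def)
    have cS: "real (card S) = n - 2 * q"
      using S(2) by (simp add: n_def flip: S(2))
    have "(1 / 2 - \<gamma>) * n\<^sup>2 \<le> (n - 2 * q)\<^sup>2 / 2 + \<kappa> * n\<^sup>2 + q * (2 * n + 2 * \<theta> - \<mu> * n)"
      using dense S(3) upper[OF S(1)] cS by (simp add: n_def)
    also have "\<dots> = n\<^sup>2 / 2 + \<kappa> * n\<^sup>2 + q * (2 * q - 3 * x)"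
      by (simp add: \<theta>_def x_def power2_eq_square field_simps)
    finally have "q * (3 * x - 2 * q) \<le> (\<gamma> + \<kappa>) * n\<^sup>2"
      by (simp add: algebra_simps)
    moreover have "(x / 2) * x \<le> q * (3 * x - 2 * q)"
      using q x by (intro mult_mono) auto
    moreover have "(x / 2) * x = \<mu>\<^sup>2 / 32 * n\<^sup>2"
      by (simp add: x_def power2_eq_square)
    moreover have "(\<gamma> + \<kappa>) * n\<^sup>2 < \<mu>\<^sup>2 / 32 * n\<^sup>2"
      using small n0 by (intro mult_strict_right_mono) auto
    ultimately show False
      by linarith
  qed
  have both: "card (both_ways D) \<le> n\<^sup>2"
  proof -
    have "card (both_ways D) \<le> card (V \<times> V)"
      using fin both_ways_V by (intro card_mono) auto
    then have "real (card (both_ways D)) \<le> real (card (V \<times> V))"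
      by (rule of_nat_mono)
    then show ?thesis
      by (simp add: n_def power2_eq_square card_cartesian_product)
  qed
  have dn: "real (deficit u v) \<le> n" for u v
    unfolding deficit_def n_def using fin by (intro of_nat_mono card_mono) auto
  have "real deficit_sum = (\<Sum>p\<in>both_ways D. real (deficit (fst p) (snd p)))"
    by (simp add: deficit_sum_def case_prod_beta)
  also have "\<dots> \<le> (\<Sum>p\<in>both_ways D. \<mu> * n + (of_bool (p \<in> C) * n + of_bool (p \<in> X) * n))"
  proof (rule sum_mono)
    fix p assume p: "p \<in> both_ways D"
    show "real (deficit (fst p) (snd p)) \<le> \<mu> * n + (of_bool (p \<in> C) * n + of_bool (p \<in> X) * n)"
    proof (cases "p \<in> C \<or> p \<in> X")
      case True
      have "0 \<le> \<mu> * n"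
        using \<mu> n0 by simp
      then show ?thesis
        using True dn[of "fst p" "snd p"] n0 by auto
    next
      case False
      then show ?thesis
        using p by (auto simp: X_def case_prod_beta)
    qed
  qed
  also have "\<dots> = card (both_ways D) * (\<mu> * n) +
      ((\<Sum>p\<in>both_ways D. of_bool (p \<in> C)) * n + (\<Sum>p\<in>both_ways D. of_bool (p \<in> X)) * n)"
    by (simp add: sum.distrib sum_distrib_right)
  also have "(\<Sum>p\<in>both_ways D. of_bool (p \<in> C)) = real (card C)"
    by (simp add: Int_absorb2 C_def)
      (metis (no_types, lifting) Int_absorb1 case_prodD mem_Collect_eq subrelI)
  also have "(\<Sum>p\<in>both_ways D. of_bool (p \<in> X)) = real (card X)"
  proof -
    have "both_ways D \<inter> X = X"
      by (auto simp: X_def)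
    then show ?thesis
      by simp
  qed
  also have "card (both_ways D) * (\<mu> * n) + (card C * n + card X * n) \<le>
      n\<^sup>2 * (\<mu> * n) + (8 * e / \<mu> * n\<^sup>2 * n + \<mu> * n\<^sup>2 * n)"
    using both C X \<mu> n0 by (intro add_mono mult_right_mono) auto
  also have "\<dots> = (2 * \<mu> + 8 * e / \<mu>) * n ^ 3"
    by (simp add: power2_eq_square power3_eq_cube algebra_simps)
  finally show ?thesis
    by (simp add: n_def)
qed

text \<open>Going back and forth along a double edge closes up after an even number of
  steps.\<close>

lemma card_both_ways_pattern:
  assumes "even k"
  shows "card (both_ways D) \<le> card (pattern_walks V D (map (\<lambda>m. m mod 2) [0..<k]) 2)"
proof (rule card_inj_on_le)
  show "inj_on (\<lambda>(u, v). [u, v]) (both_ways D)"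
    by (auto simp: inj_on_def)
  show "(\<lambda>(u, v). [u, v]) ` both_ways D \<subseteq> pattern_walks V D (map (\<lambda>m. m mod 2) [0..<k]) 2"
  proof clarify
    fix u v assume uv: "(u, v) \<in> both_ways D"
    have "[u, v] ! (m mod 2) = (if even m then u else v)" for m :: nat
      by (simp add: even_iff_mod_2_eq_zero odd_iff_mod_2_eq_one)
    then have "closed_walk D (map ((!) [u, v]) (map (\<lambda>m. m mod 2) [0..<k]))"
      using uv assms by (auto simp: closed_walk_upt o_def even_Suc_mod both_ways_def)
    then show "[u, v] \<in> pattern_walks V D (map (\<lambda>m. m mod 2) [0..<k]) 2"
      using uv both_ways_V by (auto simp: pattern_walks_def tuples_def)
  qed
qed (use fin in \<open>simp add: pattern_walks_def\<close>)

text \<open>For odd length: back and forth along the double edge until \<open>v\<close> is reached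
  at position \<open>k - 2\<close>, then back to \<open>u\<close> through \<open>w\<close>.\<close>

lemma excess_sum_pattern:
  assumes "odd k" "3 \<le> k"
  shows "excess_sum \<le> card (pattern_walks V D (map (\<lambda>m. if m = k - 1 then 2 else m mod 2) [0..<k]) 3)"
    (is "_ \<le> card (pattern_walks V D ?x 3)")
  unfolding excess_sum_eq
proof (rule card_inj_on_le)
  let ?E = "{(u, v, w). (u, v) \<in> both_ways D \<and> w \<in> V \<and> (w, u) \<in> D \<and> (v, w) \<in> D}"
  show "inj_on (\<lambda>(u, v, w). [u, v, w]) ?E"
    by (auto simp: inj_on_def)
  show "(\<lambda>(u, v, w). [u, v, w]) ` ?E \<subseteq> pattern_walks V D ?x 3"
  proof clarify
    fix u v w assume uvw: "(u, v) \<in> both_ways D" "w \<in> V" "(w, u) \<in> D" "(v, w) \<in> D"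
    define f where "f m = (if m = k - 1 then w else if even m then u else v)" for m
    have "map ((!) [u, v, w]) ?x = map f [0..<k]"
      by (auto simp: f_def even_iff_mod_2_eq_zero odd_iff_mod_2_eq_one)
    moreover have "closed_walk D (map f [0..<k])"
      unfolding closed_walk_upt
    proof (intro allI impI)
      fix m assume m: "m < k"
      consider "m = k - 1" | "Suc m = k - 1" | "Suc m < k - 1"
        using m by linarith
      then show "(f m, f (Suc m mod k)) \<in> D"
      proof cases
        case 1
        then have "Suc m mod k = 0"
          using assms by simp
        then show ?thesis
          using 1 uvw assms by (simp add: f_def)
      next
        case 2
        then have "k = Suc (Suc m)"
          using assms by linarith
        then show ?thesis
          using uvw assms by (simp add: f_def)
      next
        case 3
        then show ?thesis
          using uvw assms by (auto simp: f_def both_ways_def)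
      qed
    qed
    ultimately have "closed_walk D (map ((!) [u, v, w]) ?x)"
      by (simp only:)
    then show "[u, v, w] \<in> pattern_walks V D ?x 3"
      using uvw both_ways_V by (auto simp: pattern_walks_def tuples_def)
  qed
qed (use fin in \<open>simp add: pattern_walks_def\<close>)

text \<open>Once round the triangle, then back and forth between \<open>a\<close> and
  \<open>d\<close> for the remaining even number of steps.\<close>

lemma triangles_both_ways_pattern:
  assumes "odd k" "5 \<le> k"
  shows "card {(a, b, c, d). (a, b, c) \<in> triangles \<and> (a, d) \<in> both_ways D} \<le>
    card (pattern_walks V D (map (\<lambda>m. if m < 3 then m else if odd m then 0 else 3) [0..<k]) 4)"
    (is "card ?Q \<le> card (pattern_walks V D ?x 4)")
proof (rule card_inj_on_le)
  show "inj_on (\<lambda>(a, b, c, d). [a, b, c, d]) ?Q"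
    by (auto simp: inj_on_def)
  show "(\<lambda>(a, b, c, d). [a, b, c, d]) ` ?Q \<subseteq> pattern_walks V D ?x 4"
  proof clarify
    fix a b c d assume abc: "(a, b, c) \<in> triangles" and ad: "(a, d) \<in> both_ways D"
    have arcs: "(a, b) \<in> D" "(b, c) \<in> D" "(c, a) \<in> D" "(a, d) \<in> D" "(d, a) \<in> D"
      using abc ad by (auto simp: triangles_def both_ways_def)
    define f where "f m = (if m = 0 then a else if m = 1 then b else if m = 2 then c else if odd m then a else d)"
      for m :: nat
    have "[a, b, c, d] ! (if m < 3 then m else if odd m then 0 else 3) = f m" for m
      by (auto simp: f_def less_Suc_eq numeral_3_eq_3)
    then have "map ((!) [a, b, c, d]) ?x = map f [0..<k]"
      by simp
    moreover have "closed_walk D (map f [0..<k])"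
      unfolding closed_walk_upt
    proof (intro allI impI)
      fix m assume m: "m < k"
      consider "Suc m = k" | "Suc m < k" "m = 0" | "Suc m < k" "m = 1" | "Suc m < k" "m = 2" |
          "Suc m < k" "3 \<le> m"
        using m by linarith
      then show "(f m, f (Suc m mod k)) \<in> D"
      proof cases
        case 1
        have "even m" "3 < m"
          using 1 assms by auto
        then have "f m = d"
          by (simp add: f_def)
        then show ?thesis
          using 1 arcs by (simp add: f_def)
      next
        case 5
        then have "f m = (if odd m then a else d)" "f (Suc m) = (if odd m then d else a)"
          by (auto simp: f_def)
        then show ?thesis
          using 5 arcs by simp
      qed (use arcs in \<open>simp_all add: f_def\<close>)
    qed
    ultimately have "closed_walk D (map ((!) [a, b, c, d]) ?x)"
      by (simp only:)
    then show "[a, b, c, d] \<in> pattern_walks V D ?x 4"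
      using arcs sub by (auto simp: pattern_walks_def tuples_def)
  qed
qed (use fin in \<open>simp add: pattern_walks_def\<close>)

lemma card_triangles_eq: "card triangles = card (walks V D 3)"
proof (rule bij_betw_same_card[where f = "\<lambda>(a, b, c). [a, b, c]"],
    rule bij_betw_byWitness[where f' = "\<lambda>xs. (xs ! 0, xs ! 1, xs ! 2)"])
  have eq: "xs = [xs ! 0, xs ! 1, xs ! 2]" if "length xs = 3" for xs :: "'a list"
    using that by (auto simp: length_Suc_conv numeral_3_eq_3 numeral_2_eq_2)
  show "\<forall>xs\<in>walks V D 3. (\<lambda>(a, b, c). [a, b, c]) (xs ! 0, xs ! 1, xs ! 2) = xs"
    using eq by (simp add: walks_def tuples_def)
  show "(\<lambda>xs. (xs ! 0, xs ! 1, xs ! 2)) ` walks V D 3 \<subseteq> triangles"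
  proof clarify
    fix xs assume xs: "xs \<in> walks V D 3"
    then have "closed_walk D [xs ! 0, xs ! 1, xs ! 2]"
      using eq[of xs] by (simp add: walks_def tuples_def)
    then show "(xs ! 0, xs ! 1, xs ! 2) \<in> triangles"
      unfolding closed_walk_3 by (simp add: triangles_def)
  qed
qed (use sub in \<open>auto simp: triangles_def walks_def tuples_def closed_walk_3\<close>)

end

text \<open>
  Families of arc sets indexed along a filter, so that error terms can be handled as limits.
\<close>

locale few_walks_family =
  fixes F :: "'i filter" and V :: "'i \<Rightarrow> 'a set" and D :: "'i \<Rightarrow> ('a \<times> 'a) set" and k :: nat
  assumes k: "3 \<le> k" and arcs: "\<And>i. arc_set (V i) (D i)" and ne: "\<And>i. V i \<noteq> {}"
    and few: "\<And>\<epsilon>::real. 0 < \<epsilon> \<Longrightarrow> \<forall>\<^sub>F i in F. card (walks (V i) (D i) k) \<le> \<epsilon> * card (V i) ^ k"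
begin

lemma finV: "finite (V i)"
  using arcs[of i] by (simp add: arc_set_def)

lemma cardV: "0 < card (V i)"
  using ne finV by (simp add: card_gt_0_iff)

text \<open>This is X = o(n^r) along the filter, n being the number of vertices.\<close>

definition small :: "nat \<Rightarrow> ('i \<Rightarrow> nat) \<Rightarrow> bool" where
  "small r X \<longleftrightarrow> (\<forall>\<kappa>::real. 0 < \<kappa> \<longrightarrow> (\<forall>\<^sub>F i in F. X i \<le> \<kappa> * card (V i) ^ r))"

lemma smallI: "(\<And>\<kappa>::real. 0 < \<kappa> \<Longrightarrow> \<forall>\<^sub>F i in F. X i \<le> \<kappa> * card (V i) ^ r) \<Longrightarrow> small r X"
  by (simp add: small_def)

lemma smallD: "small r X \<Longrightarrow> 0 < \<kappa> \<Longrightarrow> \<forall>\<^sub>F i in F. X i \<le> (\<kappa>::real) * card (V i) ^ r"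
  by (simp add: small_def)

lemma small_mono:
  assumes "small r X" "\<And>i. Y i \<le> X i"
  shows "small r Y"
proof (rule smallI)
  fix \<kappa> :: real assume "0 < \<kappa>"
  from smallD[OF assms(1) this] show "\<forall>\<^sub>F i in F. Y i \<le> \<kappa> * card (V i) ^ r"
  proof eventually_elim
    case (elim i)
    have "real (Y i) \<le> real (X i)"
      using assms(2) by simp
    with elim show ?case
      by linarith
  qed
qed

lemma small_add:
  assumes "small r X" "small r Y"
  shows "small r (\<lambda>i. X i + Y i)"
proof (rule smallI)
  fix \<kappa> :: real assume "0 < \<kappa>"
  then have "0 < \<kappa> / 2"
    by simp
  from smallD[OF assms(1) this] smallD[OF assms(2) this]
  show "\<forall>\<^sub>F i in F. (X i + Y i) \<le> \<kappa> * card (V i) ^ r"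
    by eventually_elim (simp add: field_simps)
qed

lemma small_cmult:
  assumes "small r X"
  shows "small r (\<lambda>i. c * X i)"
proof (rule smallI)
  fix \<kappa> :: real assume \<kappa>: "0 < \<kappa>"
  then have "0 < \<kappa> / Suc c"
    by simp
  from smallD[OF assms this] show "\<forall>\<^sub>F i in F. (c * X i) \<le> \<kappa> * card (V i) ^ r"
  proof eventually_elim
    case (elim i)
    have "real (c * X i) \<le> Suc c * real (X i)"
      by (simp add: algebra_simps)
    also have "\<dots> \<le> Suc c * (\<kappa> / Suc c * card (V i) ^ r)"
      using elim by (intro mult_left_mono) auto
    finally show ?case
      by (simp del: of_nat_Suc)
  qed
qed

lemma small_times_card:
  assumes "small r X"
  shows "small (Suc r) (\<lambda>i. X i * card (V i))"
proof (rule smallI)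
  fix \<kappa> :: real assume "0 < \<kappa>"
  from smallD[OF assms this] show "\<forall>\<^sub>F i in F. (X i * card (V i)) \<le> \<kappa> * card (V i) ^ Suc r"
  proof eventually_elim
    case (elim i)
    then have "real (X i) * card (V i) \<le> \<kappa> * card (V i) ^ r * card (V i)"
      by (intro mult_right_mono) auto
    then show ?case
      by (simp add: mult_ac)
  qed
qed

lemma small_pattern:
  assumes "length x = k" "set x = {..<r}"
  shows "small r (\<lambda>i. card (pattern_walks (V i) (D i) x r))"
proof (rule smallI)
  fix \<kappa> :: real assume \<kappa>: "0 < \<kappa>"
  obtain e where e: "e > 0" and dens: "\<forall>V::'a set. \<forall>D. finite V \<longrightarrow> V \<noteq> {} \<longrightarrow> irrefl D \<longrightarrow>
      (card (pattern_walks V D x r) / card V ^ r) ^ e \<le> card (walks V D k) / card V ^ k"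
    using pattern_walks_density[OF assms, where 'a = 'a] by (elim exE conjE) (rule that)
  have "0 < \<kappa> ^ e"
    using \<kappa> by simp
  from few[OF this] show "\<forall>\<^sub>F i in F. card (pattern_walks (V i) (D i) x r) \<le> \<kappa> * card (V i) ^ r"
  proof eventually_elim
    case (elim i)
    have irr: "irrefl (D i)"
      using arcs[of i] by (simp add: arc_set_def)
    have "(card (pattern_walks (V i) (D i) x r) / card (V i) ^ r) ^ e \<le> card (walks (V i) (D i) k) / card (V i) ^ k"
      by (rule dens[rule_format, OF finV ne irr])
    also have "\<dots> \<le> \<kappa> ^ e"
      using elim cardV[of i] by (simp add: divide_le_eq)
    finally have "card (pattern_walks (V i) (D i) x r) / card (V i) ^ r \<le> \<kappa>"
      using e \<kappa> by (simp add: power_mono_iff)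
    then show ?case
      using cardV[of i] by (simp add: divide_le_eq)
  qed
qed

lemma small_both_ways:
  assumes "even k"
  shows "small 2 (\<lambda>i. card (both_ways (D i)))"
proof (rule small_mono[OF small_pattern])
  show "set (map (\<lambda>m. m mod 2) [0..<k]) = {..<2}"
  proof
    show "{..<2} \<subseteq> set (map (\<lambda>m. m mod 2) [0..<k])"
    proof
      fix j :: nat assume "j \<in> {..<2}"
      then have "j \<in> {0..<k}" "j = j mod 2"
        using k by auto
      then show "j \<in> set (map (\<lambda>m. m mod 2) [0..<k])"
        unfolding set_map set_upt by (metis imageI)
    qed
  qed auto
  show "card (both_ways (D i)) \<le> card (pattern_walks (V i) (D i) (map (\<lambda>m. m mod 2) [0..<k]) 2)" for i
    by (rule arc_set.card_both_ways_pattern[OF arcs assms])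
qed simp

text \<open>For even \<open>k\<close> the double edges themselves are rare; for odd \<open>k\<close>
  a triangle on a double edge is a degenerate closed walk.\<close>

lemma small_excess: "small 3 (\<lambda>i. arc_set.excess_sum (V i) (D i))"
proof (cases "even k")
  case True
  have le: "arc_set.excess_sum (V i) (D i) \<le> card (both_ways (D i)) * card (V i)" for i
  proof -
    interpret arc_set "V i" "D i"
      by (rule arcs)
    have "excess_sum \<le> (\<Sum>p\<in>both_ways (D i). card (V i))"
      unfolding excess_sum_def excess_def by (intro sum_mono) (auto intro!: card_mono finV)
    then show ?thesis
      by simp
  qed
  have "small (Suc 2) (\<lambda>i. card (both_ways (D i)) * card (V i))"
    by (intro small_times_card small_both_ways True)
  then show ?thesis
    unfolding numeral_3_eq_3 numeral_2_eq_2 using le by (rule small_mono)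
next
  case False
  let ?f = "\<lambda>m. if m = k - 1 then 2 else m mod 2"
  show ?thesis
  proof (rule small_mono[OF small_pattern])
    show "set (map ?f [0..<k]) = {..<3}"
    proof
      have "0 \<in> ?f ` {0..<k}"
        by (rule image_eqI[of _ _ 0]) (use k in auto)
      moreover have "1 \<in> ?f ` {0..<k}"
        by (rule image_eqI[of _ _ 1]) (use k in auto)
      moreover have "2 \<in> ?f ` {0..<k}"
        by (rule image_eqI[of _ _ "k - 1"]) (use k in auto)
      ultimately have "{0, 1, 2} \<subseteq> ?f ` {0..<k}"
        by simp
      then show "{..<3} \<subseteq> set (map ?f [0..<k])"
        by (auto simp: numeral_3_eq_3 numeral_2_eq_2 lessThan_Suc)
    qed auto
    show "arc_set.excess_sum (V i) (D i) \<le> card (pattern_walks (V i) (D i) (map ?f [0..<k]) 3)" for i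
      by (rule arc_set.excess_sum_pattern[OF arcs False k])
  qed simp
qed

text \<open>The case \<open>k = 3\<close> stands apart because the four-vertex pattern takes at
  least five steps; there the triangles are themselves the walks assumed to be rare. For even
  \<open>k\<close> the double edges are rare.\<close>

lemma small_triangles_both_ways:
  "small 4 (\<lambda>i. card {(a, b, c, d). (a, b, c) \<in> arc_set.triangles (D i) \<and> (a, d) \<in> both_ways (D i)})"
proof -
  have 4: "4 = Suc 3" "3 = Suc 2"
    by simp_all
  have "even k \<or> k = 3 \<or> odd k \<and> 5 \<le> k"
    using k by presburger
  then consider "even k" | "k = 3" | "odd k" "5 \<le> k"
    by blast
  then show ?thesis
  proof cases
    case 1
    have le: "card {(a, b, c, d). (a, b, c) \<in> arc_set.triangles (D i) \<and> (a, d) \<in> both_ways (D i)}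
        \<le> card (both_ways (D i)) * card (V i) * card (V i)" for i
    proof -
      interpret arc_set "V i" "D i"
        by (rule arcs)
      have "{(a, b, c, d). (a, b, c) \<in> triangles \<and> (a, d) \<in> both_ways (D i)} \<subseteq>
          (\<lambda>(((a, d), b), c). (a, b, c, d)) ` ((both_ways (D i) \<times> V i) \<times> V i)"
      proof
        fix p assume "p \<in> {(a, b, c, d). (a, b, c) \<in> triangles \<and> (a, d) \<in> both_ways (D i)}"
        then obtain a b c d where p: "p = (a, b, c, d)" "(a, b, c) \<in> triangles" "(a, d) \<in> both_ways (D i)"
          by auto
        then have "b \<in> V i" "c \<in> V i"
          using sub by (auto simp: triangles_def)
        then show "p \<in> (\<lambda>(((a, d), b), c). (a, b, c, d)) ` ((both_ways (D i) \<times> V i) \<times> V i)"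
          using p by (intro image_eqI[of _ _ "(((a, d), b), c)"]) simp_all
      qed
      then have "card {(a, b, c, d). (a, b, c) \<in> triangles \<and> (a, d) \<in> both_ways (D i)} \<le>
          card ((both_ways (D i) \<times> V i) \<times> V i)"
        using finV by (intro surj_card_le) auto
      then show ?thesis
        by (simp add: card_cartesian_product)
    qed
    show ?thesis
      unfolding 4 by (rule small_mono[OF small_times_card[OF small_times_card[OF small_both_ways[OF 1]]] le])
  next
    case 2
    have le: "card {(a, b, c, d). (a, b, c) \<in> arc_set.triangles (D i) \<and> (a, d) \<in> both_ways (D i)}
        \<le> card (walks (V i) (D i) k) * card (V i)" for i
    proof -
      interpret arc_set "V i" "D i"
        by (rule arcs)
      have "{(a, b, c, d). (a, b, c) \<in> triangles \<and> (a, d) \<in> both_ways (D i)} \<subseteq>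
          (\<lambda>((a, b, c), d). (a, b, c, d)) ` (triangles \<times> V i)"
      proof
        fix p assume "p \<in> {(a, b, c, d). (a, b, c) \<in> triangles \<and> (a, d) \<in> both_ways (D i)}"
        then obtain a b c d where p: "p = (a, b, c, d)" "(a, b, c) \<in> triangles" "(a, d) \<in> both_ways (D i)"
          by auto
        then show "p \<in> (\<lambda>((a, b, c), d). (a, b, c, d)) ` (triangles \<times> V i)"
          using both_ways_V by (intro image_eqI[of _ _ "((a, b, c), d)"]) auto
      qed
      then have "card {(a, b, c, d). (a, b, c) \<in> triangles \<and> (a, d) \<in> both_ways (D i)} \<le>
          card (triangles \<times> V i)"
        using finV by (intro surj_card_le) auto
      then show ?thesis
        using card_triangles_eq 2 by (simp add: card_cartesian_product)
    qed
    have "small k (\<lambda>i. card (walks (V i) (D i) k))"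
      by (rule smallI[OF few])
    then show ?thesis
      unfolding 4(1) using 2 le by (intro small_mono[OF small_times_card]) auto
  next
    case 3
    let ?f = "\<lambda>m. if m < 3 then m else if odd m then 0 else 3"
    show ?thesis
    proof (rule small_mono[OF small_pattern])
      show "set (map ?f [0..<k]) = {..<4}"
      proof
        have "0 \<in> ?f ` {0..<k}"
          by (rule image_eqI[of _ _ 0]) (use 3 in auto)
        moreover have "1 \<in> ?f ` {0..<k}"
          by (rule image_eqI[of _ _ 1]) (use 3 in auto)
        moreover have "2 \<in> ?f ` {0..<k}"
          by (rule image_eqI[of _ _ 2]) (use 3 in auto)
        moreover have "3 \<in> ?f ` {0..<k}"
          by (rule image_eqI[of _ _ 4]) (use 3 in auto)
        ultimately have "{0, 1, 2, 3} \<subseteq> ?f ` {0..<k}"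
          by simp
        moreover have "{..<4} = {0, 1, 2, 3::nat}"
          by auto
        ultimately show "{..<4} \<subseteq> set (map ?f [0..<k])"
          by simp
      qed auto
      show "card {(a, b, c, d). (a, b, c) \<in> arc_set.triangles (D i) \<and> (a, d) \<in> both_ways (D i)} \<le>
          card (pattern_walks (V i) (D i) (map ?f [0..<k]) 4)" for i
        by (rule arc_set.triangles_both_ways_pattern[OF arcs 3])
    qed simp
  qed
qed

lemma eventually_upper_bound:
  fixes \<kappa> :: real
  assumes "0 < \<kappa>"
  shows "\<forall>\<^sub>F i in F. \<forall>S\<subseteq>V i. card (D i \<inter> S \<times> S) \<le> (card S)\<^sup>2 / 2 + \<kappa> * (card (V i))\<^sup>2"
proof -
  have "0 < \<kappa>\<^sup>2 / 4"
    using assms by simp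
  from smallD[OF small_excess this] show ?thesis
  proof eventually_elim
    case (elim i)
    then show ?case
      using arc_set.few_excess_upper_bound[OF arcs assms ne, of i] by simp
  qed
qed

end

section \<open>Families of almost maximal density\<close>

locale extremal_family = few_walks_family F V D k
  for F :: "'i filter" and V :: "'i \<Rightarrow> 'a set" and D :: "'i \<Rightarrow> ('a \<times> 'a) set" and k +
  assumes dense: "\<And>\<epsilon>::real. 0 < \<epsilon> \<Longrightarrow> \<forall>\<^sub>F i in F. (1 / 2 - \<epsilon>) * (card (V i))\<^sup>2 \<le> card (D i)"
    and large: "\<And>m. \<forall>\<^sub>F i in F. m \<le> card (V i)"
begin

lemma small_deficit: "small 3 (\<lambda>i. arc_set.deficit_sum (V i) (D i))"
proof (rule smallI)
  fix \<kappa> :: real assume \<kappa>: "0 < \<kappa>"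
  \<comment> \<open>Both terms 2\<mu> and 8e/\<mu> of \<open>deficit_sum_bound\<close> become
    \<kappa>/2.\<close>
  define \<mu> where "\<mu> = \<kappa> / 4"
  define e where "e = \<mu> * \<kappa> / 16"
  define \<gamma> where "\<gamma> = \<mu>\<^sup>2 / 128"
  have pos: "0 < \<mu>" "0 < e" "0 < \<gamma>"
    using \<kappa> by (simp_all add: \<mu>_def e_def \<gamma>_def)
  have lt: "\<gamma> + \<gamma> < \<mu>\<^sup>2 / 32"
    using pos by (simp add: \<gamma>_def)
  show "\<forall>\<^sub>F i in F. arc_set.deficit_sum (V i) (D i) \<le> \<kappa> * card (V i) ^ 3"
    using smallD[OF small_excess pos(2)] eventually_upper_bound[OF pos(3)] dense[OF pos(3)]
      large[of "nat \<lceil>8 / \<mu>\<rceil>"]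
  proof eventually_elim
    case (elim i)
    have "8 / \<mu> \<le> card (V i)"
      using elim(4) by linarith
    then have "arc_set.deficit_sum (V i) (D i) \<le> (2 * \<mu> + 8 * e / \<mu>) * card (V i) ^ 3"
      using elim by (intro arc_set.deficit_sum_bound[OF arcs pos(1) _ ne _ _ _ lt]) auto
    also have "2 * \<mu> + 8 * e / \<mu> = \<kappa>"
      using pos by (simp add: e_def \<mu>_def)
    finally show ?case .
  qed
qed

lemma small_unbalanced: "small 3 (\<lambda>i. card (arc_set.unbalanced (V i) (D i)))"
  by (rule small_mono[OF small_add[OF small_excess small_deficit]])
    (rule arc_set.card_unbalanced[OF arcs])

lemma eventually_low:
  fixes \<delta> :: real
  assumes "0 < \<delta>"
  defines "L \<equiv> \<lambda>i. {v \<in> V i. arc_set.double_degree (V i) (D i) v < \<delta> * card (V i)}"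
  shows "\<forall>\<^sub>F i in F. card (nonadjacent (D i) \<inter> L i \<times> L i) \<le> 6 * \<delta> * (card (V i))\<^sup>2"
  using eventually_upper_bound[OF assms(1)] dense[OF assms(1)]
proof eventually_elim
  case (elim i)
  interpret arc_set "V i" "D i"
    by (rule arcs)
  have "card (nonadjacent (D i) \<inter> L i \<times> L i) \<le>
      (real (card (V i)))\<^sup>2 - 2 * real (card (D i)) + 2 * (\<delta> * (card (V i))\<^sup>2) + 2 * ((\<delta> * card (V i)) * card (V i))"
    unfolding L_def using elim(1) assms(1) by (intro card_nonadjacent_low) auto
  also have "\<dots> = (real (card (V i)))\<^sup>2 - 2 * real (card (D i)) + 4 * \<delta> * (card (V i))\<^sup>2"
    by (simp add: power2_eq_square)
  also have "\<dots> \<le> 6 * \<delta> * (card (V i))\<^sup>2"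
    using elim(2) by (simp add: algebra_simps)
  finally show ?case .
qed

lemma small_split_nonadjacent: "small 3 (\<lambda>i. card (arc_set.split_nonadjacent (V i) (D i)))"
proof (rule smallI)
  fix \<kappa> :: real assume \<kappa>: "0 < \<kappa>"
  \<comment> \<open>The nonadjacent pairs of low double degree contribute 6\<delta> = \<kappa>/2,
    and the unbalanced triples 12\<beta>/\<delta> = \<kappa>/2.\<close>
  define \<delta> where "\<delta> = \<kappa> / 12"
  define \<beta> where "\<beta> = \<kappa> * \<delta> / 24"
  have pos: "0 < \<delta>" "0 < \<beta>"
    using \<kappa> by (simp_all add: \<delta>_def \<beta>_def)
  show "\<forall>\<^sub>F i in F. card (arc_set.split_nonadjacent (V i) (D i)) \<le> \<kappa> * card (V i) ^ 3"
    using smallD[OF small_unbalanced pos(2)] eventually_low[OF pos(1)]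
  proof eventually_elim
    case (elim i)
    interpret arc_set "V i" "D i"
      by (rule arcs)
    define n where "n = real (card (V i))"
    have n: "0 < n"
      using cardV[of i] by (simp add: n_def)
    let ?L = "{v \<in> V i. double_degree v < \<delta> * n}"
    have "card split_nonadjacent \<le> 12 / (\<delta> * n) * card unbalanced * n + card (nonadjacent (D i) \<inter> ?L \<times> ?L) * n"
      using card_split_nonadjacent[of "\<delta> * n"] pos n by (simp add: n_def)
    also have "\<dots> = 12 / \<delta> * card unbalanced + card (nonadjacent (D i) \<inter> ?L \<times> ?L) * n"
      using n pos by simp
    also have "\<dots> \<le> 12 / \<delta> * (\<beta> * n ^ 3) + (6 * \<delta> * n\<^sup>2) * n"
      using elim pos n by (intro add_mono mult_left_mono mult_right_mono) (auto simp: n_def)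
    also have "\<dots> = \<kappa> * n ^ 3"
      using pos by (simp add: \<beta>_def \<delta>_def power2_eq_square power3_eq_cube field_simps)
    finally show ?case
      by (simp add: n_def)
  qed
qed

text \<open>Triangles with a vertex of large double degree are bounded by triangles with an attached
  double edge. The others lie in the part \<open>L\<close> of low double degree, which is nearly a
  tournament by \<open>eventually_low\<close>, so there few closed walks of length \<open>k\<close>
  imply few triangles.\<close>

lemma small_triangles: "small 3 (\<lambda>i. card (arc_set.triangles (D i)))"
proof (rule smallI)
  fix \<kappa> :: real assume \<kappa>: "0 < \<kappa>"
  then have "0 < \<kappa> / 2"
    by simp
  from near_tournament_few_walks[OF k _ this, where 'a = 'a] obtain \<zeta> where \<zeta>: "0 < \<zeta>" and
    near: "\<forall>(V :: 'a set) D (N::real). arc_set V D \<longrightarrow> 0 < N \<longrightarrow> card V \<le> N \<longrightarrow>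
    card (nonadjacent D \<inter> V \<times> V) + card (both_ways D \<inter> V \<times> V) \<le> \<zeta> * N\<^sup>2 \<longrightarrow>
    card (walks V D k) \<le> \<zeta> * N ^ k \<longrightarrow> card (walks V D 3) \<le> \<kappa> / 2 * N ^ 3"
    by auto
  \<comment> \<open>Seven parts: 6\<delta> for nonadjacent and \<delta> for doubly joined pairs of
    \<open>L\<close>.\<close>
  define \<delta> where "\<delta> = \<zeta> / 7"
  define \<beta> where "\<beta> = \<kappa> * \<delta> / 6"
  have pos: "0 < \<delta>" "0 < \<beta>"
    using \<kappa> \<zeta> by (simp_all add: \<delta>_def \<beta>_def)
  show "\<forall>\<^sub>F i in F. card (arc_set.triangles (D i)) \<le> \<kappa> * card (V i) ^ 3"
    using smallD[OF small_triangles_both_ways pos(2)] eventually_low[OF pos(1)] few[OF \<zeta>]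
  proof eventually_elim
    case (elim i)
    interpret arc_set "V i" "D i"
      by (rule arcs)
    define n where "n = real (card (V i))"
    have n: "0 < n"
      using cardV[of i] by (simp add: n_def)
    define L where "L = {v \<in> V i. double_degree v < \<delta> * n}"
    define D' where "D' = D i \<inter> L \<times> L"
    have L: "L \<subseteq> V i" "finite L"
      using finV by (auto simp: L_def)
    have arc': "arc_set L D'"
      using L irr by unfold_locales (auto simp: D'_def irrefl_def)
    have "card (both_ways D' \<inter> L \<times> L) \<le> card (SIGMA v:L. {u \<in> V i. (v, u) \<in> both_ways (D i)})"
      using L finV by (intro card_mono) (auto simp: D'_def both_ways_def)
    also have "\<dots> = (\<Sum>v\<in>L. double_degree v)"
      using L finV by (simp add: double_degree_def card_SigmaI)
    finally have "real (card (both_ways D' \<inter> L \<times> L)) \<le> real (\<Sum>v\<in>L. double_degree v)"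
      by (rule of_nat_mono)
    also have "\<dots> \<le> (\<Sum>v\<in>L. \<delta> * n)"
      unfolding of_nat_sum by (intro sum_mono) (auto simp: L_def)
    also have "\<dots> = card L * (\<delta> * n)"
      by simp
    also have "\<dots> \<le> n * (\<delta> * n)"
      using L finV pos n by (intro mult_right_mono) (auto simp: n_def card_mono)
    finally have b: "card (both_ways D' \<inter> L \<times> L) \<le> \<delta> * n\<^sup>2"
      by (simp add: power2_eq_square mult_ac)
    have "nonadjacent D' \<inter> L \<times> L = nonadjacent (D i) \<inter> L \<times> L"
      by (auto simp: D'_def nonadjacent_def)
    then have "card (nonadjacent D' \<inter> L \<times> L) \<le> 6 * \<delta> * n\<^sup>2"
      using elim(2) by (simp add: L_def n_def)
    with b have ns: "card (nonadjacent D' \<inter> L \<times> L) + card (both_ways D' \<inter> L \<times> L) \<le> \<zeta> * n\<^sup>2"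
      by (simp add: \<delta>_def)
    have "walks L D' k \<subseteq> walks (V i) (D i) k"
      using L by (auto simp: walks_def tuples_def D'_def walk_of_def)
    then have "card (walks L D' k) \<le> card (walks (V i) (D i) k)"
      by (intro card_mono finite_walks finV)
    then have wk: "card (walks L D' k) \<le> \<zeta> * n ^ k"
      using elim(3) by (simp add: n_def)
    have "card L \<le> n"
      using L finV by (simp add: n_def card_mono)
    then have "card (walks L D' 3) \<le> \<kappa> / 2 * n ^ 3"
      by (rule near[rule_format, OF arc' n _ ns wk])
    moreover have "3 / (\<delta> * n) * card {(a, b, c, d). (a, b, c) \<in> triangles \<and> (a, d) \<in> both_ways (D i)} \<le>
        3 / (\<delta> * n) * (\<beta> * n ^ 4)"
      using elim(1) pos n by (intro mult_left_mono) (auto simp: n_def)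
    moreover have "3 / (\<delta> * n) * (\<beta> * n ^ 4) = \<kappa> / 2 * n ^ 3"
      using pos n by (simp add: \<beta>_def field_simps power3_eq_cube power4_eq_xxxx)
    moreover have "card triangles \<le> 3 / (\<delta> * n) *
        card {(a, b, c, d). (a, b, c) \<in> triangles \<and> (a, d) \<in> both_ways (D i)} + card (walks L D' 3)"
      using card_triangles[of "\<delta> * n"] pos n by (simp add: L_def D'_def)
    ultimately show ?case
      by (simp add: n_def)
  qed
qed

lemma small_inconsistent: "small 3 (\<lambda>i. card (arc_set.inconsistent (V i) (D i)))"
proof (rule small_mono)
  show "small 3 (\<lambda>i. 6 * card (arc_set.unbalanced (V i) (D i)) +
      3 * card (arc_set.split_nonadjacent (V i) (D i)) + 2 * card (arc_set.triangles (D i)))"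
    by (intro small_add small_cmult small_unbalanced small_split_nonadjacent small_triangles)
qed (rule arc_set.card_inconsistent[OF arcs])

text \<open>The share \<xi> fixes the number \<open>m\<close> of pivots, and only then the density
  of inconsistent triples is made small compared with 1/m; each of the three losses of
  \<open>exists_blow_up\<close> is at most \<rho>/3.\<close>

lemma eventually_blow_up:
  fixes \<rho> :: real
  assumes \<rho>: "0 < \<rho>"
  shows "\<forall>\<^sub>F i in F. \<exists>f c. card (D i - blow_up_arcs f c) \<le> \<rho> * (card (V i))\<^sup>2"
proof -
  define \<xi> where "\<xi> = min (1 / 2) (\<rho> / 9)"
  have \<xi>: "0 < \<xi>" "\<xi> < 1" "3 * \<xi> \<le> \<rho> / 3"
    using \<rho> by (auto simp: \<xi>_def)
  obtain m where m: "(1 - \<xi>) ^ m < \<rho> / 3"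
    using real_arch_pow_inv[of "\<rho> / 3" "1 - \<xi>"] \<rho> \<xi> by auto
  define \<beta> where "\<beta> = \<rho> / (3 * (Suc m))"
  have \<beta>: "0 < \<beta>" "m * \<beta> \<le> \<rho> / 3"
    using \<rho> by (simp_all add: \<beta>_def field_simps)
  from smallD[OF small_inconsistent \<beta>(1)] show ?thesis
  proof eventually_elim
    case (elim i)
    interpret arc_set "V i" "D i"
      by (rule arcs)
    define n where "n = real (card (V i))"
    have n: "0 < n"
      using cardV[of i] by (simp add: n_def)
    obtain f c where fc: "card (D i - blow_up_arcs f c) \<le>
        (1 - \<xi>) ^ m * (card (V i))\<^sup>2 + m * (card inconsistent / card (V i)) + 3 * \<xi> * (card (V i))\<^sup>2"
      using exists_blow_up[of \<xi> m] ne \<xi> by auto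
    have "card inconsistent / n \<le> \<beta> * n\<^sup>2"
      using elim n by (simp add: n_def divide_le_eq power2_eq_square power3_eq_cube mult_ac)
    then have "m * (card inconsistent / n) \<le> m * (\<beta> * n\<^sup>2)"
      by (intro mult_left_mono) auto
    also have "\<dots> = (m * \<beta>) * n\<^sup>2"
      by simp
    also have "\<dots> \<le> \<rho> / 3 * n\<^sup>2"
      by (intro mult_right_mono \<beta>) simp
    finally have "m * (card inconsistent / n) \<le> \<rho> / 3 * n\<^sup>2" .
    moreover have "(1 - \<xi>) ^ m * n\<^sup>2 \<le> \<rho> / 3 * n\<^sup>2"
      by (rule mult_right_mono[OF less_imp_le[OF m] zero_le_power2])
    moreover have "3 * \<xi> * n\<^sup>2 \<le> \<rho> / 3 * n\<^sup>2"
      by (rule mult_right_mono[OF \<xi>(3) zero_le_power2])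
    moreover have "card (D i - blow_up_arcs f c) \<le> (1 - \<xi>) ^ m * n\<^sup>2 + m * (card inconsistent / n) + 3 * \<xi> * n\<^sup>2"
      using fc by (simp add: n_def)
    ultimately have "card (D i - blow_up_arcs f c) \<le> \<rho> / 3 * n\<^sup>2 + \<rho> / 3 * n\<^sup>2 + \<rho> / 3 * n\<^sup>2"
      by linarith
    also have "\<dots> = \<rho> * n\<^sup>2"
      by simp
    finally have "card (D i - blow_up_arcs f c) \<le> \<rho> * (card (V i))\<^sup>2"
      by (simp add: n_def)
    then show ?case
      by blast
  qed
qed

end

section \<open>From sequences back to uniform constants\<close>

lemma eventually_inverse_Suc_le:
  assumes "0 < (\<epsilon>::real)"
  shows "\<forall>\<^sub>F j in sequentially. inverse (Suc j) \<le> \<epsilon>"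
proof -
  obtain N where N: "inverse (real (Suc N)) < \<epsilon>"
    using reals_Archimedean[OF assms] by blast
  have "inverse (Suc j) \<le> \<epsilon>" if "N \<le> j" for j
  proof -
    have "inverse (real (Suc j)) \<le> inverse (real (Suc N))"
      using that by (intro le_imp_inverse_le) auto
    with N show ?thesis
      by linarith
  qed
  then show ?thesis
    unfolding eventually_sequentially by blast
qed

lemma few_walks_familyI:
  fixes V :: "nat \<Rightarrow> 'a set" and D :: "nat \<Rightarrow> ('a \<times> 'a) set"
  assumes "3 \<le> k" "\<And>j. arc_set (V j) (D j)" "\<And>j. V j \<noteq> {}"
    and few: "\<And>j. card (walks (V j) (D j) k) \<le> inverse (real (Suc j)) * card (V j) ^ k"
  shows "few_walks_family sequentially V D k"
proof (rule few_walks_family.intro)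
  fix \<epsilon> :: real assume "0 < \<epsilon>"
  from eventually_inverse_Suc_le[OF this]
  show "\<forall>\<^sub>F j in sequentially. card (walks (V j) (D j) k) \<le> \<epsilon> * card (V j) ^ k"
  proof eventually_elim
    case (elim j)
    then have "inverse (real (Suc j)) * card (V j) ^ k \<le> \<epsilon> * card (V j) ^ k"
      by (intro mult_right_mono) auto
    with few[of j] show ?case
      by linarith
  qed
qed (use assms in auto)

text \<open>If no \<epsilon> works, counterexamples for \<epsilon> = 1/(j + 1) form a family along
  \<open>sequentially\<close>, for which \<open>P\<close> holds eventually.\<close>

lemma few_walks_principle:
  fixes P :: "'a set \<Rightarrow> ('a \<times> 'a) set \<Rightarrow> bool"
  assumes "3 \<le> k"
    and P: "\<And>V D. few_walks_family sequentially V D k \<Longrightarrow> \<forall>\<^sub>F j in sequentially. P (V j) (D j)"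
  shows "\<exists>\<epsilon>::real. 0 < \<epsilon> \<and> (\<forall>V D. arc_set V D \<longrightarrow> V \<noteq> {} \<longrightarrow> card (walks V D k) \<le> \<epsilon> * card V ^ k \<longrightarrow> P V D)"
proof (rule ccontr)
  assume no: "\<not> ?thesis"
  have "\<exists>p. arc_set (fst p) (snd p) \<and> fst p \<noteq> {} \<and>
      card (walks (fst p) (snd p) k) \<le> inverse (real (Suc j)) * card (fst p) ^ k \<and> \<not> P (fst p) (snd p)" for j
  proof -
    have "0 < inverse (real (Suc j))"
      by simp
    with no show ?thesis
      by (metis fst_conv snd_conv)
  qed
  then obtain p where p: "\<And>j. arc_set (fst (p j)) (snd (p j)) \<and> fst (p j) \<noteq> {} \<and>
      card (walks (fst (p j)) (snd (p j)) k) \<le> inverse (real (Suc j)) * card (fst (p j)) ^ k \<and>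
      \<not> P (fst (p j)) (snd (p j))"
    by metis
  have "few_walks_family sequentially (\<lambda>j. fst (p j)) (\<lambda>j. snd (p j)) k"
    using p assms(1) by (intro few_walks_familyI) blast+
  from P[OF this] show False
    using p by (simp add: eventually_False)
qed

lemma few_walks_card_le:
  fixes \<kappa> :: real
  assumes "3 \<le> k" "0 < \<kappa>"
  shows "\<exists>\<epsilon>::real. 0 < \<epsilon> \<and> (\<forall>(V :: 'a set) D. arc_set V D \<longrightarrow> V \<noteq> {} \<longrightarrow>
    card (walks V D k) \<le> \<epsilon> * card V ^ k \<longrightarrow> card D \<le> (1 / 2 + \<kappa>) * (card V)\<^sup>2)"
proof (rule few_walks_principle[OF assms(1)])
  fix V :: "nat \<Rightarrow> 'a set" and D
  assume "few_walks_family sequentially V D k"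
  then interpret few_walks_family sequentially V D k .
  from eventually_upper_bound[OF assms(2)]
  show "\<forall>\<^sub>F j in sequentially. card (D j) \<le> (1 / 2 + \<kappa>) * (card (V j))\<^sup>2"
  proof eventually_elim
    case (elim j)
    have "D j \<inter> V j \<times> V j = D j"
      using arcs[of j] by (auto simp: arc_set_def)
    then show ?case
      using elim[rule_format, of "V j"] by (simp add: algebra_simps)
  qed
qed

lemma few_walks_both_ways:
  fixes \<kappa> :: real
  assumes "3 \<le> k" "even k" "0 < \<kappa>"
  shows "\<exists>\<epsilon>::real. 0 < \<epsilon> \<and> (\<forall>(V :: 'a set) D. arc_set V D \<longrightarrow> V \<noteq> {} \<longrightarrow>
    card (walks V D k) \<le> \<epsilon> * card V ^ k \<longrightarrow> card (both_ways D) \<le> \<kappa> * (card V)\<^sup>2)"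
proof (rule few_walks_principle[OF assms(1)])
  fix V :: "nat \<Rightarrow> 'a set" and D
  assume "few_walks_family sequentially V D k"
  then interpret few_walks_family sequentially V D k .
  show "\<forall>\<^sub>F j in sequentially. card (both_ways (D j)) \<le> \<kappa> * (card (V j))\<^sup>2"
    using smallD[OF small_both_ways[OF assms(2)] assms(3)] by simp
qed

text \<open>One parameter governs the order, the number of walks and the density, so that a sequence
  of counterexamples with parameter tending to 0 is an \<open>extremal_family\<close>.\<close>

definition near_extremal :: "nat \<Rightarrow> real \<Rightarrow> 'a set \<Rightarrow> ('a \<times> 'a) set \<Rightarrow> bool" where
  "near_extremal k \<epsilon> V D \<longleftrightarrow> arc_set V D \<and> V \<noteq> {} \<and> 1 / \<epsilon> \<le> card V \<and>
    real (card (walks V D k)) \<le> \<epsilon> * real (card V ^ k) \<and> (1 / 2 - \<epsilon>) * (card V)\<^sup>2 \<le> card D"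

lemma near_extremal_mono:
  assumes "near_extremal k \<epsilon> V D" "0 < \<epsilon>" "\<epsilon> \<le> \<epsilon>'"
  shows "near_extremal k \<epsilon>' V D"
proof -
  have "1 / \<epsilon>' \<le> 1 / \<epsilon>"
    using assms by (simp add: frac_le)
  moreover have "\<epsilon> * card V ^ k \<le> \<epsilon>' * card V ^ k"
    using assms by (intro mult_right_mono) auto
  moreover have "(1 / 2 - \<epsilon>') * (card V)\<^sup>2 \<le> (1 / 2 - \<epsilon>) * (card V)\<^sup>2"
    using assms by (intro mult_right_mono) auto
  ultimately show ?thesis
    using assms(1) unfolding near_extremal_def by linarith
qed

lemma near_extremal_blow_up:
  fixes \<rho> :: real
  assumes "3 \<le> k" "0 < \<rho>"
  shows "\<exists>\<epsilon>::real. 0 < \<epsilon> \<and> (\<forall>(V :: 'a set) D. near_extremal k \<epsilon> V D \<longrightarrow>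
    (\<exists>f c. card (D - blow_up_arcs f c) \<le> \<rho> * (card V)\<^sup>2))"
proof (rule ccontr)
  let ?Q = "\<lambda>(V :: 'a set) D. \<exists>f c. card (D - blow_up_arcs f c) \<le> \<rho> * (card V)\<^sup>2"
  assume no: "\<not> ?thesis"
  have "\<exists>p :: 'a set \<times> ('a \<times> 'a) set. near_extremal k (inverse (real (Suc j))) (fst p) (snd p) \<and> \<not> ?Q (fst p) (snd p)" for j
  proof -
    have "0 < inverse (real (Suc j))"
      by simp
    with no obtain V :: "'a set" and D where "near_extremal k (inverse (real (Suc j))) V D" "\<not> ?Q V D"
      by blast
    then show ?thesis
      by (intro exI[of _ "(V, D)"]) simp
  qed
  then have "\<exists>p :: nat \<Rightarrow> 'a set \<times> ('a \<times> 'a) set.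
      \<forall>j. near_extremal k (inverse (real (Suc j))) (fst (p j)) (snd (p j)) \<and> \<not> ?Q (fst (p j)) (snd (p j))"
    by (intro choice allI)
  then obtain p :: "nat \<Rightarrow> 'a set \<times> ('a \<times> 'a) set" where
    ext: "\<And>j. near_extremal k (inverse (real (Suc j))) (fst (p j)) (snd (p j))" and
    nQ: "\<And>j. \<not> ?Q (fst (p j)) (snd (p j))"
    by auto
  define V where "V j = fst (p j)" for j
  define D where "D j = snd (p j)" for j
  have ext': "arc_set (V j) (D j)" "V j \<noteq> {}" "real (Suc j) \<le> card (V j)"
    "card (walks (V j) (D j) k) \<le> inverse (real (Suc j)) * card (V j) ^ k"
    "(1 / 2 - inverse (real (Suc j))) * (card (V j))\<^sup>2 \<le> card (D j)" for j
  proof -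
    have inv: "1 / inverse (real (Suc j)) = real (Suc j)"
      by (simp add: inverse_eq_divide)
    show "arc_set (V j) (D j)" "V j \<noteq> {}" "real (Suc j) \<le> card (V j)"
      "card (walks (V j) (D j) k) \<le> inverse (real (Suc j)) * card (V j) ^ k"
      "(1 / 2 - inverse (real (Suc j))) * (card (V j))\<^sup>2 \<le> card (D j)"
      using ext[of j] unfolding near_extremal_def inv V_def D_def by blast+
  qed
  interpret extremal_family sequentially V D k
  proof (intro extremal_family.intro few_walks_familyI extremal_family_axioms.intro)
    show "\<forall>\<^sub>F j in sequentially. (1 / 2 - \<epsilon>) * (card (V j))\<^sup>2 \<le> card (D j)" if "0 < \<epsilon>" for \<epsilon> :: real
      using eventually_inverse_Suc_le[OF that]
    proof eventually_elim
      case (elim j)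
      then have "(1 / 2 - \<epsilon>) * (card (V j))\<^sup>2 \<le> (1 / 2 - inverse (real (Suc j))) * (card (V j))\<^sup>2"
        by (intro mult_right_mono) auto
      with ext'(5)[of j] show ?case
        by linarith
    qed
    show "\<forall>\<^sub>F j in sequentially. m \<le> card (V j)" for m
      unfolding eventually_sequentially
    proof (intro exI[of _ m] allI impI)
      fix j assume "m \<le> j"
      then show "m \<le> card (V j)"
        using ext'(3)[of j] by linarith
    qed
  qed (use assms ext' in auto)
  from eventually_blow_up[OF assms(2)] have "\<forall>\<^sub>F j in sequentially. ?Q (V j) (D j)" .
  then show False
    using nQ by (simp add: V_def D_def eventually_False)
qed

section \<open>Arc counts of blow ups, and balancing their classes\<close>

definition key_class :: "'a set \<Rightarrow> ('a \<Rightarrow> nat) \<Rightarrow> nat \<Rightarrow> 'a set" where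
  "key_class V f i = {v \<in> V. f v = i}"

definition colour_class :: "'a set \<Rightarrow> ('a \<Rightarrow> nat) \<Rightarrow> ('a \<Rightarrow> bool) \<Rightarrow> nat \<Rightarrow> bool \<Rightarrow> 'a set" where
  "colour_class V f c i b = {v \<in> V. f v = i \<and> c v = b}"

lemma card_same_key:
  assumes "finite V"
  shows "card {(u, v). u \<in> V \<and> v \<in> V \<and> f u = f v \<and> P u v} =
    (\<Sum>i\<in>f ` V. card {(u, v). u \<in> key_class V f i \<and> v \<in> key_class V f i \<and> P u v})"
proof -
  have "{(u, v). u \<in> V \<and> v \<in> V \<and> f u = f v \<and> P u v} =
      (\<Union>i\<in>f ` V. {(u, v). u \<in> key_class V f i \<and> v \<in> key_class V f i \<and> P u v})" (is "?L = ?R")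
  proof (intro equalityI subsetI)
    fix p assume p: "p \<in> ?L"
    obtain u v where uv: "p = (u, v)"
      by (cases p)
    have "f u \<in> f ` V" "p \<in> {(x, y). x \<in> key_class V f (f u) \<and> y \<in> key_class V f (f u) \<and> P x y}"
      using p by (simp_all add: uv key_class_def)
    then show "p \<in> ?R"
      by (rule UN_I)
  next
    fix p assume "p \<in> ?R"
    then obtain i where i: "p \<in> {(x, y). x \<in> key_class V f i \<and> y \<in> key_class V f i \<and> P x y}"
      by (rule UN_E)
    obtain u v where uv: "p = (u, v)"
      by (cases p)
    have k: "u \<in> key_class V f i" "v \<in> key_class V f i" "P u v"
      using i by (simp_all only: uv mem_Collect_eq prod.case)
    then have "u \<in> V" "v \<in> V" "f u = i" "f v = i"
      unfolding key_class_def by blast+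
    then show "p \<in> ?L"
      using k(3) by (simp only: uv mem_Collect_eq prod.case)
  qed
  also have "card \<dots> = (\<Sum>i\<in>f ` V. card {(u, v). u \<in> key_class V f i \<and> v \<in> key_class V f i \<and> P u v})"
  proof (rule card_UN_disjoint)
    have "{(u, v). u \<in> key_class V f i \<and> v \<in> key_class V f i \<and> P u v} \<subseteq> V \<times> V" for i
      unfolding key_class_def by blast
    then show "\<forall>i\<in>f ` V. finite {(u, v). u \<in> key_class V f i \<and> v \<in> key_class V f i \<and> P u v}"
      using assms finite_subset[of _ "V \<times> V"] by blast
    have "key_class V f i \<inter> key_class V f j = {}" if "i \<noteq> j" for i j
      using that by (auto simp: key_class_def)
    then show "\<forall>i\<in>f ` V. \<forall>j\<in>f ` V. i \<noteq> j \<longrightarrow>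
        {(u, v). u \<in> key_class V f i \<and> v \<in> key_class V f i \<and> P u v} \<inter>
        {(u, v). u \<in> key_class V f j \<and> v \<in> key_class V f j \<and> P u v} = {}"
      by blast
  qed (use assms in simp)
  finally show ?thesis .
qed

lemma sum_card_key_class_square:
  assumes "finite V"
  shows "(\<Sum>i\<in>f ` V. (card (key_class V f i))\<^sup>2) \<le> (card V)\<^sup>2"
proof -
  have "{(u, v). u \<in> A \<and> v \<in> A \<and> True} = A \<times> A" for A :: "'a set"
    by auto
  then have "(\<Sum>i\<in>f ` V. (card (key_class V f i))\<^sup>2) = card {(u, v). u \<in> V \<and> v \<in> V \<and> f u = f v \<and> True}"
    unfolding card_same_key[OF assms] by (simp add: card_cartesian_product power2_eq_square)
  also have "\<dots> \<le> card (V \<times> V)"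
    using assms by (intro card_mono) auto
  finally show ?thesis
    by (simp add: card_cartesian_product power2_eq_square)
qed

text \<open>In a class with colour sizes a and b, nonadjacent pairs exceed doubly joined ones by a^2
  + b^2 - 2ab. So a blow up has at most half of all pairs as arcs, and the shortfall measures the
  imbalance of its classes.\<close>

lemma card_blow_up_arcs:
  assumes "finite V"
  shows "2 * real (card (blow_up_arcs f c \<inter> V \<times> V)) = (real (card V))\<^sup>2 -
    (\<Sum>i\<in>f ` V. (real (card (colour_class V f c i True)) - card (colour_class V f c i False))\<^sup>2)"
proof -
  let ?B = "blow_up_arcs f c"
  let ?a = "\<lambda>i. card (colour_class V f c i True)" and ?b = "\<lambda>i. card (colour_class V f c i False)"
  have fin: "finite (colour_class V f c i b)" for i b
    using assms by (simp add: colour_class_def)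
  have disj: "colour_class V f c i True \<inter> colour_class V f c i False = {}" for i
    by (auto simp: colour_class_def)
  have "both_ways ?B \<inter> V \<times> V = {(u, v). u \<in> V \<and> v \<in> V \<and> f u = f v \<and> c u \<noteq> c v}"
    by (auto simp: both_ways_def blow_up_arcs_def)
  moreover have "card {(u, v). u \<in> key_class V f i \<and> v \<in> key_class V f i \<and> c u \<noteq> c v} = 2 * (?a i * ?b i)" for i
  proof -
    have "{(u, v). u \<in> key_class V f i \<and> v \<in> key_class V f i \<and> c u \<noteq> c v} =
        colour_class V f c i True \<times> colour_class V f c i False \<union>
        colour_class V f c i False \<times> colour_class V f c i True"
      by (auto simp: key_class_def colour_class_def)
    also have "card \<dots> = ?a i * ?b i + ?b i * ?a i"
      using fin disj[of i] by (subst card_Un_disjoint) (auto simp: card_cartesian_product)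
    finally show ?thesis
      by simp
  qed
  ultimately have both: "card (both_ways ?B \<inter> V \<times> V) = (\<Sum>i\<in>f ` V. 2 * (?a i * ?b i))"
    by (simp add: card_same_key[OF assms])
  have "nonadjacent ?B \<inter> V \<times> V = {(u, v). u \<in> V \<and> v \<in> V \<and> f u = f v \<and> c u = c v}"
    by (auto simp: nonadjacent_def blow_up_arcs_def)
  moreover have "card {(u, v). u \<in> key_class V f i \<and> v \<in> key_class V f i \<and> c u = c v} = (?a i)\<^sup>2 + (?b i)\<^sup>2" for i
  proof -
    have "{(u, v). u \<in> key_class V f i \<and> v \<in> key_class V f i \<and> c u = c v} =
        colour_class V f c i True \<times> colour_class V f c i True \<union>
        colour_class V f c i False \<times> colour_class V f c i False"
      by (auto simp: key_class_def colour_class_def)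
    also have "card \<dots> = ?a i * ?a i + ?b i * ?b i"
      using fin disj[of i] by (subst card_Un_disjoint) (auto simp: card_cartesian_product)
    finally show ?thesis
      by (simp add: power2_eq_square)
  qed
  ultimately have non: "card (nonadjacent ?B \<inter> V \<times> V) = (\<Sum>i\<in>f ` V. (?a i)\<^sup>2 + (?b i)\<^sup>2)"
    by (simp add: card_same_key[OF assms])
  have "2 * real (card (?B \<inter> V \<times> V)) + card (nonadjacent ?B \<inter> V \<times> V) =
      (real (card V))\<^sup>2 + card (both_ways ?B \<inter> V \<times> V)"
    using card_square_eq[OF assms, of ?B, THEN arg_cong[of _ _ real]] by simp
  moreover have "real (card (nonadjacent ?B \<inter> V \<times> V)) - card (both_ways ?B \<inter> V \<times> V) =
      (\<Sum>i\<in>f ` V. (real (?a i) - ?b i)\<^sup>2)"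
    unfolding both non of_nat_sum sum_subtractf[symmetric]
    by (intro sum.cong) (simp_all add: power2_diff)
  ultimately show ?thesis
    by linarith
qed

text \<open>The blow up has at most n^2/2 arcs while \<open>D\<close>, up to few arcs, lies in it
  and has nearly as many. The small slack bounds the missing arcs and the imbalance alike.\<close>

lemma blow_up_arcs_close:
  fixes \<rho> \<gamma> :: real
  assumes arc: "arc_set V D" and D: "card (D - blow_up_arcs f c) \<le> \<rho> * (card V)\<^sup>2"
    and dense: "(1 / 2 - \<gamma>) * (card V)\<^sup>2 \<le> card D"
  shows "card (blow_up_arcs f c \<inter> V \<times> V - D) \<le> (\<gamma> + \<rho>) * (card V)\<^sup>2"
    and "(\<Sum>i\<in>f ` V. (real (card (colour_class V f c i True)) - card (colour_class V f c i False))\<^sup>2)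
      \<le> 2 * (\<gamma> + \<rho>) * (card V)\<^sup>2"
proof -
  interpret arc_set V D
    by (rule arc)
  let ?B = "blow_up_arcs f c \<inter> V \<times> V"
  let ?S = "\<Sum>i\<in>f ` V. (real (card (colour_class V f c i True)) - card (colour_class V f c i False))\<^sup>2"
  have finB: "finite ?B"
    using fin by auto
  have "card ?B = card (?B - D) + card (?B \<inter> D)"
    using card_Int_Diff[OF finB, of D] by simp
  moreover have "card D = card (D - ?B) + card (?B \<inter> D)"
    using card_Int_Diff[OF finD, of ?B] by (simp only: Int_commute add.commute)
  moreover have "D - ?B = D - blow_up_arcs f c"
    using sub by auto
  ultimately have eq: "real (card ?B) - card (?B - D) = real (card D) - card (D - blow_up_arcs f c)"
    by simp
  have B: "2 * real (card ?B) = (real (card V))\<^sup>2 - ?S"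
    by (rule card_blow_up_arcs[OF fin])
  have "0 \<le> ?S"
    by (intro sum_nonneg) auto
  then show "card (?B - D) \<le> (\<gamma> + \<rho>) * (card V)\<^sup>2"
    using B eq D dense by (simp add: algebra_simps)
  show "?S \<le> 2 * (\<gamma> + \<rho>) * (card V)\<^sup>2"
    using B eq D dense by (simp add: algebra_simps)
qed

text \<open>The keys alone provide the order. An arc that does not increase the key lies outside the
  blow up, belongs to a double edge, or joins two colours of one class; in the last case its reverse
  is an arc of the blow up that is missing from \<open>D\<close>, and few are missing.\<close>

lemma near_extremal_order:
  fixes \<beta> :: real
  assumes "3 \<le> k" "0 < \<beta>"
  shows "\<exists>\<epsilon>::real. 0 < \<epsilon> \<and> (\<forall>(V :: 'a set) D. near_extremal k \<epsilon> V D \<longrightarrow> card (both_ways D) \<le> \<epsilon> * (card V)\<^sup>2 \<longrightarrow>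
    (\<exists>f :: 'a \<Rightarrow> nat. card {(u, v) \<in> D. f v \<le> f u} \<le> \<beta> * (card V)\<^sup>2))"
proof -
  define \<rho> where "\<rho> = \<beta> / 4"
  have \<rho>: "0 < \<rho>"
    using assms by (simp add: \<rho>_def)
  obtain \<epsilon>1 :: real where \<epsilon>1: "0 < \<epsilon>1" and
    blow: "\<And>(V :: 'a set) D. near_extremal k \<epsilon>1 V D \<Longrightarrow> \<exists>f c. card (D - blow_up_arcs f c) \<le> \<rho> * (card V)\<^sup>2"
    using near_extremal_blow_up[OF assms(1) \<rho>, where 'a = 'a] by blast
  define \<epsilon> where "\<epsilon> = min \<epsilon>1 \<rho>"
  have \<epsilon>: "0 < \<epsilon>" "\<epsilon> \<le> \<epsilon>1" "\<epsilon> \<le> \<rho>"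
    using \<epsilon>1 \<rho> by (auto simp: \<epsilon>_def)
  show ?thesis
  proof (intro exI[of _ \<epsilon>] conjI allI impI \<epsilon>(1))
    fix V :: "'a set" and D
    assume ext: "near_extremal k \<epsilon> V D" and both: "card (both_ways D) \<le> \<epsilon> * (card V)\<^sup>2"
    have arc: "arc_set V D" and dense: "(1 / 2 - \<epsilon>) * (card V)\<^sup>2 \<le> card D"
      using ext by (auto simp: near_extremal_def)
    interpret arc_set V D
      by (rule arc)
    obtain f c where fc: "card (D - blow_up_arcs f c) \<le> \<rho> * (card V)\<^sup>2"
      using blow[OF near_extremal_mono[OF ext \<epsilon>(1,2)]] by blast
    let ?M = "blow_up_arcs f c \<inter> V \<times> V - D"
    have M: "card ?M \<le> (\<epsilon> + \<rho>) * (card V)\<^sup>2"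
      by (rule blow_up_arcs_close(1)[OF arc fc dense])
    have finM: "finite ?M"
      using fin by auto
    have "{(u, v) \<in> D. f v \<le> f u} \<subseteq> (D - blow_up_arcs f c) \<union> both_ways D \<union> prod.swap ` ?M"
    proof
      fix p assume p: "p \<in> {(u, v) \<in> D. f v \<le> f u}"
      then obtain u v where uv: "p = (u, v)" "(u, v) \<in> D" "f v \<le> f u"
        by auto
      have V: "u \<in> V" "v \<in> V"
        using uv sub by auto
      have "p \<in> prod.swap ` ?M" if "(u, v) \<in> blow_up_arcs f c" "(v, u) \<notin> D"
        using that uv V by (intro image_eqI[of _ _ "(v, u)"]) (auto simp: blow_up_arcs_def)
      then show "p \<in> (D - blow_up_arcs f c) \<union> both_ways D \<union> prod.swap ` ?M"
        using uv by (auto simp: both_ways_def)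
    qed
    then have "card {(u, v) \<in> D. f v \<le> f u} \<le> card ((D - blow_up_arcs f c) \<union> both_ways D \<union> prod.swap ` ?M)"
      using finM by (intro card_mono) auto
    also have "\<dots> \<le> card (D - blow_up_arcs f c) + card (both_ways D) + card ?M"
      using finM by (intro order_trans[OF card_Un_le] add_mono card_image_le order_refl)
    finally have "real (card {(u, v) \<in> D. f v \<le> f u}) \<le> real (card (D - blow_up_arcs f c) + card (both_ways D) + card ?M)"
      by (rule of_nat_mono)
    also have "\<dots> \<le> (\<rho> + \<epsilon> + (\<epsilon> + \<rho>)) * (card V)\<^sup>2"
      using fc both M by (simp add: algebra_simps)
    also have "\<dots> \<le> \<beta> * (card V)\<^sup>2"
      using \<epsilon> by (intro mult_right_mono) (auto simp: \<rho>_def)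
    finally show "\<exists>f :: 'a \<Rightarrow> nat. card {(u, v) \<in> D. f v \<le> f u} \<le> \<beta> * (card V)\<^sup>2"
      by blast
  qed
qed

definition balanced :: "'a set \<Rightarrow> ('a \<Rightarrow> nat) \<Rightarrow> ('a \<Rightarrow> bool) \<Rightarrow> bool" where
  "balanced V f c \<longleftrightarrow> (\<forall>i. card (colour_class V f c i True) \<le> card (colour_class V f c i False) + 1 \<and>
    card (colour_class V f c i False) \<le> card (colour_class V f c i True) + 1)"

text \<open>Half of the size difference, rounded down, moves from the larger set to the smaller one;
  \<open>M\<close> is the set of moved elements and \<open>A'\<close> the new version of
  \<open>A\<close>.\<close>

lemma balance_sets:
  assumes "finite A" "finite B" "A \<inter> B = {}"
  shows "\<exists>A' M. A' \<subseteq> A \<union> B \<and> M \<subseteq> A \<union> B \<and> A - M = A' - M \<and>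
    card A' \<le> card (A \<union> B - A') + 1 \<and> card (A \<union> B - A') \<le> card A' + 1 \<and>
    2 * real (card M) \<le> \<bar>real (card A) - card B\<bar>"
proof (cases "card B \<le> card A")
  case True
  define m where "m = (card A - card B) div 2"
  have m: "m \<le> card A" "2 * m \<le> card A - card B" "card A - card B \<le> 2 * m + 1"
    unfolding m_def by linarith+
  obtain M where M: "M \<subseteq> A" "card M = m"
    using obtain_subset_with_card_n[OF m(1)] by blast
  have finM: "finite M"
    using M assms finite_subset by blast
  have "A \<union> B - (A - M) = B \<union> M"
    using M assms by auto
  moreover have "card (B \<union> M) = card B + m"
    using M assms finM by (subst card_Un_disjoint) auto
  moreover have "card (A - M) = card A - m"
    using M finM by (simp add: card_Diff_subset)
  moreover have "2 * real m \<le> \<bar>real (card A) - card B\<bar>"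
    using m True by linarith
  ultimately show ?thesis
    using M True m by (intro exI[of _ "A - M"] exI[of _ M]) auto
next
  case False
  define m where "m = (card B - card A) div 2"
  have m: "m \<le> card B" "2 * m \<le> card B - card A" "card B - card A \<le> 2 * m + 1"
    unfolding m_def by linarith+
  obtain M where M: "M \<subseteq> B" "card M = m"
    using obtain_subset_with_card_n[OF m(1)] by blast
  have finM: "finite M"
    using M assms finite_subset by blast
  have "A \<union> B - (A \<union> M) = B - M"
    using M assms by auto
  moreover have "card (A \<union> M) = card A + m"
    using M assms finM by (subst card_Un_disjoint) auto
  moreover have "card (B - M) = card B - m"
    using M finM by (simp add: card_Diff_subset)
  moreover have "2 * real m \<le> \<bar>real (card A) - card B\<bar>"
    using m False by linarith
  ultimately show ?thesis
    using M False m by (intro exI[of _ "A \<union> M"] exI[of _ M]) auto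
qed

text \<open>Keys are kept, so an arc is destroyed only inside a class and only if one of its ends is
  recoloured. The number of recoloured vertices is at most half the imbalance, which cancels the
  factor 2 for the two ends.\<close>

lemma rebalance:
  assumes "finite V"
  shows "\<exists>c'. balanced V f c' \<and> card (blow_up_arcs f c \<inter> V \<times> V - blow_up_arcs f c') \<le>
    (\<Sum>i\<in>f ` V. \<bar>real (card (colour_class V f c i True)) - card (colour_class V f c i False)\<bar> * card (key_class V f i))"
proof -
  let ?A = "\<lambda>i. colour_class V f c i True" and ?B = "\<lambda>i. colour_class V f c i False"
  have AB: "finite (?A i)" "finite (?B i)" "?A i \<inter> ?B i = {}" "?A i \<union> ?B i = key_class V f i" for i
    using assms by (auto simp: colour_class_def key_class_def)
  have "\<forall>i. \<exists>q. fst q \<subseteq> key_class V f i \<and> snd q \<subseteq> key_class V f i \<and> ?A i - snd q = fst q - snd q \<and>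
    card (fst q) \<le> card (key_class V f i - fst q) + 1 \<and> card (key_class V f i - fst q) \<le> card (fst q) + 1 \<and>
    2 * real (card (snd q)) \<le> \<bar>real (card (?A i)) - card (?B i)\<bar>"
  proof
    fix i
    obtain A' M where "A' \<subseteq> key_class V f i \<and> M \<subseteq> key_class V f i \<and> ?A i - M = A' - M \<and>
      card A' \<le> card (key_class V f i - A') + 1 \<and> card (key_class V f i - A') \<le> card A' + 1 \<and>
      2 * real (card M) \<le> \<bar>real (card (?A i)) - card (?B i)\<bar>"
      using balance_sets[OF AB(1-3), of i] unfolding AB(4) by blast
    then show "\<exists>q. fst q \<subseteq> key_class V f i \<and> snd q \<subseteq> key_class V f i \<and> ?A i - snd q = fst q - snd q \<and>
      card (fst q) \<le> card (key_class V f i - fst q) + 1 \<and> card (key_class V f i - fst q) \<le> card (fst q) + 1 \<and>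
      2 * real (card (snd q)) \<le> \<bar>real (card (?A i)) - card (?B i)\<bar>"
      by (intro exI[of _ "(A', M)"]) simp
  qed
  from choice[OF this] obtain q where
    q: "\<And>i. fst (q i) \<subseteq> key_class V f i" "\<And>i. snd (q i) \<subseteq> key_class V f i"
      "\<And>i. ?A i - snd (q i) = fst (q i) - snd (q i)"
      "\<And>i. card (fst (q i)) \<le> card (key_class V f i - fst (q i)) + 1"
      "\<And>i. card (key_class V f i - fst (q i)) \<le> card (fst (q i)) + 1"
      "\<And>i. 2 * real (card (snd (q i))) \<le> \<bar>real (card (?A i)) - card (?B i)\<bar>"
    by blast
  define c' where "c' v \<longleftrightarrow> v \<in> fst (q (f v))" for v
  have cc: "colour_class V f c' i True = fst (q i)" "colour_class V f c' i False = key_class V f i - fst (q i)" for i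
    using q(1)[of i] by (auto simp: colour_class_def key_class_def c'_def)
  have bal: "balanced V f c'"
    unfolding balanced_def cc using q(4,5) by blast
  have "blow_up_arcs f c \<inter> V \<times> V - blow_up_arcs f c' \<subseteq>
      (\<Union>i\<in>f ` V. snd (q i) \<times> key_class V f i \<union> key_class V f i \<times> snd (q i))"
  proof
    fix p assume p: "p \<in> blow_up_arcs f c \<inter> V \<times> V - blow_up_arcs f c'"
    obtain u v where uv: "p = (u, v)"
      by (cases p)
    have *: "u \<in> V" "v \<in> V" "f u = f v" "c u \<noteq> c v" "c' u = c' v"
      using p by (auto simp: uv blow_up_arcs_def)
    have same: "c w \<longleftrightarrow> c' w" if "w \<in> V" "w \<notin> snd (q (f w))" for w
      using that q(3)[of "f w"] by (auto simp: c'_def colour_class_def)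
    have "u \<in> snd (q (f u)) \<or> v \<in> snd (q (f v))"
      using same * by blast
    then show "p \<in> (\<Union>i\<in>f ` V. snd (q i) \<times> key_class V f i \<union> key_class V f i \<times> snd (q i))"
      using * by (intro UN_I[of "f u"]) (auto simp: uv key_class_def)
  qed
  then have "card (blow_up_arcs f c \<inter> V \<times> V - blow_up_arcs f c') \<le>
      card (\<Union>i\<in>f ` V. snd (q i) \<times> key_class V f i \<union> key_class V f i \<times> snd (q i))"
    using assms finite_subset[OF q(2)] by (intro card_mono) (auto simp: key_class_def)
  also have "\<dots> \<le> (\<Sum>i\<in>f ` V. card (snd (q i) \<times> key_class V f i \<union> key_class V f i \<times> snd (q i)))"
    using assms by (intro card_UN_le) auto
  also have "\<dots> \<le> (\<Sum>i\<in>f ` V. 2 * card (snd (q i)) * card (key_class V f i))"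
    by (intro sum_mono order_trans[OF card_Un_le]) (simp add: card_cartesian_product)
  finally have "real (card (blow_up_arcs f c \<inter> V \<times> V - blow_up_arcs f c')) \<le>
      real (\<Sum>i\<in>f ` V. 2 * card (snd (q i)) * card (key_class V f i))"
    by (rule of_nat_mono)
  also have "\<dots> = (\<Sum>i\<in>f ` V. 2 * real (card (snd (q i))) * card (key_class V f i))"
    by simp
  also have "\<dots> \<le> (\<Sum>i\<in>f ` V. \<bar>real (card (?A i)) - card (?B i)\<bar> * card (key_class V f i))"
    by (intro sum_mono mult_right_mono q) auto
  finally show ?thesis
    using bal by blast
qed

text \<open>The imbalances are known to be small only in the sum of squares. Weighted AM-GM with
  weight \<tau> plays them off against the class sizes, whose squares sum to at most n^2, and this
  bounds the arcs lost by rebalancing.\<close>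

lemma near_extremal_balanced:
  fixes \<beta> :: real
  assumes "3 \<le> k" "0 < \<beta>"
  shows "\<exists>\<epsilon>::real. 0 < \<epsilon> \<and> (\<forall>(V :: 'a set) D. near_extremal k \<epsilon> V D \<longrightarrow>
    (\<exists>f c. balanced V f c \<and> card (D - blow_up_arcs f c) \<le> \<beta> * (card V)\<^sup>2))"
proof -
  define \<tau> where "\<tau> = \<beta> / 4"
  define \<rho> where "\<rho> = min (\<beta> / 4) (\<tau> * \<beta> / 4)"
  have pos: "0 < \<tau>" "0 < \<rho>" "\<rho> \<le> \<beta> / 4" "\<rho> \<le> \<tau> * \<beta> / 4"
    using assms by (auto simp: \<tau>_def \<rho>_def)
  obtain \<epsilon>1 :: real where \<epsilon>1: "0 < \<epsilon>1" and
    blow: "\<And>(V :: 'a set) D. near_extremal k \<epsilon>1 V D \<Longrightarrow> \<exists>f c. card (D - blow_up_arcs f c) \<le> \<rho> * (card V)\<^sup>2"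
    using near_extremal_blow_up[OF assms(1) pos(2), where 'a = 'a] by blast
  define \<epsilon> where "\<epsilon> = min \<epsilon>1 \<rho>"
  have \<epsilon>: "0 < \<epsilon>" "\<epsilon> \<le> \<epsilon>1" "\<epsilon> \<le> \<rho>"
    using \<epsilon>1 pos by (auto simp: \<epsilon>_def)
  show ?thesis
  proof (intro exI[of _ \<epsilon>] conjI allI impI \<epsilon>(1))
    fix V :: "'a set" and D
    assume ext: "near_extremal k \<epsilon> V D"
    have arc: "arc_set V D" and dense: "(1 / 2 - \<epsilon>) * (card V)\<^sup>2 \<le> card D"
      using ext by (auto simp: near_extremal_def)
    interpret arc_set V D
      by (rule arc)
    define n where "n = real (card V)"
    obtain f c where fc: "card (D - blow_up_arcs f c) \<le> \<rho> * (card V)\<^sup>2"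
      using blow[OF near_extremal_mono[OF ext \<epsilon>(1,2)]] by blast
    define d where "d i = real (card (colour_class V f c i True)) - card (colour_class V f c i False)" for i
    define s where "s i = real (card (key_class V f i))" for i
    have sumd: "(\<Sum>i\<in>f ` V. (d i)\<^sup>2) \<le> 2 * (\<epsilon> + \<rho>) * n\<^sup>2"
      using blow_up_arcs_close(2)[OF arc fc dense] by (simp add: d_def n_def)
    have sums: "(\<Sum>i\<in>f ` V. (s i)\<^sup>2) \<le> n\<^sup>2"
      using of_nat_mono[OF sum_card_key_class_square[OF fin, of f], where 'a = real] by (simp add: s_def n_def)
    have amgm: "\<bar>d i\<bar> * s i \<le> (1 / (2 * \<tau>)) * (d i)\<^sup>2 + \<tau> / 2 * (s i)\<^sup>2" for i
    proof -
      have "0 \<le> (\<bar>d i\<bar> - \<tau> * s i)\<^sup>2"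
        by simp
      then have "2 * \<tau> * (\<bar>d i\<bar> * s i) \<le> (d i)\<^sup>2 + \<tau>\<^sup>2 * (s i)\<^sup>2"
        by (simp add: power2_diff power_mult_distrib algebra_simps)
      then show ?thesis
        using pos by (simp add: field_simps power2_eq_square)
    qed
    obtain c' where c': "balanced V f c'" and
      loss: "card (blow_up_arcs f c \<inter> V \<times> V - blow_up_arcs f c') \<le> (\<Sum>i\<in>f ` V. \<bar>d i\<bar> * s i)"
      using rebalance[OF fin, of f c] by (auto simp: d_def s_def)
    note loss
    also have "(\<Sum>i\<in>f ` V. \<bar>d i\<bar> * s i) \<le> (\<Sum>i\<in>f ` V. (1 / (2 * \<tau>)) * (d i)\<^sup>2 + \<tau> / 2 * (s i)\<^sup>2)"
      by (intro sum_mono amgm)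
    also have "\<dots> = (1 / (2 * \<tau>)) * (\<Sum>i\<in>f ` V. (d i)\<^sup>2) + \<tau> / 2 * (\<Sum>i\<in>f ` V. (s i)\<^sup>2)"
      by (simp add: sum.distrib sum_distrib_left)
    also have "\<dots> \<le> (1 / (2 * \<tau>)) * (2 * (\<epsilon> + \<rho>) * n\<^sup>2) + \<tau> / 2 * n\<^sup>2"
      using sumd sums pos by (intro add_mono mult_left_mono) auto
    also have "\<dots> \<le> \<beta> / 2 * n\<^sup>2 + \<beta> / 8 * n\<^sup>2"
    proof (intro add_mono)
      have "(\<epsilon> + \<rho>) / \<tau> \<le> \<beta> / 2"
        using \<epsilon> pos by (simp add: divide_le_eq mult.commute)
      then have "(\<epsilon> + \<rho>) / \<tau> * n\<^sup>2 \<le> \<beta> / 2 * n\<^sup>2"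
        by (intro mult_right_mono) auto
      moreover have "(1 / (2 * \<tau>)) * (2 * (\<epsilon> + \<rho>) * n\<^sup>2) = (\<epsilon> + \<rho>) / \<tau> * n\<^sup>2"
        using pos by (simp add: field_simps)
      ultimately show "(1 / (2 * \<tau>)) * (2 * (\<epsilon> + \<rho>) * n\<^sup>2) \<le> \<beta> / 2 * n\<^sup>2"
        by simp
    qed (simp add: \<tau>_def)
    finally have loss: "card (blow_up_arcs f c \<inter> V \<times> V - blow_up_arcs f c') \<le> \<beta> / 2 * n\<^sup>2 + \<beta> / 8 * n\<^sup>2" .
    have "D - blow_up_arcs f c' \<subseteq> (D - blow_up_arcs f c) \<union> (blow_up_arcs f c \<inter> V \<times> V - blow_up_arcs f c')"
      using sub by auto
    then have "card (D - blow_up_arcs f c') \<le> card ((D - blow_up_arcs f c) \<union> (blow_up_arcs f c \<inter> V \<times> V - blow_up_arcs f c'))"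
      using fin by (intro card_mono) auto
    also have "\<dots> \<le> card (D - blow_up_arcs f c) + card (blow_up_arcs f c \<inter> V \<times> V - blow_up_arcs f c')"
      by (rule card_Un_le)
    finally have "card (D - blow_up_arcs f c') \<le> \<rho> * n\<^sup>2 + (\<beta> / 2 * n\<^sup>2 + \<beta> / 8 * n\<^sup>2)"
      using fc loss by (simp add: n_def)
    also have "\<dots> \<le> \<beta> / 4 * n\<^sup>2 + (\<beta> / 2 * n\<^sup>2 + \<beta> / 8 * n\<^sup>2)"
      using pos by (intro add_mono mult_right_mono) auto
    also have "\<dots> \<le> \<beta> * n\<^sup>2"
      using assms by (simp add: algebra_simps)
    finally show "\<exists>f c. balanced V f c \<and> card (D - blow_up_arcs f c) \<le> \<beta> * (card V)\<^sup>2"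
      using c' by (auto simp: n_def)
  qed
qed

section \<open>Counting\<close>

lemma sum_power_card_Pow:
  fixes x :: real
  assumes "finite U"
  shows "(\<Sum>X\<in>Pow U. x ^ card X) = (1 + x) ^ card U"
  using assms
proof (induction U rule: finite_induct)
  case (insert a U)
  have inj: "inj_on (insert a) (Pow U)"
    using insert(2) by (auto simp: inj_on_def)
  have "(\<Sum>X\<in>Pow (insert a U). x ^ card X) = (\<Sum>X\<in>Pow U. x ^ card X) + (\<Sum>X\<in>insert a ` Pow U. x ^ card X)"
    unfolding Pow_insert using insert by (intro sum.union_disjoint) auto
  also have "(\<Sum>X\<in>insert a ` Pow U. x ^ card X) = (\<Sum>X\<in>Pow U. x * x ^ card X)"
    unfolding sum.reindex[OF inj] o_def
  proof (rule sum.cong)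
    fix X assume "X \<in> Pow U"
    then have "a \<notin> X" "finite X"
      using insert finite_subset by auto
    then show "x ^ card (insert a X) = x * x ^ card X"
      by simp
  qed simp
  finally show ?case
    using insert by (simp add: sum_distrib_left[symmetric] algebra_simps)
qed simp

text \<open>Exponential Markov inequality: each counted set has weight \<open>x ^ card X\<close> at
  least \<open>x powr y\<close>, and all weights together give
  \<open>(1 + x) ^ card U\<close>.\<close>

lemma card_small_subsets:
  fixes x y :: real
  assumes U: "finite U" and x: "0 < x" "x \<le> 1"
  shows "card {X. X \<subseteq> U \<and> card X \<le> y} * x powr y \<le> (1 + x) ^ card U"
proof -
  let ?S = "{X. X \<subseteq> U \<and> card X \<le> y}"
  have "card ?S * x powr y = (\<Sum>X\<in>?S. x powr y)"
    by simp
  also have "\<dots> \<le> (\<Sum>X\<in>?S. x ^ card X)"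
  proof (rule sum_mono)
    fix X assume "X \<in> ?S"
    then have "x powr y \<le> x powr real (card X)"
      using x by (intro powr_mono') auto
    then show "x powr y \<le> x ^ card X"
      using x by (simp add: powr_realpow)
  qed
  also have "\<dots> \<le> (\<Sum>X\<in>Pow U. x ^ card X)"
    using U x by (intro sum_mono2) auto
  finally show ?thesis
    by (simp add: sum_power_card_Pow[OF U])
qed

lemma exists_few_small_subsets:
  fixes \<omega> :: real
  assumes "0 < \<omega>"
  shows "\<exists>\<epsilon>::real. 0 < \<epsilon> \<and> (\<forall>U :: 'a set. finite U \<longrightarrow>
    card {X. X \<subseteq> U \<and> card X \<le> \<epsilon> * card U} \<le> 2 powr (\<omega> * card U))"
proof -
  define x where "x = min (1 / 2) (\<omega> / 4)"
  have x: "0 < x" "x < 1" "x \<le> \<omega> / 4"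
    using assms by (auto simp: x_def)
  define l where "l = - log 2 x"
  have l: "0 < l"
    using x by (simp add: l_def)
  \<comment> \<open>Chosen so that \<open>x powr (\<epsilon> * N)\<close> equals
    \<open>2 powr (- (\<omega> / 2 * N))\<close>; the smallness of \<open>x\<close> keeps
    \<open>(1 + x) powr N\<close> within the other half of the exponent.\<close>
  define \<epsilon> where "\<epsilon> = \<omega> / (2 * l)"
  have \<epsilon>: "0 < \<epsilon>"
    using assms l by (simp add: \<epsilon>_def)
  have ln2: "1 / 2 \<le> ln (2::real)"
    using ln_le_minus_one[of "1 / 2"] by (simp add: ln_div)
  show ?thesis
  proof (intro exI[of _ \<epsilon>] conjI allI impI \<epsilon>)
    fix U :: "'a set" assume U: "finite U"
    define N where "N = real (card U)"
    let ?C = "card {X. X \<subseteq> U \<and> card X \<le> \<epsilon> * card U}"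
    have "x powr (\<epsilon> * N) = 2 powr (log 2 x * (\<epsilon> * N))"
      using x by (simp add: powr_powr[symmetric])
    also have "log 2 x * (\<epsilon> * N) = - (\<omega> / 2 * N)"
      using l by (simp add: \<epsilon>_def l_def field_simps)
    finally have pw: "x powr (\<epsilon> * N) = 2 powr (- (\<omega> / 2 * N))" .
    have "ln (1 + x) \<le> x"
      using x ln_add_one_self_le_self[of x] by simp
    also have "x \<le> 2 * x * ln 2"
      using ln2 x by (simp add: field_simps)
    finally have "log 2 (1 + x) \<le> 2 * x"
      using ln2 by (simp add: log_def divide_le_eq)
    then have log: "log 2 (1 + x) \<le> \<omega> / 2"
      using x by simp
    have "(1 + x) ^ card U = (1 + x) powr N"
      using x by (simp add: powr_realpow N_def)
    also have "\<dots> = 2 powr (log 2 (1 + x) * N)"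
      using x by (simp add: powr_powr[symmetric])
    also have "\<dots> \<le> 2 powr (\<omega> / 2 * N)"
      using log by (intro powr_mono mult_right_mono) (auto simp: N_def)
    finally have "?C * 2 powr (- (\<omega> / 2 * N)) \<le> 2 powr (\<omega> / 2 * N)"
      using card_small_subsets[OF U x(1), of "\<epsilon> * N"] x(2) unfolding pw by (simp add: N_def)
    then have "?C * 2 powr (- (\<omega> / 2 * N)) * 2 powr (\<omega> / 2 * N) \<le> 2 powr (\<omega> / 2 * N) * 2 powr (\<omega> / 2 * N)"
      by (intro mult_right_mono) auto
    then show "?C \<le> 2 powr (\<omega> * card U)"
      by (simp add: mult.assoc powr_add[symmetric] N_def)
  qed
qed

section \<open>Counting through containers\<close>

definition containers :: "'a set \<Rightarrow> nat \<Rightarrow> ('a \<times> 'a) set set" where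
  "containers V L = (\<lambda>R. V \<times> V - Id - rectangles R) ` {R. R \<subseteq> Pow V \<times> Pow V \<and> card R \<le> L}"

lemma card_containers:
  assumes "finite V"
  shows "finite (containers V L)" "card (containers V L) \<le> 2 ^ (2 * card V * L)"
proof -
  let ?T = "tuples (Pow V \<times> Pow V) L"
  have finT: "finite ?T"
    using assms by simp
  have sub: "containers V L \<subseteq> (\<lambda>rs. V \<times> V - Id - rectangles (set rs)) ` ?T"
  proof
    fix D assume "D \<in> containers V L"
    then obtain R where R: "D = V \<times> V - Id - rectangles R" "R \<subseteq> Pow V \<times> Pow V" "card R \<le> L"
      by (auto simp: containers_def)
    have "finite R"
      using R(2) assms finite_subset by blast
    then obtain rs where rs: "set rs = R" "distinct rs"
      using finite_distinct_list by blast
    \<comment> \<open>Padding with empty rectangles gives lists of length exactly \<open>L\<close>,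
      with 4^n choices for each entry.\<close>
    define rs' where "rs' = rs @ replicate (L - card R) ({}, {})"
    have "rectangles (set rs') = rectangles R"
      using rs by (auto simp: rs'_def rectangles_def)
    moreover have "rs' \<in> ?T"
      using rs R distinct_card[OF rs(2)] by (auto simp: rs'_def tuples_def)
    ultimately show "D \<in> (\<lambda>rs. V \<times> V - Id - rectangles (set rs)) ` ?T"
      using R(1) by (intro image_eqI[of _ _ rs']) auto
  qed
  show "finite (containers V L)"
    by (rule finite_subset[OF sub]) (use finT in simp)
  have "card (containers V L) \<le> card ((\<lambda>rs. V \<times> V - Id - rectangles (set rs)) ` ?T)"
    using sub finT by (intro card_mono) auto
  also have "\<dots> \<le> card ?T"
    using finT by (rule card_image_le)
  also have "\<dots> = 2 ^ (2 * card V * L)"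
    using assms by (simp add: card_tuples card_cartesian_product card_Pow power_mult power2_eq_square flip: power_add mult_2)
  finally show "card (containers V L) \<le> 2 ^ (2 * card V * L)" .
qed

text \<open>Each \<open>A\<close> splits into its part inside a container and a small remainder.
  Since the class is hereditary, the first part is again a member and is counted by
  \<open>K\<close>.\<close>

lemma card_contained:
  fixes K y :: real
  assumes V: "finite V" and K: "0 \<le> K" and G: "\<G> \<subseteq> Pow (V \<times> V)"
    and her: "\<And>A A'. A \<in> \<G> \<Longrightarrow> A' \<subseteq> A \<Longrightarrow> A' \<in> \<G>"
    and B: "\<B> \<subseteq> \<G>" "\<And>A. A \<in> \<B> \<Longrightarrow> \<exists>D\<in>containers V L. card (A - D) \<le> y \<and> card {A' \<in> \<G>. A' \<subseteq> D} \<le> K"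
  shows "card \<B> \<le> 2 ^ (2 * card V * L) * (K * card {X. X \<subseteq> V \<times> V \<and> card X \<le> y})"
proof -
  let ?D = "{D \<in> containers V L. card {A' \<in> \<G>. A' \<subseteq> D} \<le> K}"
  let ?S = "{X. X \<subseteq> V \<times> V \<and> card X \<le> y}"
  have finG: "finite \<G>"
    using G V finite_subset by blast
  have finS: "finite ?S"
    using V by simp
  have finD: "finite ?D"
    using card_containers(1)[OF V] by simp
  have "\<B> \<subseteq> (\<Union>D\<in>?D. (\<lambda>(X, Y). X \<union> Y) ` ({A' \<in> \<G>. A' \<subseteq> D} \<times> ?S))"
  proof
    fix A assume A: "A \<in> \<B>"
    then obtain D where D: "D \<in> containers V L" "card (A - D) \<le> y" "card {A' \<in> \<G>. A' \<subseteq> D} \<le> K"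
      using B(2) by blast
    have "A \<in> \<G>" "A \<subseteq> V \<times> V"
      using A B(1) G by auto
    then have "(A \<inter> D, A - D) \<in> {A' \<in> \<G>. A' \<subseteq> D} \<times> ?S"
      using D(2) her[of A "A \<inter> D"] by auto
    moreover have "A = (\<lambda>(X, Y). X \<union> Y) (A \<inter> D, A - D)"
      by auto
    ultimately have "A \<in> (\<lambda>(X, Y). X \<union> Y) ` ({A' \<in> \<G>. A' \<subseteq> D} \<times> ?S)"
      by (intro image_eqI)
    then show "A \<in> (\<Union>D\<in>?D. (\<lambda>(X, Y). X \<union> Y) ` ({A' \<in> \<G>. A' \<subseteq> D} \<times> ?S))"
      using D by (intro UN_I[of D]) auto
  qed
  then have "card \<B> \<le> card (\<Union>D\<in>?D. (\<lambda>(X, Y). X \<union> Y) ` ({A' \<in> \<G>. A' \<subseteq> D} \<times> ?S))"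
    using finG finS finD by (intro card_mono) auto
  also have "\<dots> \<le> (\<Sum>D\<in>?D. card ((\<lambda>(X, Y). X \<union> Y) ` ({A' \<in> \<G>. A' \<subseteq> D} \<times> ?S)))"
    by (rule card_UN_le[OF finD])
  also have "\<dots> \<le> (\<Sum>D\<in>?D. card {A' \<in> \<G>. A' \<subseteq> D} * card ?S)"
  proof (rule sum_mono)
    fix D
    have "card ((\<lambda>(X, Y). X \<union> Y) ` ({A' \<in> \<G>. A' \<subseteq> D} \<times> ?S)) \<le> card ({A' \<in> \<G>. A' \<subseteq> D} \<times> ?S)"
      using finG finS by (intro card_image_le) auto
    then show "card ((\<lambda>(X, Y). X \<union> Y) ` ({A' \<in> \<G>. A' \<subseteq> D} \<times> ?S)) \<le> card {A' \<in> \<G>. A' \<subseteq> D} * card ?S"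
      by (simp only: card_cartesian_product)
  qed
  finally have "real (card \<B>) \<le> real (\<Sum>D\<in>?D. card {A' \<in> \<G>. A' \<subseteq> D} * card ?S)"
    by (rule of_nat_mono)
  also have "\<dots> = (\<Sum>D\<in>?D. real (card {A' \<in> \<G>. A' \<subseteq> D}) * card ?S)"
    by simp
  also have "\<dots> \<le> (\<Sum>D\<in>?D. K * card ?S)"
    by (intro sum_mono mult_right_mono) auto
  also have "\<dots> = card ?D * (K * card ?S)"
    by simp
  also have "\<dots> \<le> 2 ^ (2 * card V * L) * (K * card ?S)"
  proof (rule mult_right_mono)
    have "card ?D \<le> card (containers V L)"
      using card_containers(1)[OF V] by (intro card_mono) auto
    also have "\<dots> \<le> 2 ^ (2 * card V * L)"
      by (rule card_containers(2)[OF V])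
    finally have "real (card ?D) \<le> real (2 ^ (2 * card V * L))"
      by (rule of_nat_mono)
    then show "real (card ?D) \<le> 2 ^ (2 * card V * L)"
      by simp
  qed (use K in simp)
  finally show ?thesis .
qed

definition antisymmetric :: "('a \<times> 'a) set \<Rightarrow> bool" where
  "antisymmetric A \<longleftrightarrow> (\<forall>u v. (u, v) \<in> A \<longrightarrow> (v, u) \<notin> A)"

text \<open>A double edge leaves three choices to an oriented graph instead of four. From 27 \<le>
  32 follows 3 \<le> 2^(5/3), a saving of a third of a bit per double edge, that is, of a sixth per
  ordered pair. The linear order on vertices selects one direction of each double edge.\<close>

lemma card_antisymmetric_subsets:
  fixes D :: "('a::linorder \<times> 'a) set"
  assumes "finite D" "irrefl D"
  shows "card {A. antisymmetric A \<and> A \<subseteq> D} \<le> 2 powr (card D - card (both_ways D) / 6)"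
proof -
  define P where "P = {(u, v) \<in> both_ways D. u < v}"
  define S where "S = D - both_ways D"
  have sub: "both_ways D \<subseteq> D"
    by (auto simp: both_ways_def)
  then have fin: "finite P" "finite S" "finite (both_ways D)"
    using assms(1) finite_subset by (auto simp: P_def S_def intro: finite_subset)
  have both_eq: "both_ways D = P \<union> prod.swap ` P"
  proof (intro equalityI subsetI)
    fix p assume p: "p \<in> both_ways D"
    obtain u v where uv: "p = (u, v)"
      by (cases p)
    have "u \<noteq> v"
      using p assms(2) by (auto simp: uv both_ways_def irrefl_def)
    then consider "u < v" | "v < u"
      by fastforce
    then show "p \<in> P \<union> prod.swap ` P"
    proof cases
      case 2
      then have "(v, u) \<in> P"
        using p by (auto simp: uv P_def both_ways_def)
      then show ?thesis
        by (intro UnI2 image_eqI[of _ _ "(v, u)"]) (simp_all add: uv)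
    qed (use p in \<open>auto simp: uv P_def\<close>)
  qed (auto simp: P_def both_ways_def)
  have "card (P \<union> prod.swap ` P) = card P + card (prod.swap ` P)"
    using fin by (intro card_Un_disjoint) (auto simp: P_def)
  moreover have "card (prod.swap ` P) = card P"
    by (intro card_image) (auto simp: inj_on_def)
  ultimately have both: "card (both_ways D) = 2 * card P"
    unfolding both_eq by simp
  have D: "card D = card S + 2 * card P"
    using card_Diff_subset[OF fin(3) sub] card_mono[OF assms(1) sub] both by (simp add: S_def)
  define g where "g A = (\<lambda>p\<in>P. if p \<in> A then 0 else if prod.swap p \<in> A then 1 else 2 :: nat)" for A
  have "card {A. antisymmetric A \<and> A \<subseteq> D} \<le> card (Pow S \<times> (P \<rightarrow>\<^sub>E {..<3::nat}))"
  proof (rule card_inj_on_le)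
    show "inj_on (\<lambda>A. (A \<inter> S, g A)) {A. antisymmetric A \<and> A \<subseteq> D}"
    proof (rule inj_onI)
      fix A B assume AB: "A \<in> {A. antisymmetric A \<and> A \<subseteq> D}" "B \<in> {A. antisymmetric A \<and> A \<subseteq> D}"
        "(A \<inter> S, g A) = (B \<inter> S, g B)"
      then have A: "antisymmetric A" "A \<subseteq> D" and B: "antisymmetric B" "B \<subseteq> D"
        and eq: "A \<inter> S = B \<inter> S" "g A = g B"
        by simp_all
      have *: "p \<in> A \<longleftrightarrow> p \<in> B" "prod.swap p \<in> A \<longleftrightarrow> prod.swap p \<in> B" if "p \<in> P" for p
      proof -
        have "g A p = g B p"
          using eq by simp
        moreover have "\<not> (p \<in> A \<and> prod.swap p \<in> A)" "\<not> (p \<in> B \<and> prod.swap p \<in> B)"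
          using A B by (cases p; auto simp: antisymmetric_def)+
        ultimately show "p \<in> A \<longleftrightarrow> p \<in> B" "prod.swap p \<in> A \<longleftrightarrow> prod.swap p \<in> B"
          using that by (auto simp: g_def split: if_splits)
      qed
      have "p \<in> A \<longleftrightarrow> p \<in> B" if "p \<in> D" for p
      proof (cases "p \<in> both_ways D")
        case True
        then have "p \<in> P \<or> p \<in> prod.swap ` P"
          using both_eq by blast
        then show ?thesis
        proof
          assume "p \<in> prod.swap ` P"
          then obtain q where "p = prod.swap q" "q \<in> P"
            by blast
          then show ?thesis
            using *(2) by simp
        qed (rule *(1))
      next
        case False
        then show ?thesis
          using eq(1) that by (auto simp: S_def)
      qed
      then show "A = B"
        using A B by blast
    qed
    show "(\<lambda>A. (A \<inter> S, g A)) ` {A. antisymmetric A \<and> A \<subseteq> D} \<subseteq> Pow S \<times> (P \<rightarrow>\<^sub>E {..<3::nat})"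
      by (auto simp: g_def)
  qed (use fin in \<open>auto intro!: finite_PiE\<close>)
  also have "\<dots> = 2 ^ card S * 3 ^ card P"
    using fin by (simp add: card_cartesian_product card_Pow card_PiE)
  finally have "real (card {A. antisymmetric A \<and> A \<subseteq> D}) \<le> real (2 ^ card S * 3 ^ card P)"
    by (rule of_nat_mono)
  also have "\<dots> = 2 powr card S * 3 powr card P"
    by (simp add: powr_realpow)
  also have "\<dots> \<le> 2 powr card S * (2 powr (5 / 3)) powr card P"
  proof (intro mult_left_mono powr_mono2)
    have "(2 powr (5 / 3)) ^ Suc 2 = (2::real) powr (5 / 3 * real (Suc 2))"
      by (subst powr_power) auto
    also have "\<dots> = 2 powr (real 5)"
      by simp
    also have "\<dots> = 2 ^ 5"
      by (rule powr_realpow) simp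
    finally have "(3::real) ^ Suc 2 \<le> (2 powr (5 / 3)) ^ Suc 2"
      by simp
    then show "(3::real) \<le> 2 powr (5 / 3)"
      by (rule power_le_imp_le_base) simp
  qed auto
  also have "\<dots> = 2 powr (card S + 5 / 3 * card P)"
    by (simp add: powr_powr powr_add)
  also have "card S + 5 / 3 * card P = card D - card (both_ways D) / 6"
    using D both by simp
  finally show ?thesis .
qed

section \<open>Planted cycles\<close>

definition cyclefree :: "nat \<Rightarrow> 'a set \<Rightarrow> ('a \<times> 'a) set \<Rightarrow> bool" where
  "cyclefree k V A \<longleftrightarrow> A \<subseteq> V \<times> V \<and> irrefl A \<and> (\<forall>xs\<in>walks V A k. \<not> distinct xs)"

lemma card_nondistinct_tuples:
  assumes "finite V"
  shows "card {xs \<in> tuples V k. \<not> distinct xs} \<le> k\<^sup>2 * card V ^ (k - 1)"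
proof -
  let ?I = "{(i, j). i < j \<and> j < k}"
  define T where "T p = {xs \<in> tuples V k. xs ! fst p = xs ! snd p}" for p :: "nat \<times> nat"
  have finI: "finite ?I"
    by (rule finite_subset[of _ "{..<k} \<times> {..<k}"]) auto
  have "{xs \<in> tuples V k. \<not> distinct xs} \<subseteq> (\<Union>p\<in>?I. T p)"
  proof
    fix xs assume xs: "xs \<in> {xs \<in> tuples V k. \<not> distinct xs}"
    then obtain i j where ij: "i < k" "j < k" "i \<noteq> j" "xs ! i = xs ! j"
      by (auto simp: distinct_conv_nth tuples_def)
    show "xs \<in> (\<Union>p\<in>?I. T p)"
      by (rule UN_I[of "(min i j, max i j)"]) (use ij xs in \<open>auto simp: T_def min_def max_def\<close>)
  qed
  then have "card {xs \<in> tuples V k. \<not> distinct xs} \<le> card (\<Union>p\<in>?I. T p)"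
    using finI assms by (intro card_mono) (auto simp: T_def)
  also have "\<dots> \<le> (\<Sum>p\<in>?I. card (T p))"
    by (rule card_UN_le[OF finI])
  also have "\<dots> \<le> (\<Sum>p\<in>?I. card V ^ (k - 1))"
  proof (rule sum_mono)
    fix p assume "p \<in> ?I"
    then obtain i j where p: "p = (i, j)" "i < j" "j < k"
      by auto
    \<comment> \<open>Entry \<open>j\<close> repeats the earlier entry \<open>i\<close>, so dropping
      it loses no information.\<close>
    have "card (T p) \<le> card (tuples V (k - 1))"
    proof (rule card_inj_on_le)
      show "inj_on (\<lambda>xs. take j xs @ drop (Suc j) xs) (T p)"
      proof (rule inj_onI)
        fix xs ys assume *: "xs \<in> T p" "ys \<in> T p" "take j xs @ drop (Suc j) xs = take j ys @ drop (Suc j) ys"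
        have len: "length xs = k" "length ys = k" and eq: "xs ! i = xs ! j" "ys ! i = ys ! j"
          using * by (simp_all add: T_def tuples_def p)
        have td: "take j xs = take j ys" "drop (Suc j) xs = drop (Suc j) ys"
          using *(3) len append_eq_append_conv[of "take j xs" "take j ys"] by auto
        have "xs ! i = ys ! i"
          using td(1) p(2) nth_take[of i j xs] nth_take[of i j ys] by simp
        then show "xs = ys"
          using td eq len p id_take_nth_drop[of j xs] id_take_nth_drop[of j ys] by simp
      qed
      show "(\<lambda>xs. take j xs @ drop (Suc j) xs) ` T p \<subseteq> tuples V (k - 1)"
      proof (rule image_subsetI)
        fix xs assume "xs \<in> T p"
        then have "set xs \<subseteq> V" "length xs = k"
          by (simp_all add: T_def tuples_def)
        then show "take j xs @ drop (Suc j) xs \<in> tuples V (k - 1)"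
          using p set_take_subset[of j xs] set_drop_subset[of "Suc j" xs] unfolding tuples_def
          by (auto dest: subsetD)
      qed
    qed (use assms in simp)
    then show "card (T p) \<le> card V ^ (k - 1)"
      using assms by (simp add: card_tuples)
  qed
  also have "\<dots> = card ?I * card V ^ (k - 1)"
    by simp
  also have "\<dots> \<le> k\<^sup>2 * card V ^ (k - 1)"
  proof (rule mult_right_mono)
    have "card ?I \<le> card ({..<k} \<times> {..<k})"
      by (intro card_mono) auto
    then show "card ?I \<le> k\<^sup>2"
      by (simp add: card_cartesian_product power2_eq_square)
  qed simp
  finally show ?thesis .
qed

lemma cyclefree_few_walks:
  assumes "finite V" "cyclefree k V A"
  shows "card (walks V A k) \<le> k\<^sup>2 * card V ^ (k - 1)"
proof -
  have "walks V A k \<subseteq> {xs \<in> tuples V k. \<not> distinct xs}"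
    using assms by (auto simp: cyclefree_def walks_def)
  then have "card (walks V A k) \<le> card {xs \<in> tuples V k. \<not> distinct xs}"
    using assms(1) by (intro card_mono) auto
  also note card_nondistinct_tuples[OF assms(1), of k]
  finally show ?thesis .
qed

lemma topological_order:
  assumes "finite V" "A \<subseteq> V \<times> V" "acyclic A"
  shows "\<exists>p. bij_betw p V {..<card V} \<and> (\<forall>(u, v)\<in>A. p u < p v)"
  using assms
proof (induction "card V" arbitrary: V A)
  case 0
  then show ?case
    by (intro exI[of _ "\<lambda>_. 0"]) (auto simp: bij_betw_def)
next
  case (Suc n)
  have "finite A"
    using Suc.prems finite_subset by blast
  then have "wf (A\<inverse>)"
    using Suc.prems by (intro finite_acyclic_wf_converse)
  moreover obtain w where "w \<in> V"
    using Suc.hyps(2) by force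
  ultimately have "\<exists>z\<in>V. \<forall>y. (y, z) \<in> A\<inverse> \<longrightarrow> y \<notin> V"
    unfolding wf_eq_minimal by blast
  then obtain z where z: "z \<in> V" "\<And>y. (y, z) \<in> A\<inverse> \<Longrightarrow> y \<notin> V"
    by blast
  have sink: "(z, y) \<notin> A" for y
    using z Suc.prems(2) by auto
  define A' where "A' = A \<inter> (V - {z}) \<times> (V - {z})"
  have "acyclic A'"
    using Suc.prems(3) by (rule acyclic_subset) (auto simp: A'_def)
  moreover have n: "n = card (V - {z})"
    using Suc z by simp
  ultimately obtain p where p: "bij_betw p (V - {z}) {..<n}" "\<forall>(u, v)\<in>A'. p u < p v"
    using Suc.hyps(1)[of "V - {z}" A'] Suc.prems(1) by (auto simp: A'_def)
  define p' where "p' = p(z := n)"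
  have "bij_betw p' (V - {z}) {..<n}"
    using p(1) by (rule bij_betw_cong[THEN iffD1, rotated]) (auto simp: p'_def)
  moreover have "p' z = n"
    by (simp add: p'_def)
  ultimately have "bij_betw p' (insert z (V - {z})) (insert n {..<n})"
    using notIn_Un_bij_betw[of z "V - {z}" p' "{..<n}"] by simp
  moreover have "insert z (V - {z}) = V" "insert n {..<n} = {..<card V}"
    using z(1) Suc.hyps(2) by auto
  ultimately have bij: "bij_betw p' V {..<card V}"
    by simp
  have "p' u < p' v" if uv: "(u, v) \<in> A" for u v
  proof -
    have V: "u \<in> V" "v \<in> V" "u \<noteq> z"
      using uv Suc.prems(2) sink by auto
    show ?thesis
    proof (cases "v = z")
      case True
      have "p u \<in> {..<n}"
        using p(1) V by (auto simp: bij_betw_def)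
      then show ?thesis
        using True V by (simp add: p'_def)
    next
      case False
      then have "(u, v) \<in> A'"
        using uv V by (simp add: A'_def)
      then show ?thesis
        using p(2) V False by (auto simp: p'_def)
    qed
  qed
  then show ?case
    using bij by blast
qed

text \<open>
  Planting cycles: the vertices are cut into blocks of \<open>q\<close> consecutive vertices with respect to
  \<open>p\<close>, and each block with index in \<open>S\<close> is made to induce a directed cycle of length \<open>q\<close>.
\<close>

locale planted =
  fixes V :: "'a set" and A :: "('a \<times> 'a) set" and p :: "'a \<Rightarrow> nat" and q :: nat and S :: "nat set"
  assumes fin: "finite V" and A: "A \<subseteq> V \<times> V" and p: "bij_betw p V {..<card V}"
    and ord: "\<And>u v. (u, v) \<in> A \<Longrightarrow> p u < p v" and q: "4 \<le> q" and S: "S \<subseteq> {..<card V div q}"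
begin

definition same :: "('a \<times> 'a) set" where
  "same = {(u, v). u \<in> V \<and> v \<in> V \<and> p u div q = p v div q \<and> p u div q \<in> S}"

definition cyc :: "('a \<times> 'a) set" where
  "cyc = {(u, v) \<in> same. p v mod q = Suc (p u mod q) mod q}"

definition plant :: "('a \<times> 'a) set" where
  "plant = (A - same) \<union> cyc"

text \<open>Collapses each planted block to its first position. The height is constant along planted
  cycles and strictly increases along all other arcs.\<close>

definition height :: "'a \<Rightarrow> nat" where
  "height v = (if p v div q \<in> S then q * (p v div q) else p v)"

lemma q0: "0 < q"
  using q by simp

lemma plant_height:
  assumes "(u, v) \<in> plant"
  shows "height u \<le> height v" "height u = height v \<Longrightarrow> (u, v) \<in> cyc"
proof -
  have "height u < height v \<or> (u, v) \<in> cyc"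
  proof (rule disjCI)
    assume "(u, v) \<notin> cyc"
    then have uv: "(u, v) \<in> A" "(u, v) \<notin> same"
      using assms by (auto simp: plant_def)
    have lt: "p u < p v"
      by (rule ord[OF uv(1)])
    then have le: "p u div q \<le> p v div q"
      by (intro div_le_mono) simp
    have V: "u \<in> V" "v \<in> V"
      using uv(1) A by auto
    have lo: "q * (p v div q) \<le> p v"
      by simp
    show "height u < height v"
    proof (cases "p u div q = p v div q")
      case True
      then have "p u div q \<notin> S"
        using uv(2) V by (auto simp: same_def)
      then show ?thesis
        using True lt by (simp add: height_def)
    next
      case False
      then have "Suc (p u div q) \<le> p v div q"
        using le by simp
      then have "q * Suc (p u div q) \<le> q * (p v div q)"
        by (rule mult_le_mono2)
      moreover have "p u < q * Suc (p u div q)"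
        using dividend_less_times_div[OF q0] by simp
      then have "height u < q * Suc (p u div q)"
        using q0 by (simp add: height_def)
      moreover have "q * (p v div q) \<le> height v"
        using lo by (simp add: height_def)
      ultimately show ?thesis
        by linarith
    qed
  qed
  moreover have "height u = height v" if "(u, v) \<in> cyc"
    using that by (auto simp: cyc_def same_def height_def)
  ultimately show "height u \<le> height v" "height u = height v \<Longrightarrow> (u, v) \<in> cyc"
    by auto
qed

lemma plant_trancl_height:
  assumes "(u, v) \<in> plant\<^sup>+"
  shows "height u \<le> height v \<and> (height u = height v \<longrightarrow> (u, v) \<in> same)"
  using assms
proof (induction rule: trancl_induct)
  case (base y)
  then show ?case
    using plant_height[OF base] by (auto simp: cyc_def)
next
  case (step y z)
  have yz: "height y \<le> height z" "height y = height z \<Longrightarrow> (y, z) \<in> cyc"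
    using plant_height[OF step.hyps(2)] .
  show ?case
  proof (intro conjI impI)
    show "height u \<le> height z"
      using yz step.IH by simp
    assume "height u = height z"
    then have "(u, y) \<in> same" "(y, z) \<in> same"
      using yz step.IH by (auto simp: cyc_def)
    then show "(u, z) \<in> same"
      by (auto simp: same_def)
  qed
qed

lemma exists_pos:
  assumes "m < card V"
  shows "\<exists>v\<in>V. p v = m"
proof -
  have "m \<in> p ` V"
    using assms p by (simp add: bij_betw_def)
  then show ?thesis
    by blast
qed

lemma block_pos:
  assumes "i \<in> S" "r < q"
  shows "q * i + r < card V" "(q * i + r) div q = i" "(q * i + r) mod q = r"
proof -
  have "Suc i \<le> card V div q"
    using assms(1) S by auto
  then have "q * Suc i \<le> q * (card V div q)"
    by (rule mult_le_mono2)
  also have "\<dots> \<le> card V"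
    by simp
  finally show "q * i + r < card V"
    using assms(2) by simp
qed (use assms in auto)

lemma same_trancl:
  assumes "(u, v) \<in> same"
  shows "(u, v) \<in> plant\<^sup>+"
proof -
  define i where "i = p u div q"
  have u: "u \<in> V" "v \<in> V" "p v div q = i" "i \<in> S"
    using assms by (auto simp: same_def i_def)
  have reach: "\<forall>w\<in>V. p w = q * i + (p u mod q + Suc t) mod q \<longrightarrow> (u, w) \<in> plant\<^sup>+" for t
  proof (induction t)
    case 0
    show ?case
    proof (intro ballI impI)
      fix w assume w: "w \<in> V" "p w = q * i + (p u mod q + Suc 0) mod q"
      then have "(u, w) \<in> cyc"
        using u q0 block_pos[OF u(4), of "(p u mod q + Suc 0) mod q"] by (auto simp: cyc_def same_def i_def)
      then show "(u, w) \<in> plant\<^sup>+"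
        by (auto simp: plant_def)
    qed
  next
    case (Suc t)
    show ?case
    proof (intro ballI impI)
      fix w assume w: "w \<in> V" "p w = q * i + (p u mod q + Suc (Suc t)) mod q"
      have lt: "(p u mod q + Suc t) mod q < q"
        using q0 by simp
      obtain y where y: "y \<in> V" "p y = q * i + (p u mod q + Suc t) mod q"
        using exists_pos[OF block_pos(1)[OF u(4) lt]] by blast
      have "p w mod q = Suc (p y mod q) mod q"
        unfolding w(2) y(2) using q0 by (simp add: mod_Suc_eq)
      then have "(y, w) \<in> cyc"
        using w y u block_pos[OF u(4) lt] block_pos[OF u(4), of "(p u mod q + Suc (Suc t)) mod q"] q0
        by (auto simp: cyc_def same_def)
      then show "(u, w) \<in> plant\<^sup>+"
        using Suc y by (auto simp: plant_def intro: trancl_into_trancl)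
    qed
  qed
  \<comment> \<open>The full turn \<open>q\<close> keeps the natural subtraction from truncating and
    ensures at least one step, also for \<open>u = v\<close>.\<close>
  define t where "t = p v mod q + q - p u mod q - 1"
  have "p u mod q < q"
    using q0 by auto
  then have "p u mod q + Suc t = p v mod q + q"
    unfolding t_def by linarith
  then have "p v = q * i + (p u mod q + Suc t) mod q"
    using u(3) by (metis mod_add_self2 mod_mod_trivial mult_div_mod_eq)
  then show ?thesis
    using reach u(2) by blast
qed

text \<open>The planted blocks are the nontrivial strong components, so they can be read off from
  \<open>plant\<close> alone; this makes planting decodable.\<close>

lemma plant_connected: "{(u, v). (u, v) \<in> plant\<^sup>+ \<and> (v, u) \<in> plant\<^sup>+} = same"
proof (intro equalityI subrelI)
  fix u v assume "(u, v) \<in> {(u, v). (u, v) \<in> plant\<^sup>+ \<and> (v, u) \<in> plant\<^sup>+}"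
  then show "(u, v) \<in> same"
    using plant_trancl_height[of u v] plant_trancl_height[of v u] by auto
next
  fix u v assume *: "(u, v) \<in> same"
  then have "(v, u) \<in> same"
    by (auto simp: same_def)
  with * show "(u, v) \<in> {(u, v). (u, v) \<in> plant\<^sup>+ \<and> (v, u) \<in> plant\<^sup>+}"
    using same_trancl by blast
qed

lemma plant_diff: "plant - same = A - same"
  by (auto simp: plant_def cyc_def)

text \<open>Decodes the chosen block indices from the blocks once the ordering \<open>p\<close> is
  known.\<close>

lemma S_eq: "S = {p u div q |u. (u, u) \<in> same}"
proof (intro equalityI subsetI)
  fix i assume i: "i \<in> S"
  obtain v where "v \<in> V" "p v = q * i + 0"
    using exists_pos[OF block_pos(1)[OF i q0]] by blast
  then have "(v, v) \<in> same" "i = p v div q"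
    using i q0 by (auto simp: same_def)
  then show "i \<in> {p u div q |u. (u, u) \<in> same}"
    by blast
qed (auto simp: same_def)

lemma card_same: "card same \<le> card S * q\<^sup>2"
proof -
  have finS: "finite S"
    using S finite_subset by blast
  have "card same \<le> card (S \<times> {..<q} \<times> {..<q})"
  proof (rule card_inj_on_le)
    show "inj_on (\<lambda>(u, v). (p u div q, p u mod q, p v mod q)) same"
    proof (rule inj_onI, clarify)
      fix u v u' v'
      assume *: "(u, v) \<in> same" "(u', v') \<in> same" "p u div q = p u' div q"
        "p u mod q = p u' mod q" "p v mod q = p v' mod q"
      have "p u = p u'"
        using *(3,4) by (metis mult_div_mod_eq)
      moreover have "p v div q = p v' div q"
        using * by (simp add: same_def)
      then have "p v = p v'"
        using *(5) by (metis mult_div_mod_eq)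
      ultimately show "u = u' \<and> v = v'"
        using *(1,2) p by (auto simp: same_def bij_betw_def inj_on_def)
    qed
  qed (use finS q0 in \<open>auto simp: same_def\<close>)
  then show ?thesis
    by (simp add: card_cartesian_product power2_eq_square)
qed

lemma plant_subset: "plant \<subseteq> V \<times> V"
  using A by (auto simp: plant_def cyc_def same_def)

text \<open>Opposite arcs would have equal height and so lie on one planted cycle, whose length
  exceeds 2.\<close>

lemma plant_antisymmetric: "antisymmetric plant"
  unfolding antisymmetric_def
proof (intro allI impI notI)
  fix u v assume uv: "(u, v) \<in> plant" "(v, u) \<in> plant"
  then have "height u = height v"
    using plant_height by (meson le_antisym)
  then have "(u, v) \<in> cyc" "(v, u) \<in> cyc"
    using uv plant_height by auto
  then have "p u mod q = Suc (Suc (p u mod q) mod q) mod q"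
    by (auto simp: cyc_def)
  also have "\<dots> = (p u mod q + 2) mod q"
    by (simp add: mod_Suc_eq mod_Suc_Suc_eq)
  finally have "p u mod q = (p u mod q + 2) mod q" .
  moreover have "p u mod q < q"
    using q0 by simp
  ultimately show False
    using q by (cases "p u mod q + 2 < q") (auto simp: le_mod_geq)
qed

text \<open>Heights never decrease along arcs, so a closed walk has constant height and runs on a
  planted cycle. Each step advances by one modulo \<open>q\<close>, and \<open>k = q - 1\<close>
  steps do not return to the start.\<close>

lemma plant_cyclefree:
  assumes "q = Suc k" shows "cyclefree k V plant"
  unfolding cyclefree_def
proof (intro conjI ballI)
  show "irrefl plant"
    using plant_antisymmetric by (auto simp: antisymmetric_def irrefl_def)
  fix xs assume xs: "xs \<in> walks V plant k"
  have k: "3 \<le> k"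
    using q assms by simp
  have arc: "(xs ! j, xs ! (Suc j mod k)) \<in> plant" if "j < k" for j
    using xs that by (auto simp: walks_def tuples_def walk_of_def)
  have up: "height (xs ! 0) \<le> height (xs ! j) \<and> height (xs ! j) \<le> height (xs ! (k - 1))" if "j < k" for j
  proof
    have step: "height (xs ! j) \<le> height (xs ! Suc j)" if "Suc j < k" for j
      using arc[of j] that plant_height(1) by fastforce
    show "height (xs ! 0) \<le> height (xs ! j)"
      using that by (induction j) (use step le_trans in \<open>force+\<close>)
    have "j \<le> k - 1"
      using that by simp
    then show "height (xs ! j) \<le> height (xs ! (k - 1))"
    proof (induction rule: inc_induct)
      case (step m)
      then have "Suc m < k"
        by simp
      with \<open>\<And>j. Suc j < k \<Longrightarrow> height (xs ! j) \<le> height (xs ! Suc j)\<close> step show ?case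
        using le_trans by blast
    qed simp
  qed
  have "height (xs ! (k - 1)) \<le> height (xs ! 0)"
    using arc[of "k - 1"] k plant_height(1)[of "xs ! (k - 1)" "xs ! 0"] by simp
  then have const: "height (xs ! j) = height (xs ! 0)" if "j < k" for j
    using up[OF that] by simp
  have cyc: "(xs ! j, xs ! (Suc j mod k)) \<in> cyc" if "j < k" for j
  proof -
    have lt: "Suc j mod k < k"
      using k by simp
    have "height (xs ! j) = height (xs ! (Suc j mod k))"
      using const[OF that] const[OF lt] by (rule trans[OF _ sym])
    then show ?thesis
      by (rule plant_height(2)[OF arc[OF that]])
  qed
  define r where "r = p (xs ! 0) mod q"
  have r: "p (xs ! j) mod q = (r + j) mod q" if "j < k" for j
    using that
  proof (induction j)
    case (Suc j)
    have "p (xs ! Suc j) mod q = Suc (p (xs ! j) mod q) mod q"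
      using cyc[of j] Suc.prems by (simp add: cyc_def)
    also have "p (xs ! j) mod q = (r + j) mod q"
      using Suc by simp
    also have "Suc ((r + j) mod q) mod q = (r + Suc j) mod q"
      by (simp add: mod_Suc_eq)
    finally show ?case .
  qed (simp add: r_def)
  have "r = Suc (p (xs ! (k - 1)) mod q) mod q"
    using cyc[of "k - 1"] k by (simp add: cyc_def r_def)
  also have "p (xs ! (k - 1)) mod q = (r + (k - 1)) mod q"
    using r[of "k - 1"] k by simp
  also have "Suc ((r + (k - 1)) mod q) mod q = (r + k) mod q"
    using k by (simp add: mod_Suc_eq)
  finally have "r = (r + k) mod q" .
  moreover have "r < q"
    using q0 by (simp add: r_def)
  ultimately have False
    using assms k by (cases "r = 0") (auto simp: le_mod_geq)
  then show "\<not> distinct xs" ..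
qed (rule plant_subset)

end

section \<open>Many more cycle-free oriented graphs than acyclic digraphs\<close>

definition acyclic_sets :: "'a set \<Rightarrow> ('a \<times> 'a) set set" where
  "acyclic_sets V = {A. A \<subseteq> V \<times> V \<and> acyclic A}"

definition cyclefree_sets :: "nat \<Rightarrow> 'a set \<Rightarrow> ('a \<times> 'a) set set" where
  "cyclefree_sets k V = {A. cyclefree k V A}"

definition oriented_cyclefree_sets :: "nat \<Rightarrow> 'a set \<Rightarrow> ('a \<times> 'a) set set" where
  "oriented_cyclefree_sets k V = {A. cyclefree k V A \<and> antisymmetric A}"

lemma finite_cyclefree_sets:
  assumes "finite V"
  shows "finite (cyclefree_sets k V)" "finite (oriented_cyclefree_sets k V)" "finite (acyclic_sets V)"
proof -
  have fin: "finite (Pow (V \<times> V))"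
    using assms by simp
  have cf: "cyclefree_sets k V \<subseteq> Pow (V \<times> V)"
  proof
    fix A assume "A \<in> cyclefree_sets k V"
    then have "cyclefree k V A"
      unfolding cyclefree_sets_def by (rule CollectD)
    then have "A \<subseteq> V \<times> V"
      unfolding cyclefree_def by (rule conjunct1)
    then show "A \<in> Pow (V \<times> V)"
      by (rule PowI)
  qed
  then show "finite (cyclefree_sets k V)"
    using fin by (rule finite_subset)
  have "oriented_cyclefree_sets k V \<subseteq> cyclefree_sets k V"
    unfolding oriented_cyclefree_sets_def cyclefree_sets_def by (rule Collect_mono) simp
  then show "finite (oriented_cyclefree_sets k V)"
    using \<open>finite (cyclefree_sets k V)\<close> by (rule finite_subset)
  have "acyclic_sets V \<subseteq> Pow (V \<times> V)"
    unfolding acyclic_sets_def Pow_def by (rule Collect_mono) (intro impI, erule conjunct1)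
  then show "finite (acyclic_sets V)"
    using fin by (rule finite_subset)
qed

text \<open>The planted set together with the arcs of \<open>A\<close> inside the blocks determines
  \<open>A\<close> and \<open>S\<close>: the blocks are strong components, outside them nothing
  changed, and the topological order is a fixed function of \<open>A\<close>, so that recovering
  \<open>A\<close> also yields the order needed to read off \<open>S\<close>. The blocks contain at
  most s q^2 pairs, which bounds the number of possibilities for the overwritten arcs.\<close>

lemma acyclic_sets_times_binomial:
  assumes V: "finite V" and k: "3 \<le> k" and qk: "q = Suc k"
  shows "card (acyclic_sets V) * ((card V div q) choose s) \<le>
    card (oriented_cyclefree_sets k V) * (2 ^ q\<^sup>2) ^ s"
proof -
  define N where "N = card V div q"
  define \<S> where "\<S> = {S. S \<subseteq> {..<N} \<and> card S = s}"
  define p where "p A = (SOME p. bij_betw p V {..<card V} \<and> (\<forall>(u, v)\<in>A. p u < p v))" for A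
  have p: "bij_betw (p A) V {..<card V} \<and> (\<forall>(u, v)\<in>A. p A u < p A v)" if "A \<in> acyclic_sets V" for A
  proof -
    have "A \<subseteq> V \<times> V" "acyclic A"
      using that unfolding acyclic_sets_def by simp_all
    from someI_ex[OF topological_order[OF V this]] show ?thesis
      unfolding p_def .
  qed
  have planted: "planted V A (p A) q S" if "A \<in> acyclic_sets V" "S \<in> \<S>" for A S
  proof (rule planted.intro)
    show "A \<subseteq> V \<times> V"
      using that(1) unfolding acyclic_sets_def by (elim CollectE conjE)
    show "S \<subseteq> {..<card V div q}"
      using that(2) by (simp add: \<S>_def N_def)
    show "p A u < p A v" if "(u, v) \<in> A" for u v
      using p[OF \<open>A \<in> acyclic_sets V\<close>] that by blast
  qed (use p[OF that(1)] V k qk in simp_all)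
  define conn where "conn X = {(u, v). (u, v) \<in> X\<^sup>+ \<and> (v, u) \<in> X\<^sup>+}" for X :: "('a \<times> 'a) set"
  have conn: "conn (planted.plant V A (p A) q S) = planted.same V (p A) q S"
    if "A \<in> acyclic_sets V" "S \<in> \<S>" for A S
    unfolding conn_def by (rule planted.plant_connected[OF planted[OF that]])
  let ?f = "\<lambda>(A, S). (planted.plant V A (p A) q S, A \<inter> planted.same V (p A) q S)"
  let ?T = "{X \<in> oriented_cyclefree_sets k V. card (conn X) \<le> s * q\<^sup>2}"
  have finconn: "finite (conn X)" if "X \<in> oriented_cyclefree_sets k V" for X
  proof -
    have "X \<subseteq> V \<times> V"
      using that by (simp add: oriented_cyclefree_sets_def cyclefree_def)
    then have "X\<^sup>+ \<subseteq> V \<times> V"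
      by (rule trancl_subset_Sigma)
    moreover have "conn X \<subseteq> X\<^sup>+"
      unfolding conn_def by (rule subrelI) simp
    moreover have "finite (V \<times> V)"
      using V by simp
    ultimately show ?thesis
      by (meson finite_subset subset_trans)
  qed
  have "card (acyclic_sets V \<times> \<S>) \<le> card (SIGMA X:?T. Pow (conn X))"
  proof (rule card_inj_on_le[of ?f])
    show "inj_on ?f (acyclic_sets V \<times> \<S>)"
    proof (rule inj_onI)
      fix x y assume xy: "x \<in> acyclic_sets V \<times> \<S>" "y \<in> acyclic_sets V \<times> \<S>" "?f x = ?f y"
      obtain A S where x: "x = (A, S)" "A \<in> acyclic_sets V" "S \<in> \<S>"
        using xy(1) by blast
      obtain A' S' where y: "y = (A', S')" "A' \<in> acyclic_sets V" "S' \<in> \<S>"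
        using xy(2) by blast
      interpret a: planted V A "p A" q S
        by (rule planted[OF x(2,3)])
      interpret b: planted V A' "p A'" q S'
        by (rule planted[OF y(2,3)])
      have pl: "a.plant = b.plant" and int: "A \<inter> a.same = A' \<inter> b.same"
        using xy(3) by (simp_all add: x(1) y(1))
      have same: "a.same = b.same"
        using conn[OF x(2,3)] conn[OF y(2,3)] pl by simp
      have "A - a.same = A' - a.same"
        using a.plant_diff b.plant_diff pl same by simp
      then have AA: "A = A'"
        using int same by blast
      have "S = S'"
        using a.S_eq b.S_eq same AA by simp
      then show "x = y"
        using x(1) y(1) AA by simp
    qed
    show "?f ` (acyclic_sets V \<times> \<S>) \<subseteq> (SIGMA X:?T. Pow (conn X))"
    proof (rule image_subsetI)
      fix x assume "x \<in> acyclic_sets V \<times> \<S>"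
      then obtain A S where x: "x = (A, S)" "A \<in> acyclic_sets V" "S \<in> \<S>"
        by blast
      interpret planted V A "p A" q S
        by (rule planted[OF x(2,3)])
      have "plant \<in> ?T"
        using plant_cyclefree[OF qk] plant_antisymmetric card_same conn[OF x(2,3)] x(3)
        by (simp add: oriented_cyclefree_sets_def \<S>_def)
      then show "?f x \<in> (SIGMA X:?T. Pow (conn X))"
        using conn[OF x(2,3)] x(1) by simp
    qed
    show "finite (SIGMA X:?T. Pow (conn X))"
      using finite_cyclefree_sets(2)[OF V] finconn by (intro finite_SigmaI) auto
  qed
  also have "\<dots> = (\<Sum>X\<in>?T. card (Pow (conn X)))"
    using finite_cyclefree_sets(2)[OF V, of k] finconn by (intro card_SigmaI) auto
  also have "\<dots> \<le> (\<Sum>X\<in>?T. (2 ^ q\<^sup>2) ^ s)"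
  proof (rule sum_mono)
    fix X assume "X \<in> ?T"
    then have "card (Pow (conn X)) = 2 ^ card (conn X)" "card (conn X) \<le> s * q\<^sup>2"
      using finconn by (auto simp: card_Pow)
    then have "card (Pow (conn X)) \<le> 2 ^ (q\<^sup>2 * s)"
      by (simp add: power_increasing mult.commute)
    then show "card (Pow (conn X)) \<le> (2 ^ q\<^sup>2) ^ s"
      by (simp only: power_mult)
  qed
  also have "\<dots> = card ?T * (2 ^ q\<^sup>2) ^ s"
    by simp
  also have "\<dots> \<le> card (oriented_cyclefree_sets k V) * (2 ^ q\<^sup>2) ^ s"
    using finite_cyclefree_sets(2)[OF V, of k] by (intro mult_right_mono card_mono) auto
  finally show ?thesis
    by (simp add: card_cartesian_product \<S>_def N_def n_subsets)
qed

lemma many_oriented_cyclefree_sets: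
  assumes V: "finite V" and k: "3 \<le> k" and q: "q = Suc k"
  shows "card (acyclic_sets V) * 2 ^ (card V div (q * (2 * 2 ^ q\<^sup>2))) \<le> card (oriented_cyclefree_sets k V)"
proof -
  define K :: nat where "K = 2 ^ q\<^sup>2"
  define N where "N = card V div q"
  \<comment> \<open>For \<open>s > 0\<close> this gives \<open>N choose s\<close> at least
    \<open>(N / s) ^ s\<close>, hence at least \<open>(2 * K) ^ s\<close>. Decoding costs
    \<open>K ^ s\<close>, and the factor \<open>2 ^ s\<close> is the gain.\<close>
  define s where "s = N div (2 * K)"
  have K: "0 < K"
    by (simp add: K_def)
  have sN: "s * (2 * K) \<le> N"
    by (simp add: s_def)
  moreover have "s * 1 \<le> s * (2 * K)"
    using K by (intro mult_le_mono2) simp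
  ultimately have "s \<le> N"
    by linarith
  have "(2 * real K) ^ s \<le> real (N choose s)"
  proof (cases "s = 0")
    case False
    have "2 * real K \<le> real N / real s"
      using of_nat_mono[OF sN, where 'a = real] False by (simp add: field_simps)
    then have "(2 * real K) ^ s \<le> (real N / real s) ^ s"
      by (intro power_mono) auto
    also have "\<dots> \<le> real (N choose s)"
      by (rule binomial_ge_n_over_k_pow_k[OF \<open>s \<le> N\<close>])
    finally show ?thesis .
  qed simp
  then have "real ((2 * K) ^ s) \<le> real (N choose s)"
    by simp
  then have "(2 * K) ^ s \<le> N choose s"
    by (simp only: of_nat_le_iff)
  then have "card (acyclic_sets V) * (2 * K) ^ s \<le> card (acyclic_sets V) * (N choose s)"
    by simp
  also have "\<dots> \<le> card (oriented_cyclefree_sets k V) * K ^ s"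
    unfolding N_def K_def by (rule acyclic_sets_times_binomial[OF V k q])
  finally have "(card (acyclic_sets V) * 2 ^ s) * K ^ s \<le> card (oriented_cyclefree_sets k V) * K ^ s"
    by (simp add: power_mult_distrib mult_ac)
  then have "card (acyclic_sets V) * 2 ^ s \<le> card (oriented_cyclefree_sets k V)"
    using K by simp
  then show ?thesis
    by (simp add: s_def N_def K_def div_mult2_eq)
qed

section \<open>Digraphs with few backwards edges are rare\<close>

lemma card_few_backwards:
  fixes y :: real
  assumes V: "finite (V :: nat set)"
  shows "card {A. A \<subseteq> V \<times> V \<and> irrefl A \<and> (\<exists>\<sigma>. bij_betw \<sigma> V V \<and> card {(i, j) \<in> A. \<sigma> i > \<sigma> j} \<le> y)}
    \<le> card (acyclic_sets V) * card {X. X \<subseteq> V \<times> V \<and> card X \<le> y}"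
proof -
  let ?F = "{A. A \<subseteq> V \<times> V \<and> irrefl A \<and> (\<exists>\<sigma>. bij_betw \<sigma> V V \<and> card {(i, j) \<in> A. \<sigma> i > \<sigma> j} \<le> y)}"
  let ?S = "{X. X \<subseteq> V \<times> V \<and> card X \<le> y}"
  have "?F \<subseteq> (\<lambda>(B, X). B \<union> X) ` (acyclic_sets V \<times> ?S)"
  proof
    fix A assume "A \<in> ?F"
    then obtain \<sigma> where A: "A \<subseteq> V \<times> V" "irrefl A" and \<sigma>: "bij_betw \<sigma> V V" "card {(i, j) \<in> A. \<sigma> i > \<sigma> j} \<le> y"
      by auto
    define X where "X = {(i, j) \<in> A. \<sigma> i > \<sigma> j}"
    have lt: "\<sigma> i < \<sigma> j" if "(i, j) \<in> A - X" for i j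
    proof -
      have "i \<in> V" "j \<in> V" "i \<noteq> j" "\<sigma> i \<le> \<sigma> j"
        using that A by (auto simp: X_def irrefl_def)
      then show ?thesis
        using \<sigma>(1) by (auto simp: bij_betw_def inj_on_def le_less)
    qed
    have "\<sigma> i < \<sigma> j" if "(i, j) \<in> (A - X)\<^sup>+" for i j
      using that by (induction rule: trancl_induct) (use lt less_trans in blast)+
    then have "acyclic (A - X)"
      unfolding acyclic_def by blast
    moreover have "A - X \<subseteq> V \<times> V" "X \<subseteq> V \<times> V" "card X \<le> y"
      using A(1) \<sigma>(2) by (auto simp: X_def)
    ultimately have "(A - X, X) \<in> acyclic_sets V \<times> ?S"
      unfolding acyclic_sets_def by simp
    moreover have "A = (\<lambda>(B, X). B \<union> X) (A - X, X)"
      by (auto simp: X_def)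
    ultimately show "A \<in> (\<lambda>(B, X). B \<union> X) ` (acyclic_sets V \<times> ?S)"
      by (rule rev_image_eqI)
  qed
  moreover have fin: "finite (acyclic_sets V \<times> ?S)"
    using V finite_cyclefree_sets(3)[OF V] by simp
  ultimately have "card ?F \<le> card ((\<lambda>(B, X). B \<union> X) ` (acyclic_sets V \<times> ?S))"
    by (intro card_mono) auto
  also have "\<dots> \<le> card (acyclic_sets V \<times> ?S)"
    using fin by (rule card_image_le)
  finally show ?thesis
    by (simp only: card_cartesian_product)
qed

lemma card_very_small_subsets:
  fixes c :: real
  assumes "finite U" "card U = n\<^sup>2" "2 \<le> n"
  shows "card {X. X \<subseteq> U \<and> card X \<le> c * n / log 2 n} \<le> 3 * 2 powr (2 * c * n)"
proof -
  define y where "y = c * n / log 2 n"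
  \<comment> \<open>This weight keeps \<open>(1 + x) ^ n\<^sup>2\<close> below e, and since its
    binary logarithm is -2 times that of n, the logarithm in the bound \<open>y\<close>
    cancels.\<close>
  define x where "x = 1 / (real n)\<^sup>2"
  have x: "0 < x" "x \<le> 1"
    using assms by (simp_all add: x_def)
  have l: "0 < log 2 n"
    using assms by simp
  have "x powr y = (2 powr (log 2 x)) powr y"
    using x by simp
  also have "log 2 x = - 2 * log 2 n"
    using assms by (simp add: x_def log_divide log_nat_power)
  also have "(2 powr (- 2 * log 2 n)) powr y = 2 powr (- (2 * c * n))"
    using l by (simp add: powr_powr y_def mult.assoc)
  finally have pw: "x powr y = 2 powr (- (2 * c * n))" .
  have "(1 + x) ^ n\<^sup>2 \<le> (exp x) ^ n\<^sup>2"
    using x by (intro power_mono exp_ge_add_one_self) auto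
  also have "\<dots> = exp (n\<^sup>2 * x)"
    by (rule exp_of_nat_mult[symmetric])
  also have "n\<^sup>2 * x = 1"
    using assms by (simp add: x_def)
  finally have "(1 + x) ^ n\<^sup>2 \<le> 3"
    using exp_le by linarith
  then have "card {X. X \<subseteq> U \<and> card X \<le> y} * 2 powr (- (2 * c * n)) \<le> 3"
    using card_small_subsets[OF assms(1) x, of y] unfolding pw assms(2) by linarith
  then have "card {X. X \<subseteq> U \<and> card X \<le> y} * 2 powr (- (2 * c * n)) * 2 powr (2 * c * n) \<le> 3 * 2 powr (2 * c * n)"
    by (intro mult_right_mono) auto
  then show ?thesis
    by (simp add: mult.assoc powr_add[symmetric] y_def)
qed

lemma few_backwards_ratio:
  assumes k: "3 \<le> k"
  shows "\<exists>c>0. \<exists>\<delta> :: nat \<Rightarrow> real. \<delta> \<longlonglongrightarrow> 0 \<and> (\<forall>n\<ge>2.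
    card {A. A \<subseteq> {1..n} \<times> {1..n} \<and> irrefl A \<and>
      (\<exists>\<sigma>. bij_betw \<sigma> {1..n} {1..n} \<and> card {(i, j) \<in> A. \<sigma> i > \<sigma> j} \<le> c * n / log 2 n)}
    \<le> \<delta> n * card (oriented_cyclefree_sets k {1..n}))"
proof -
  define q where "q = Suc k"
  define M where "M = q * (2 * 2 ^ q\<^sup>2)"
  \<comment> \<open>Planting gains at least 4cn - 1 bits, whereas specifying the backwards edges
    costs only 2cn. In \<delta> the factor 6 is the 3 of \<open>card_very_small_subsets\<close>
    times 2 for rounding in \<open>s\<close>.\<close>
  define c where "c = 1 / (4 * real M)"
  define \<delta> where "\<delta> n = 6 * 2 powr (- (2 * c * real n))" for n
  have M: "0 < M"
    by (simp add: M_def q_def)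
  have c: "0 < c"
    using M by (simp add: c_def)
  have "\<delta> \<longlonglongrightarrow> 0"
  proof -
    have "2 powr (- (2 * c)) < (2::real) powr 0"
      by (intro powr_less_mono) (use c in auto)
    then have "2 powr (- (2 * c)) < 1"
      by simp
    then have "(\<lambda>n. 6 * (2 powr (- (2 * c))) ^ n) \<longlonglongrightarrow> 6 * 0"
      by (intro tendsto_mult tendsto_const LIMSEQ_realpow_zero) auto
    moreover have "(2 powr (- (2 * c))) ^ n = 2 powr (- (2 * c * real n))" for n
      by (simp add: powr_power mult_ac)
    ultimately show ?thesis
      by (simp add: \<delta>_def[abs_def])
  qed
  moreover have "card {A. A \<subseteq> {1..n} \<times> {1..n} \<and> irrefl A \<and>
      (\<exists>\<sigma>. bij_betw \<sigma> {1..n} {1..n} \<and> card {(i, j) \<in> A. \<sigma> i > \<sigma> j} \<le> c * n / log 2 n)}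
    \<le> \<delta> n * card (oriented_cyclefree_sets k {1..n})" if n: "2 \<le> n" for n
  proof -
    let ?V = "{1..n}"
    let ?O = "real (card (oriented_cyclefree_sets k ?V))"
    define s where "s = n div M"
    have "real (card (acyclic_sets ?V) * 2 ^ s) \<le> ?O"
      using many_oriented_cyclefree_sets[of ?V k q] k by (intro of_nat_mono) (simp add: q_def s_def M_def)
    then have ac: "card (acyclic_sets ?V) * 2 powr s \<le> ?O"
      by (simp add: powr_realpow)
    have "n < M + M * s"
      unfolding s_def by (rule dividend_less_times_div[OF M])
    then have "real n < real (M + M * s)"
      by (simp only: of_nat_less_iff)
    then have "real n / M - 1 \<le> s"
      using M by (simp add: field_simps)
    then have s: "4 * c * n - 1 \<le> s"
      using M by (simp add: c_def)
    have "card {A. A \<subseteq> ?V \<times> ?V \<and> irrefl A \<and> (\<exists>\<sigma>. bij_betw \<sigma> ?V ?V \<and> card {(i, j) \<in> A. \<sigma> i > \<sigma> j} \<le> c * n / log 2 n)}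
        \<le> real (card (acyclic_sets ?V) * card {X. X \<subseteq> ?V \<times> ?V \<and> card X \<le> c * n / log 2 n})"
      by (intro of_nat_mono card_few_backwards) simp
    also have "\<dots> = real (card (acyclic_sets ?V)) * real (card {X. X \<subseteq> ?V \<times> ?V \<and> card X \<le> c * n / log 2 n})"
      by simp
    also have "\<dots> \<le> real (card (acyclic_sets ?V)) * (3 * 2 powr (2 * c * n))"
      using n by (intro mult_left_mono card_very_small_subsets) (auto simp: card_cartesian_product power2_eq_square)
    also have "\<dots> \<le> real (card (acyclic_sets ?V)) * (\<delta> n * 2 powr s)"
    proof (intro mult_left_mono)
      have "3 * 2 powr (2 * c * n) = 6 * 2 powr (2 * c * n - 1)"
        by (simp add: powr_diff)
      also have "\<dots> \<le> 6 * 2 powr (- (2 * c * n) + s)"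
        using s by (intro mult_left_mono powr_mono) auto
      also have "\<dots> = \<delta> n * 2 powr s"
        by (simp only: \<delta>_def powr_add mult.assoc)
      finally show "3 * 2 powr (2 * c * n) \<le> \<delta> n * 2 powr s" .
    qed simp
    also have "\<dots> = \<delta> n * (card (acyclic_sets ?V) * 2 powr s)"
      by simp
    also have "\<dots> \<le> \<delta> n * ?O"
      using ac by (intro mult_left_mono) (auto simp: \<delta>_def)
    finally show ?thesis .
  qed
  ultimately show ?thesis
    using c by blast
qed

text \<open>Common scheme for the typical upper structure. By \<open>dich\<close>, a container with
  at least the critical number of members of the class forces \<open>P\<close> on every member close
  to it. Members violating \<open>P\<close> thus come from poor containers, and neither the 2^(O(n))
  containers nor the 2^(\<omega> n^2 / 2) possible remainders make up for the missing \<omega> n^2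
  bits.\<close>

lemma bad_ratio:
  fixes \<omega> \<epsilon>0 :: real and \<G> :: "nat \<Rightarrow> (nat \<times> nat) set set"
  assumes k: "3 \<le> k" and \<omega>: "0 < \<omega>" and \<epsilon>0: "0 < \<epsilon>0"
    and G: "\<And>n. \<G> n \<subseteq> Pow ({1..n} \<times> {1..n})" "\<And>n A A'. A \<in> \<G> n \<Longrightarrow> A' \<subseteq> A \<Longrightarrow> A' \<in> \<G> n"
    and dich: "\<And>n D. n0 \<le> n \<Longrightarrow> 0 < n \<Longrightarrow> arc_set {1..n} D \<Longrightarrow> card (walks {1..n} D k) \<le> \<epsilon>0 * n ^ k \<Longrightarrow>
      \<not> card {A' \<in> \<G> n. A' \<subseteq> D} \<le> 2 powr ((1 / 2 - \<omega>) * (real n)\<^sup>2) \<Longrightarrow>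
      (\<And>A. A \<in> \<G> n \<Longrightarrow> card (A - D) \<le> \<epsilon>0 * (real n)\<^sup>2 \<Longrightarrow> P n A)"
  shows "\<exists>\<delta> :: nat \<Rightarrow> real. \<delta> \<longlonglongrightarrow> 0 \<and> (\<forall>\<^sub>F n in sequentially.
    card {A \<in> \<G> n. cyclefree k {1..n} A \<and> \<not> P n A} \<le> \<delta> n * 2 powr (real n * (real n - 1) / 2))"
proof -
  have "0 < \<omega> / 2"
    using \<omega> by simp
  from exists_few_small_subsets[OF this, where 'a = "nat \<times> nat"] obtain \<epsilon>s :: real where \<epsilon>s: "0 < \<epsilon>s" and
    few: "\<And>U :: (nat \<times> nat) set. finite U \<Longrightarrow> card {X. X \<subseteq> U \<and> card X \<le> \<epsilon>s * card U} \<le> 2 powr (\<omega> / 2 * card U)"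
    by blast
  define \<epsilon> where "\<epsilon> = min \<epsilon>0 \<epsilon>s"
  have \<epsilon>: "0 < \<epsilon>" "\<epsilon> \<le> \<epsilon>0" "\<epsilon> \<le> \<epsilon>s"
    using \<epsilon>0 \<epsilon>s by (auto simp: \<epsilon>_def)
  obtain \<epsilon>1 :: real and L where \<epsilon>1: "0 < \<epsilon>1" and
    cont: "\<forall>V::nat set. \<forall>A. finite V \<longrightarrow> V \<noteq> {} \<longrightarrow> card (walks V A k) \<le> \<epsilon>1 * card V ^ k \<longrightarrow>
    (\<exists>R. R \<subseteq> Pow V \<times> Pow V \<and> card R \<le> L \<and> card (A \<inter> rectangles R) \<le> \<epsilon> * (card V)\<^sup>2 \<and>
      card (walks V (V \<times> V - rectangles R) k) \<le> \<epsilon> * card V ^ k)"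
    using container[OF k \<epsilon>(1), where 'a = nat] by (elim exE conjE) (rule that)
  \<comment> \<open>The terms are the number of containers, the gap n/2 between n^2/2 and n(n-1)/2,
    and what is left of the missing \<omega> n^2 bits after the remainders.\<close>
  define \<delta> where "\<delta> n = 2 powr (2 * real n * L + real n / 2 - \<omega> / 2 * (real n)\<^sup>2)" for n
  have "\<delta> \<longlonglongrightarrow> 0"
    unfolding \<delta>_def using \<omega> by real_asymp
  moreover have "\<forall>\<^sub>F n in sequentially.
    card {A \<in> \<G> n. cyclefree k {1..n} A \<and> \<not> P n A} \<le> \<delta> n * 2 powr (real n * (real n - 1) / 2)"
    using eventually_ge_at_top[of "max n0 (nat \<lceil>(real k)\<^sup>2 / \<epsilon>1\<rceil> + 1)"]
  proof eventually_elim
    case (elim n)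
    define V where "V = {1..n}"
    have n: "n0 \<le> n" "0 < n" "(real k)\<^sup>2 / \<epsilon>1 \<le> n"
      using elim by linarith+
    have V: "finite V" "V \<noteq> {}" "card V = n"
      using n by (auto simp: V_def)
    let ?y = "\<epsilon> * (real n)\<^sup>2"
    let ?K = "2 powr ((1 / 2 - \<omega>) * (real n)\<^sup>2)"
    let ?B = "{A \<in> \<G> n. cyclefree k {1..n} A \<and> \<not> P n A}"
    have "card ?B \<le> 2 ^ (2 * card V * L) * (?K * card {X. X \<subseteq> V \<times> V \<and> card X \<le> ?y})"
    proof (rule card_contained[OF V(1), where \<G> = "\<G> n"])
      show "\<G> n \<subseteq> Pow (V \<times> V)"
        using G(1) by (simp add: V_def)
      show "A' \<in> \<G> n" if "A \<in> \<G> n" "A' \<subseteq> A" for A A'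
        using G(2) that by blast
      fix A assume A: "A \<in> ?B"
      then have cf: "cyclefree k V A"
        by (simp add: V_def)
      have "real (card (walks V A k)) \<le> real (k\<^sup>2 * card V ^ (k - 1))"
        by (intro of_nat_mono cyclefree_few_walks[OF V(1) cf])
      also have "\<dots> = (real k)\<^sup>2 * real n ^ (k - 1)"
        by (simp add: V(3))
      also have "\<dots> \<le> (\<epsilon>1 * n) * real n ^ (k - 1)"
        using n(3) \<epsilon>1 by (intro mult_right_mono) (auto simp: field_simps)
      also have "\<dots> = \<epsilon>1 * real n ^ k"
        using k by (cases k) auto
      finally have "card (walks V A k) \<le> \<epsilon>1 * card V ^ k"
        by (simp add: V(3))
      from cont[rule_format, OF V(1,2) this] obtain R where
        R: "R \<subseteq> Pow V \<times> Pow V" "card R \<le> L" "card (A \<inter> rectangles R) \<le> \<epsilon> * (card V)\<^sup>2"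
          "card (walks V (V \<times> V - rectangles R) k) \<le> \<epsilon> * card V ^ k"
        by blast
      define D where "D = V \<times> V - Id - rectangles R"
      have "D \<in> containers V L"
        using R by (auto simp: D_def containers_def)
      have "A - D = A \<inter> rectangles R"
        using cf by (auto simp: D_def cyclefree_def irrefl_def)
      then have AD: "card (A - D) \<le> ?y"
        using R(3) by (simp add: V(3))
      have arc: "arc_set V D"
        using V by (auto simp: arc_set_def D_def irrefl_def)
      have "card (walks V D k) \<le> card (walks V (V \<times> V - rectangles R) k)"
        using V by (intro card_mono walks_mono finite_walks) (auto simp: D_def)
      then have "real (card (walks V D k)) \<le> \<epsilon> * real n ^ k"
        using R(4) by (simp add: V(3))
      also have "\<dots> \<le> \<epsilon>0 * real n ^ k"
        using \<epsilon> by (intro mult_right_mono) auto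
      finally have wk: "real (card (walks V D k)) \<le> \<epsilon>0 * real n ^ k" .
      have AD0: "card (A - D) \<le> \<epsilon>0 * (real n)\<^sup>2"
        using AD mult_right_mono[OF \<epsilon>(2), of "(real n)\<^sup>2"] by simp
      have "card {A' \<in> \<G> n. A' \<subseteq> D} \<le> ?K"
      proof (rule ccontr)
        assume *: "\<not> ?thesis"
        have "A \<in> \<G> n"
          using A by simp
        then have "P n A"
          using AD0 by (rule dich[OF n(1,2) arc[unfolded V_def] wk[unfolded V_def] *])
        with A show False
          by simp
      qed
      with \<open>D \<in> containers V L\<close> AD
      show "\<exists>D\<in>containers V L. card (A - D) \<le> ?y \<and> card {A' \<in> \<G> n. A' \<subseteq> D} \<le> ?K"
        by blast
    qed auto
    also have "\<dots> \<le> 2 ^ (2 * card V * L) * (?K * 2 powr (\<omega> / 2 * (real n)\<^sup>2))"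
    proof (intro mult_left_mono)
      have "?y \<le> \<epsilon>s * card (V \<times> V)"
        using \<epsilon>(3) by (simp add: card_cartesian_product V(3) power2_eq_square mult_right_mono)
      then have "card {X. X \<subseteq> V \<times> V \<and> card X \<le> ?y} \<le> card {X. X \<subseteq> V \<times> V \<and> card X \<le> \<epsilon>s * card (V \<times> V)}"
        using V by (intro card_mono) (auto simp del: card_cartesian_product)
      then show "real (card {X. X \<subseteq> V \<times> V \<and> card X \<le> ?y}) \<le> 2 powr (\<omega> / 2 * (real n)\<^sup>2)"
        using few[of "V \<times> V"] V by (simp add: card_cartesian_product power2_eq_square)
    qed auto
    also have "2 ^ (2 * card V * L) = 2 powr (2 * real n * L)"
      by (simp add: powr_realpow[symmetric] V(3))
    also have "2 powr (2 * real n * L) * (?K * 2 powr (\<omega> / 2 * (real n)\<^sup>2)) =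
        2 powr (2 * real n * L + ((1 / 2 - \<omega>) * (real n)\<^sup>2 + \<omega> / 2 * (real n)\<^sup>2))"
      by (simp only: powr_add)
    also have "\<dots> = 2 powr ((2 * real n * L + real n / 2 - \<omega> / 2 * (real n)\<^sup>2) + real n * (real n - 1) / 2)"
      by (rule arg_cong[of _ _ "\<lambda>x. 2 powr x"]) (simp add: power2_eq_square field_simps)
    also have "\<dots> = \<delta> n * 2 powr (real n * (real n - 1) / 2)"
      by (simp only: powr_add \<delta>_def)
    finally show ?case .
  qed
  ultimately show ?thesis
    by blast
qed

section \<open>Cycle-free digraphs as arc sets\<close>

definition digraph_of :: "nat \<Rightarrow> (nat \<times> nat) set \<Rightarrow> nat pair_pre_digraph" where
  "digraph_of n A = \<lparr>pverts = {1..n}, parcs = A\<rparr>"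

lemma pverts_digraph_of [simp]: "pverts (digraph_of n A) = {1..n}"
  and parcs_digraph_of [simp]: "parcs (digraph_of n A) = A"
  by (simp_all add: digraph_of_def)

lemma inj_digraph_of: "inj_on (digraph_of n) X"
  by (auto simp: inj_on_def digraph_of_def)

lemma pair_digraph_iff:
  "pair_digraph G \<longleftrightarrow> finite (pverts G) \<and> parcs G \<subseteq> pverts G \<times> pverts G \<and> irrefl (parcs G)"
proof
  assume "pair_digraph G"
  then interpret pair_digraph G .
  show "finite (pverts G) \<and> parcs G \<subseteq> pverts G \<times> pverts G \<and> irrefl (parcs G)"
    using finite_verts in_arcsD1 in_arcsD2 by (auto simp: irrefl_def dest: no_loops')
next
  assume *: "finite (pverts G) \<and> parcs G \<subseteq> pverts G \<times> pverts G \<and> irrefl (parcs G)"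
  then have "finite (parcs G)"
    by (meson finite_SigmaI finite_subset)
  with * show "pair_digraph G"
    by unfold_locales (auto simp: irrefl_def)
qed

lemma digraphs_on_eq: "digraphs_on n = digraph_of n ` {A. A \<subseteq> {1..n} \<times> {1..n} \<and> irrefl A}"
proof (intro equalityI subsetI)
  fix G assume "G \<in> digraphs_on n"
  then have G: "pair_digraph G" "pverts G = {1..n}"
    by (simp_all add: digraphs_on_def)
  then have "G = digraph_of n (parcs G)"
    by (simp add: digraph_of_def)
  moreover have "parcs G \<in> {A. A \<subseteq> {1..n} \<times> {1..n} \<and> irrefl A}"
    using G unfolding pair_digraph_iff by simp
  ultimately show "G \<in> digraph_of n ` {A. A \<subseteq> {1..n} \<times> {1..n} \<and> irrefl A}"
    by (rule image_eqI)
qed (auto simp: digraphs_on_def pair_digraph_iff)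

lemma wf_directed_cycle: "0 < k \<Longrightarrow> wf_digraph (with_proj (directed_cycle k))"
  by unfold_locales (auto simp: directed_cycle_def)

text \<open>A subgraph must share the projections \<open>fst\<close> and \<open>snd\<close> as tail
  and head maps, so an isomorphism onto it sends an arc to the pair of images of its ends. A copy of
  the cycle is thereby given by its vertex map alone, that is, by a closed walk with distinct
  entries.\<close>

lemma contains_directed_cycle_iff:
  assumes G: "pair_digraph G" and k: "0 < k"
  shows "contains_copy (with_proj G) (with_proj (directed_cycle k)) \<longleftrightarrow>
    (\<exists>xs\<in>walks (pverts G) (parcs G) k. distinct xs)"
proof
  let ?H = "with_proj (directed_cycle k)"
  assume "contains_copy (with_proj G) ?H"
  then obtain K f where K: "subgraph K (with_proj G)" "K = app_iso f ?H" and
    f: "pre_digraph.digraph_isomorphism ?H f"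
    by (auto simp: contains_copy_def digraph_iso_def)
  define xs where "xs = map (iso_verts f) [0..<k]"
  have inj: "inj_on (iso_verts f) {0..<k}"
    using f by (simp add: pre_digraph.digraph_isomorphism_def directed_cycle_def)
  then have "distinct xs"
    by (simp add: xs_def distinct_map)
  moreover have "set xs \<subseteq> pverts G"
    using K by (auto simp: subgraph_def xs_def directed_cycle_def)
  moreover have "(xs ! i, xs ! (Suc i mod k)) \<in> parcs G" if i: "i < k" for i
  proof -
    let ?a = "(i, (i + 1) mod k)"
    have a: "?a \<in> arcs ?H"
      using i by (auto simp: directed_cycle_def)
    then have in_G: "iso_arcs f ?a \<in> parcs G"
      using K by (auto simp: subgraph_def)
    have "tail K = fst" "head K = snd"
      using K(1) by (simp_all add: subgraph_def compatible_def)
    then have "iso_tail f = fst" "iso_head f = snd"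
      using K(2) by simp_all
    then have "fst (iso_arcs f ?a) = iso_verts f i" "snd (iso_arcs f ?a) = iso_verts f ((i + 1) mod k)"
      using f a unfolding pre_digraph.digraph_isomorphism_def by force+
    moreover have "xs ! i = iso_verts f i" "xs ! (Suc i mod k) = iso_verts f ((i + 1) mod k)"
      using i k by (simp_all add: xs_def)
    ultimately show ?thesis
      using in_G by (metis prod.collapse)
  qed
  ultimately show "\<exists>xs\<in>walks (pverts G) (parcs G) k. distinct xs"
    by (intro bexI[of _ xs]) (auto simp: walks_def tuples_def walk_of_def xs_def)
next
  let ?H = "with_proj (directed_cycle k)"
  assume "\<exists>xs\<in>walks (pverts G) (parcs G) k. distinct xs"
  then obtain xs where xs: "set xs \<subseteq> pverts G" "length xs = k" "distinct xs"
    and arc: "\<And>i. i < k \<Longrightarrow> (xs ! i, xs ! (Suc i mod k)) \<in> parcs G"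
    by (auto simp: walks_def tuples_def walk_of_def)
  define f where "f = \<lparr>iso_verts = (!) xs, iso_arcs = (\<lambda>(i, j). (xs ! i, xs ! j)), iso_head = snd, iso_tail = fst\<rparr>"
  have lt: "Suc i mod k < k" for i
    using k by simp
  have inj: "inj_on ((!) xs) {0..<k}"
    using xs by (auto simp: inj_on_def nth_eq_iff_index_eq)
  have "inj_on (\<lambda>(i, j). (xs ! i, xs ! j)) {(i, (i + 1) mod k) |i. i < k}"
    using xs lt by (auto simp: inj_on_def nth_eq_iff_index_eq)
  then have iso: "pre_digraph.digraph_isomorphism ?H f"
    using wf_directed_cycle[OF k] inj
    by (auto simp: pre_digraph.digraph_isomorphism_def f_def directed_cycle_def)
  have "subgraph (app_iso f ?H) (with_proj G)"
    unfolding subgraph_def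
  proof (intro conjI)
    show "verts (app_iso f ?H) \<subseteq> verts (with_proj G)"
      using xs by (auto simp: f_def directed_cycle_def)
    show "arcs (app_iso f ?H) \<subseteq> arcs (with_proj G)"
      using arc by (auto simp: f_def directed_cycle_def)
    show "wf_digraph (with_proj G)"
      using G unfolding pair_digraph_iff by unfold_locales auto
    show "wf_digraph (app_iso f ?H)"
      using lt by unfold_locales (auto simp: f_def directed_cycle_def)
    show "compatible (with_proj G) (app_iso f ?H)"
      by (simp add: compatible_def f_def)
  qed
  then show "contains_copy (with_proj G) ?H"
    using iso unfolding contains_copy_def digraph_iso_def by blast
qed

lemma cycle_free_digraph_of:
  assumes "A \<subseteq> {1..n} \<times> {1..n}" "irrefl A" "0 < k"
  shows "cycle_free k (digraph_of n A) \<longleftrightarrow> cyclefree k {1..n} A"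
proof -
  have "pair_digraph (digraph_of n A)"
    using assms by (simp add: pair_digraph_iff)
  then show ?thesis
    using contains_directed_cycle_iff[of "digraph_of n A" k] assms
    by (simp add: cycle_free_def cyclefree_def)
qed

lemma cycle_free_digraphs_eq:
  assumes "0 < k"
  shows "cycle_free_digraphs k n = digraph_of n ` cyclefree_sets k {1..n}"
  unfolding cycle_free_digraphs_def digraphs_on_eq cyclefree_sets_def
  using cycle_free_digraph_of[OF _ _ assms] by (auto simp: cyclefree_def)

lemma cycle_free_oriented_graphs_eq:
  assumes "0 < k"
  shows "cycle_free_oriented_graphs k n = digraph_of n ` oriented_cyclefree_sets k {1..n}"
  unfolding cycle_free_oriented_graphs_def digraphs_on_eq oriented_cyclefree_sets_def oriented_def
    antisymmetric_def
  using cycle_free_digraph_of[OF _ _ assms] by (auto simp: cyclefree_def)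

lemma many_cyclefree_sets:
  assumes "3 \<le> k"
  shows "2 powr (real n * (real n - 1) / 2) \<le> card (oriented_cyclefree_sets k {1..n})"
proof -
  let ?U = "{(i, j). i \<in> {1..n} \<and> j \<in> {1..n} \<and> i < j}"
  have finU: "finite ?U"
    by (rule finite_subset[of _ "{1..n} \<times> {1..n}"]) auto
  have "nonadjacent ?U \<inter> {1..n} \<times> {1..n} = (\<lambda>i. (i, i)) ` {1..n}"
    by (auto simp: nonadjacent_def)
  moreover have "card ((\<lambda>i. (i, i)) ` {1..n}) = n"
    by (subst card_image) (auto simp: inj_on_def)
  moreover have "both_ways ?U = {}"
    by (auto simp: both_ways_def)
  moreover have "?U \<inter> {1..n} \<times> {1..n} = ?U"
    by auto
  ultimately have "2 * card ?U + n = n\<^sup>2"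
    using card_square_eq[of "{1..n}" ?U] by simp
  then have "real (2 * card ?U + n) = real (n\<^sup>2)"
    by (rule arg_cong)
  then have "2 * real (card ?U) + n = (real n)\<^sup>2"
    by simp
  then have U: "real (card ?U) = real n * (real n - 1) / 2"
    by (simp add: power2_eq_square algebra_simps)
  have "Pow ?U \<subseteq> oriented_cyclefree_sets k {1..n}"
  proof
    fix A assume "A \<in> Pow ?U"
    then have A: "A \<subseteq> {1..n} \<times> {1..n}" "\<And>i j. (i, j) \<in> A \<Longrightarrow> i < j"
      by auto
    have "walks {1..n} A k = {}"
    proof (rule ccontr)
      assume "walks {1..n} A k \<noteq> {}"
      then obtain xs where xs: "\<And>i. i < k \<Longrightarrow> (xs ! i, xs ! (Suc i mod k)) \<in> A"
        by (auto simp: walks_def tuples_def walk_of_def)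
      have le: "xs ! 0 \<le> xs ! i" if "i < k" for i
        using that
      proof (induction i)
        case (Suc i)
        then show ?case
          using A(2)[OF xs[of i]] by simp
      qed simp
      have "xs ! (k - 1) < xs ! 0"
        using A(2)[OF xs[of "k - 1"]] assms by simp
      with le[of "k - 1"] assms show False
        by simp
    qed
    moreover have "irrefl A"
      unfolding irrefl_def using A(2) by (meson less_irrefl)
    moreover have "antisymmetric A"
      unfolding antisymmetric_def using A(2) by (meson less_asym)
    ultimately show "A \<in> oriented_cyclefree_sets k {1..n}"
      using A(1) by (simp add: oriented_cyclefree_sets_def cyclefree_def)
  qed
  then have "card (Pow ?U) \<le> card (oriented_cyclefree_sets k {1..n})"
    by (intro card_mono finite_cyclefree_sets) simp
  then have "real (2 ^ card ?U) \<le> real (card (oriented_cyclefree_sets k {1..n}))"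
    using finU by (intro of_nat_mono) (simp add: card_Pow)
  then show ?thesis
    unfolding U[symmetric] by (simp add: powr_realpow)
qed

lemma oriented_cyclefree_subset: "oriented_cyclefree_sets k V \<subseteq> cyclefree_sets k V"
  unfolding oriented_cyclefree_sets_def cyclefree_sets_def by (rule Collect_mono) simp

lemma almost_allI:
  fixes \<delta> :: "nat \<Rightarrow> real"
  assumes fin: "\<And>n. finite (F n)" and ne: "\<And>n. F n \<noteq> {}" and lim: "\<delta> \<longlonglongrightarrow> 0"
    and bad: "\<forall>\<^sub>F n in sequentially. card {G \<in> F n. \<not> P n G} \<le> \<delta> n * card (F n)"
  shows "almost_all F P"
proof -
  have "(\<lambda>n. 1 - \<delta> n) \<longlonglongrightarrow> 1 - 0"
    by (intro tendsto_diff tendsto_const lim)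
  then have lim1: "(\<lambda>n. 1 - \<delta> n) \<longlonglongrightarrow> 1"
    by simp
  have F: "0 < real (card (F n))" for n
    using fin ne by (simp add: card_gt_0_iff)
  show ?thesis
    unfolding almost_all_def
  proof (rule tendsto_sandwich[OF _ _ lim1 tendsto_const])
    show "\<forall>\<^sub>F n in sequentially. 1 - \<delta> n \<le> card {G \<in> F n. P n G} / card (F n)"
      using bad
    proof eventually_elim
      case (elim n)
      have "F n = {G \<in> F n. P n G} \<union> {G \<in> F n. \<not> P n G}"
        by auto
      then have "card (F n) \<le> card {G \<in> F n. P n G} + card {G \<in> F n. \<not> P n G}"
        by (metis card_Un_le)
      then have "real (card (F n)) \<le> card {G \<in> F n. P n G} + \<delta> n * card (F n)"
        using elim by linarith
      then show ?case
        using F[of n] by (simp add: le_divide_eq algebra_simps)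
    qed
    show "\<forall>\<^sub>F n in sequentially. card {G \<in> F n. P n G} / card (F n) \<le> 1"
    proof (rule always_eventually, rule allI)
      fix n
      have "card {G \<in> F n. P n G} \<le> card (F n)"
        using fin by (intro card_mono) auto
      then show "card {G \<in> F n. P n G} / card (F n) \<le> 1"
        using F[of n] by simp
    qed
  qed
qed

lemma almost_all_digraph_ofI:
  fixes \<delta> :: "nat \<Rightarrow> real"
  assumes F: "\<And>n. F n = digraph_of n ` \<A> n" and fin: "\<And>n. finite (\<A> n)" and ne: "\<And>n. \<A> n \<noteq> {}"
    and lim: "\<delta> \<longlonglongrightarrow> 0"
    and bad: "\<forall>\<^sub>F n in sequentially. card {A \<in> \<A> n. \<not> Q n A} \<le> \<delta> n * card (\<A> n)"
    and Q: "\<And>n A. A \<in> \<A> n \<Longrightarrow> Q n A \<Longrightarrow> P n (digraph_of n A)"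
  shows "almost_all F P"
proof (rule almost_allI[OF _ _ lim])
  show "\<forall>\<^sub>F n in sequentially. card {G \<in> F n. \<not> P n G} \<le> \<delta> n * card (F n)"
    using bad
  proof eventually_elim
    case (elim n)
    have "{G \<in> F n. \<not> P n G} \<subseteq> digraph_of n ` {A \<in> \<A> n. \<not> Q n A}"
      using Q by (auto simp: F)
    then have "card {G \<in> F n. \<not> P n G} \<le> card (digraph_of n ` {A \<in> \<A> n. \<not> Q n A})"
      using fin by (intro card_mono) auto
    also have "\<dots> = card {A \<in> \<A> n. \<not> Q n A}"
      by (rule card_image[OF inj_digraph_of])
    finally have "card {G \<in> F n. \<not> P n G} \<le> card {A \<in> \<A> n. \<not> Q n A}" .
    then show ?case
      using elim by (simp add: F card_image[OF inj_digraph_of])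
  qed
qed (use fin ne in \<open>auto simp: F\<close>)

section \<open>Typical properties\<close>

text \<open>Exceptions are bounded by a null sequence times the size of the class, so that the
  exceptions of several properties can simply be added.\<close>

definition typical :: "(nat \<Rightarrow> (nat \<times> nat) set set) \<Rightarrow> (nat \<Rightarrow> (nat \<times> nat) set \<Rightarrow> bool) \<Rightarrow> bool" where
  "typical \<A> Q \<longleftrightarrow> (\<exists>\<delta> :: nat \<Rightarrow> real. \<delta> \<longlonglongrightarrow> 0 \<and>
    (\<forall>\<^sub>F n in sequentially. card {A \<in> \<A> n. \<not> Q n A} \<le> \<delta> n * card (\<A> n)))"

lemma typical_conj:
  assumes fin: "\<And>n. finite (\<A> n)" and "typical \<A> Q" "typical \<A> R"
  shows "typical \<A> (\<lambda>n A. Q n A \<and> R n A)"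
proof -
  obtain \<delta> \<delta>' :: "nat \<Rightarrow> real" where lim: "\<delta> \<longlonglongrightarrow> 0" "\<delta>' \<longlonglongrightarrow> 0" and
    Q: "\<forall>\<^sub>F n in sequentially. card {A \<in> \<A> n. \<not> Q n A} \<le> \<delta> n * card (\<A> n)" and
    R: "\<forall>\<^sub>F n in sequentially. card {A \<in> \<A> n. \<not> R n A} \<le> \<delta>' n * card (\<A> n)"
    using assms(2,3) unfolding typical_def by blast
  have "(\<lambda>n. \<delta> n + \<delta>' n) \<longlonglongrightarrow> 0"
    using tendsto_add[OF lim] by simp
  moreover have "\<forall>\<^sub>F n in sequentially. card {A \<in> \<A> n. \<not> (Q n A \<and> R n A)} \<le> (\<delta> n + \<delta>' n) * card (\<A> n)"
    using Q R
  proof eventually_elim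
    case (elim n)
    have "{A \<in> \<A> n. \<not> (Q n A \<and> R n A)} = {A \<in> \<A> n. \<not> Q n A} \<union> {A \<in> \<A> n. \<not> R n A}"
      by auto
    then have "card {A \<in> \<A> n. \<not> (Q n A \<and> R n A)} \<le> card {A \<in> \<A> n. \<not> Q n A} + card {A \<in> \<A> n. \<not> R n A}"
      by (simp add: card_Un_le)
    then have "real (card {A \<in> \<A> n. \<not> (Q n A \<and> R n A)}) \<le> \<delta> n * card (\<A> n) + \<delta>' n * card (\<A> n)"
      using elim by linarith
    then show ?case
      by (simp add: distrib_right)
  qed
  ultimately show ?thesis
    unfolding typical_def by blast
qed

text \<open>
  \<open>X n\<close> bounds the number of exceptional arc sets; the class only has to be at least as large as
  the class of oriented \<open>C\<^sub>k\<close>-free graphs.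
\<close>

lemma typicalI:
  fixes \<delta> X :: "nat \<Rightarrow> real"
  assumes lim: "\<delta> \<longlonglongrightarrow> 0"
    and bad: "\<forall>\<^sub>F n in sequentially. card {A \<in> \<A> n. \<not> Q n A} \<le> \<delta> n * X n"
    and X: "\<And>n. 0 \<le> X n" "\<And>n. X n \<le> card (\<A> n)"
  shows "typical \<A> Q"
  unfolding typical_def
proof (intro exI[of _ "\<lambda>n. \<bar>\<delta> n\<bar>"] conjI)
  show "(\<lambda>n. \<bar>\<delta> n\<bar>) \<longlonglongrightarrow> 0"
    using lim by (rule tendsto_rabs_zero)
  show "\<forall>\<^sub>F n in sequentially. card {A \<in> \<A> n. \<not> Q n A} \<le> \<bar>\<delta> n\<bar> * card (\<A> n)"
    using bad
  proof eventually_elim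
    case (elim n)
    also have "\<delta> n * X n \<le> \<bar>\<delta> n\<bar> * X n"
      using X by (intro mult_right_mono) auto
    also have "\<dots> \<le> \<bar>\<delta> n\<bar> * card (\<A> n)"
      using X by (intro mult_left_mono) auto
    finally show ?case .
  qed
qed

lemma card_oriented_le: "card (oriented_cyclefree_sets k {1..n::nat}) \<le> card (cyclefree_sets k {1..n})"
  by (intro card_mono finite_cyclefree_sets oriented_cyclefree_subset) simp

text \<open>For both classes the exceptions are compared with the oriented class alone, which is
  contained in the other; so one constant serves both.\<close>

lemma typical_many_backwards:
  assumes k: "3 \<le> k"
  shows "\<exists>c::real. 0 < c \<and> (\<forall>\<A>. \<A> = (\<lambda>n. oriented_cyclefree_sets k {1..n}) \<or> \<A> = (\<lambda>n. cyclefree_sets k {1..n}) \<longrightarrow>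
    typical \<A> (\<lambda>n A. \<forall>\<sigma>. bij_betw \<sigma> {1..n} {1..n} \<longrightarrow> c * n / log 2 n \<le> card {(i, j) \<in> A. \<sigma> i > \<sigma> j}))"
proof -
  obtain c and \<delta> :: "nat \<Rightarrow> real" where c: "0 < c" and lim: "\<delta> \<longlonglongrightarrow> 0" and
    few: "\<And>n. 2 \<le> n \<Longrightarrow> card {A. A \<subseteq> {1..n} \<times> {1..n} \<and> irrefl A \<and>
      (\<exists>\<sigma>. bij_betw \<sigma> {1..n} {1..n} \<and> card {(i, j) \<in> A. \<sigma> i > \<sigma> j} \<le> c * n / log 2 n)}
    \<le> \<delta> n * card (oriented_cyclefree_sets k {1..n})"
    using few_backwards_ratio[OF k] by blast
  have "typical \<A> (\<lambda>n A. \<forall>\<sigma>. bij_betw \<sigma> {1..n} {1..n} \<longrightarrow> c * n / log 2 n \<le> card {(i, j) \<in> A. \<sigma> i > \<sigma> j})"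
    if \<A>: "\<A> = (\<lambda>n. oriented_cyclefree_sets k {1..n}) \<or> \<A> = (\<lambda>n. cyclefree_sets k {1..n})" for \<A>
  proof (rule typicalI[OF lim, where X = "\<lambda>n. card (oriented_cyclefree_sets k {1..n})"])
    show "\<forall>\<^sub>F n in sequentially. card {A \<in> \<A> n. \<not> (\<forall>\<sigma>. bij_betw \<sigma> {1..n} {1..n} \<longrightarrow>
        c * n / log 2 n \<le> card {(i, j) \<in> A. \<sigma> i > \<sigma> j})} \<le> \<delta> n * card (oriented_cyclefree_sets k {1..n})"
      using eventually_ge_at_top[of 2]
    proof eventually_elim
      case (elim n)
      let ?B = "{A. A \<subseteq> {1..n} \<times> {1..n} \<and> irrefl A \<and>
        (\<exists>\<sigma>. bij_betw \<sigma> {1..n} {1..n} \<and> card {(i, j) \<in> A. \<sigma> i > \<sigma> j} \<le> c * n / log 2 n)}"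
      have "{A \<in> \<A> n. \<not> (\<forall>\<sigma>. bij_betw \<sigma> {1..n} {1..n} \<longrightarrow>
          c * n / log 2 n \<le> card {(i, j) \<in> A. \<sigma> i > \<sigma> j})} \<subseteq> ?B"
      proof
        fix A assume A: "A \<in> {A \<in> \<A> n. \<not> (\<forall>\<sigma>. bij_betw \<sigma> {1..n} {1..n} \<longrightarrow>
          c * n / log 2 n \<le> card {(i, j) \<in> A. \<sigma> i > \<sigma> j})}"
        then have "cyclefree k {1..n} A"
          using \<A> by (auto simp: oriented_cyclefree_sets_def cyclefree_sets_def)
        then have "A \<subseteq> {1..n} \<times> {1..n}" "irrefl A"
          by (simp_all add: cyclefree_def)
        moreover obtain \<sigma> where "bij_betw \<sigma> {1..n} {1..n}" "\<not> c * n / log 2 n \<le> card {(i, j) \<in> A. \<sigma> i > \<sigma> j}"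
          using A by blast
        ultimately show "A \<in> ?B"
          by (intro CollectI conjI exI[of _ \<sigma>]) auto
      qed
      moreover have "finite ?B"
        by (rule finite_subset[of _ "Pow ({1..n} \<times> {1..n})"]) auto
      ultimately have "card {A \<in> \<A> n. \<not> (\<forall>\<sigma>. bij_betw \<sigma> {1..n} {1..n} \<longrightarrow>
          c * n / log 2 n \<le> card {(i, j) \<in> A. \<sigma> i > \<sigma> j})} \<le> card ?B"
        by (rule card_mono[rotated])
      then show ?case
        using few[OF elim] by linarith
    qed
    show "real (card (oriented_cyclefree_sets k {1..n})) \<le> card (\<A> n)" for n
      using \<A> card_oriented_le[of k n] by auto
  qed simp
  then show ?thesis
    using c by blast
qed

lemma card_extend_order:
  fixes f :: "'a \<Rightarrow> nat"
  assumes "finite D" "finite A"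
  shows "card {(u, v) \<in> A. f v \<le> f u} \<le> card {(u, v) \<in> D. f v \<le> f u} + card (A - D)"
proof -
  have "{(u, v) \<in> A. f v \<le> f u} \<subseteq> {(u, v) \<in> D. f v \<le> f u} \<union> (A - D)"
    by auto
  then have "card {(u, v) \<in> A. f v \<le> f u} \<le> card ({(u, v) \<in> D. f v \<le> f u} \<union> (A - D))"
    using assms by (intro card_mono) (auto intro: finite_subset[OF _ assms(1)])
  also have "\<dots> \<le> card {(u, v) \<in> D. f v \<le> f u} + card (A - D)"
    by (rule card_Un_le)
  finally show ?thesis .
qed

lemma arc_set_finite: "arc_set V D \<Longrightarrow> finite D"
  by (meson arc_set.finD)

lemma card_Pow_sets:
  assumes "D \<subseteq> V \<times> V" "finite D"
  shows "real (card {A' \<in> Pow (V \<times> V). A' \<subseteq> D}) = 2 powr card D"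
proof -
  have "{A' \<in> Pow (V \<times> V). A' \<subseteq> D} = Pow D"
    using assms by auto
  then show ?thesis
    using assms by (simp add: card_Pow powr_realpow)
qed

text \<open>A container with many subsets has many arcs and is therefore near-extremal. For even
  \<open>k\<close> it also has few double edges, and its order serves every arc set that is nearly
  contained in it.\<close>

lemma typical_order_digraphs:
  fixes \<alpha> :: real
  assumes k: "3 \<le> k" "even k" and \<alpha>: "0 < \<alpha>"
  shows "typical (\<lambda>n. cyclefree_sets k {1..n})
    (\<lambda>n A. \<exists>f :: nat \<Rightarrow> nat. card {(u, v) \<in> A. f v \<le> f u} \<le> \<alpha> * (real n)\<^sup>2)" (is "typical _ ?P")
proof -
  have \<alpha>2: "0 < \<alpha> / 2"
    using \<alpha> by simp
  obtain \<epsilon>2 :: real where \<epsilon>2: "0 < \<epsilon>2" and ord: "\<And>(V :: nat set) D. near_extremal k \<epsilon>2 V D \<Longrightarrow>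
      card (both_ways D) \<le> \<epsilon>2 * (card V)\<^sup>2 \<Longrightarrow> \<exists>f :: nat \<Rightarrow> nat. card {(u, v) \<in> D. f v \<le> f u} \<le> \<alpha> / 2 * (card V)\<^sup>2"
    using near_extremal_order[OF k(1) \<alpha>2, where 'a = nat] by blast
  obtain \<epsilon>3 :: real where \<epsilon>3: "0 < \<epsilon>3" and both: "\<And>(V :: nat set) D. arc_set V D \<Longrightarrow> V \<noteq> {} \<Longrightarrow>
      card (walks V D k) \<le> \<epsilon>3 * card V ^ k \<Longrightarrow> card (both_ways D) \<le> \<epsilon>2 * (card V)\<^sup>2"
    using few_walks_both_ways[OF k \<epsilon>2, where 'a = nat] by blast
  define \<epsilon>0 where "\<epsilon>0 = min (\<alpha> / 2) (min \<epsilon>2 \<epsilon>3)"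
  have \<epsilon>0: "0 < \<epsilon>0" "\<epsilon>0 \<le> \<alpha> / 2" "\<epsilon>0 \<le> \<epsilon>2" "\<epsilon>0 \<le> \<epsilon>3"
    using \<alpha> \<epsilon>2 \<epsilon>3 by (auto simp: \<epsilon>0_def)
  have "\<exists>\<delta> :: nat \<Rightarrow> real. \<delta> \<longlonglongrightarrow> 0 \<and> (\<forall>\<^sub>F n in sequentially.
    card {A \<in> Pow ({1..n} \<times> {1..n}). cyclefree k {1..n} A \<and> \<not> ?P n A} \<le> \<delta> n * 2 powr (real n * (real n - 1) / 2))"
  proof (rule bad_ratio[OF k(1) \<epsilon>2 \<epsilon>0(1), where ?n0.0 = "nat \<lceil>1 / \<epsilon>2\<rceil>"])
    fix n D A
    assume n: "nat \<lceil>1 / \<epsilon>2\<rceil> \<le> n" "0 < n" and arc: "arc_set {1..n} D"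
      and wk: "real (card (walks {1..n} D k)) \<le> \<epsilon>0 * real n ^ k"
      and big: "\<not> real (card {A' \<in> Pow ({1..n} \<times> {1..n}). A' \<subseteq> D}) \<le> 2 powr ((1 / 2 - \<epsilon>2) * (real n)\<^sup>2)"
      and A: "A \<in> Pow ({1..n} \<times> {1..n})" "real (card (A - D)) \<le> \<epsilon>0 * (real n)\<^sup>2"
    have D: "D \<subseteq> {1..n} \<times> {1..n}" "finite D"
      using arc arc_set_finite by (auto simp: arc_set_def)
    have dense: "(1 / 2 - \<epsilon>2) * (real n)\<^sup>2 \<le> card D"
      using big unfolding card_Pow_sets[OF D] by simp
    have wk2: "real (card (walks {1..n} D k)) \<le> \<epsilon>2 * real (card {1..n} ^ k)"
      "real (card (walks {1..n} D k)) \<le> \<epsilon>3 * real (card {1..n} ^ k)"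
      using wk mult_right_mono[OF \<epsilon>0(3), of "real (n ^ k)"] mult_right_mono[OF \<epsilon>0(4), of "real (n ^ k)"] by simp_all
    have "near_extremal k \<epsilon>2 {1..n} D"
      unfolding near_extremal_def using arc n wk2(1) dense by (auto simp: nat_le_iff ceiling_le_iff)
    moreover have "card (both_ways D) \<le> \<epsilon>2 * (card {1..n})\<^sup>2"
      using n by (intro both arc wk2(2)) auto
    ultimately obtain f :: "nat \<Rightarrow> nat" where f: "card {(u, v) \<in> D. f v \<le> f u} \<le> \<alpha> / 2 * (real n)\<^sup>2"
      using ord by fastforce
    have "finite A"
      using A(1) by (auto intro: finite_subset)
    then have "real (card {(u, v) \<in> A. f v \<le> f u}) \<le> real (card {(u, v) \<in> D. f v \<le> f u} + card (A - D))"
      by (intro of_nat_mono card_extend_order D)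
    also have "\<dots> \<le> \<alpha> / 2 * (real n)\<^sup>2 + \<epsilon>0 * (real n)\<^sup>2"
      using f A(2) by simp
    also have "\<dots> \<le> \<alpha> / 2 * (real n)\<^sup>2 + \<alpha> / 2 * (real n)\<^sup>2"
      using \<epsilon>0(2) by (intro add_left_mono mult_right_mono) auto
    finally show "\<exists>f :: nat \<Rightarrow> nat. card {(u, v) \<in> A. f v \<le> f u} \<le> \<alpha> * (real n)\<^sup>2"
      by auto
  qed auto
  then obtain \<delta> :: "nat \<Rightarrow> real" where lim: "\<delta> \<longlonglongrightarrow> 0" and bad: "\<forall>\<^sub>F n in sequentially.
    card {A \<in> Pow ({1..n} \<times> {1..n}). cyclefree k {1..n} A \<and> \<not> ?P n A} \<le> \<delta> n * 2 powr (real n * (real n - 1) / 2)"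
    by blast
  have eq: "{A \<in> Pow ({1..n} \<times> {1..n}). cyclefree k {1..n} A \<and> \<not> ?P n A} = {A \<in> cyclefree_sets k {1..n}. \<not> ?P n A}" for n
    unfolding cyclefree_sets_def cyclefree_def by blast
  show ?thesis
  proof (rule typicalI[OF lim bad[unfolded eq]])
    show "2 powr (real n * (real n - 1) / 2) \<le> card (cyclefree_sets k {1..n})" for n
      using many_cyclefree_sets[OF k(1), of n] card_oriented_le[of k n] by linarith
  qed simp
qed

text \<open>For odd \<open>k\<close> a container may have many double edges, but these are wasteful:
  its oriented subgraphs number at most 2 to the power
  \<open>card D - card (both_ways D) / 6\<close>, while \<open>card D\<close> is hardly above n^2/2.
  So many oriented subgraphs force both high density and few double edges.\<close>

lemma typical_order_oriented:
  fixes \<alpha> :: real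
  assumes k: "3 \<le> k" and \<alpha>: "0 < \<alpha>"
  shows "typical (\<lambda>n. oriented_cyclefree_sets k {1..n})
    (\<lambda>n A. \<exists>f :: nat \<Rightarrow> nat. card {(u, v) \<in> A. f v \<le> f u} \<le> \<alpha> * (real n)\<^sup>2)" (is "typical _ ?P")
proof -
  let ?G = "\<lambda>n. {A. antisymmetric A \<and> A \<subseteq> {1..n} \<times> {1..n}}"
  have \<alpha>2: "0 < \<alpha> / 2"
    using \<alpha> by simp
  obtain \<epsilon>2 :: real where \<epsilon>2: "0 < \<epsilon>2" and ord: "\<And>(V :: nat set) D. near_extremal k \<epsilon>2 V D \<Longrightarrow>
      card (both_ways D) \<le> \<epsilon>2 * (card V)\<^sup>2 \<Longrightarrow> \<exists>f :: nat \<Rightarrow> nat. card {(u, v) \<in> D. f v \<le> f u} \<le> \<alpha> / 2 * (card V)\<^sup>2"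
    using near_extremal_order[OF k(1) \<alpha>2, where 'a = nat] by blast
  \<comment> \<open>The upper and lower bounds on \<open>card D\<close> differ by 2\<omega> n^2,
    which exceeds a sixth of the double pairs; these number at most 12\<omega> n^2.\<close>
  define \<omega> where "\<omega> = \<epsilon>2 / 12"
  have \<omega>: "0 < \<omega>"
    using \<epsilon>2 by (simp add: \<omega>_def)
  obtain \<epsilon>3 :: real where \<epsilon>3: "0 < \<epsilon>3" and upper: "\<And>(V :: nat set) D. arc_set V D \<Longrightarrow> V \<noteq> {} \<Longrightarrow>
      card (walks V D k) \<le> \<epsilon>3 * card V ^ k \<Longrightarrow> card D \<le> (1 / 2 + \<omega>) * (card V)\<^sup>2"
    using few_walks_card_le[OF k \<omega>, where 'a = nat] by blast
  define \<epsilon>0 where "\<epsilon>0 = min (\<alpha> / 2) (min \<epsilon>2 \<epsilon>3)"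
  have \<epsilon>0: "0 < \<epsilon>0" "\<epsilon>0 \<le> \<alpha> / 2" "\<epsilon>0 \<le> \<epsilon>2" "\<epsilon>0 \<le> \<epsilon>3"
    using \<alpha> \<epsilon>2 \<epsilon>3 by (auto simp: \<epsilon>0_def)
  have "\<exists>\<delta> :: nat \<Rightarrow> real. \<delta> \<longlonglongrightarrow> 0 \<and> (\<forall>\<^sub>F n in sequentially.
    card {A \<in> ?G n. cyclefree k {1..n} A \<and> \<not> ?P n A} \<le> \<delta> n * 2 powr (real n * (real n - 1) / 2))"
  proof (rule bad_ratio[OF k(1) \<omega> \<epsilon>0(1), where ?n0.0 = "nat \<lceil>1 / \<epsilon>2\<rceil>"])
    show "A' \<in> ?G n" if "A \<in> ?G n" "A' \<subseteq> A" for n :: nat and A A'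
    proof -
      have "antisymmetric A'"
        using that unfolding antisymmetric_def by blast
      then show ?thesis
        using that by auto
    qed
    fix n D A
    assume n: "nat \<lceil>1 / \<epsilon>2\<rceil> \<le> n" "0 < n" and arc: "arc_set {1..n} D"
      and wk: "real (card (walks {1..n} D k)) \<le> \<epsilon>0 * real n ^ k"
      and big: "\<not> real (card {A' \<in> ?G n. A' \<subseteq> D}) \<le> 2 powr ((1 / 2 - \<omega>) * (real n)\<^sup>2)"
      and A: "A \<in> ?G n" "real (card (A - D)) \<le> \<epsilon>0 * (real n)\<^sup>2"
    have D: "D \<subseteq> {1..n} \<times> {1..n}" "finite D" "irrefl D"
      using arc arc_set_finite by (auto simp: arc_set_def)
    have eqD: "{A' \<in> ?G n. A' \<subseteq> D} = {A. antisymmetric A \<and> A \<subseteq> D}"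
      using D(1) by auto
    have "2 powr ((1 / 2 - \<omega>) * (real n)\<^sup>2) < real (card {A. antisymmetric A \<and> A \<subseteq> D})"
      using big unfolding eqD by (simp only: not_le)
    also have "\<dots> \<le> 2 powr (card D - card (both_ways D) / 6)"
      by (rule card_antisymmetric_subsets[OF D(2,3)])
    finally have "(1 / 2 - \<omega>) * (real n)\<^sup>2 < card D - card (both_ways D) / 6"
      by (simp only: powr_less_cancel_iff one_less_numeral_iff semiring_norm)
    then have lt: "(1 / 2 - \<omega>) * (real n)\<^sup>2 + card (both_ways D) / 6 < card D"
      by simp
    have "(1 / 2 - \<epsilon>2) * (real n)\<^sup>2 \<le> (1 / 2 - \<omega>) * (real n)\<^sup>2"
      using \<epsilon>2 by (intro mult_right_mono) (auto simp: \<omega>_def)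
    then have dense: "(1 / 2 - \<epsilon>2) * (real n)\<^sup>2 \<le> card D"
      using lt by linarith
    have wk2: "real (card (walks {1..n} D k)) \<le> \<epsilon>2 * real (card {1..n} ^ k)"
      "real (card (walks {1..n} D k)) \<le> \<epsilon>3 * real (card {1..n} ^ k)"
      using wk mult_right_mono[OF \<epsilon>0(3), of "real (n ^ k)"] mult_right_mono[OF \<epsilon>0(4), of "real (n ^ k)"] by simp_all
    have "card D \<le> (1 / 2 + \<omega>) * (card {1..n})\<^sup>2"
      using n by (intro upper arc wk2(2)) auto
    then have "card (both_ways D) \<le> 12 * \<omega> * (real n)\<^sup>2"
      using lt by (simp add: algebra_simps)
    then have "card (both_ways D) \<le> \<epsilon>2 * (card {1..n})\<^sup>2"
      by (simp add: \<omega>_def)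
    moreover have "near_extremal k \<epsilon>2 {1..n} D"
      unfolding near_extremal_def using arc n wk2(1) dense by (auto simp: nat_le_iff ceiling_le_iff)
    ultimately obtain f :: "nat \<Rightarrow> nat" where f: "card {(u, v) \<in> D. f v \<le> f u} \<le> \<alpha> / 2 * (real n)\<^sup>2"
      using ord by fastforce
    have "finite A"
      using A(1) by (auto intro: finite_subset)
    then have "real (card {(u, v) \<in> A. f v \<le> f u}) \<le> real (card {(u, v) \<in> D. f v \<le> f u} + card (A - D))"
      by (intro of_nat_mono card_extend_order D)
    also have "\<dots> \<le> \<alpha> / 2 * (real n)\<^sup>2 + \<epsilon>0 * (real n)\<^sup>2"
      using f A(2) by simp
    also have "\<dots> \<le> \<alpha> / 2 * (real n)\<^sup>2 + \<alpha> / 2 * (real n)\<^sup>2"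
      using \<epsilon>0(2) by (intro add_left_mono mult_right_mono) auto
    finally show "\<exists>f :: nat \<Rightarrow> nat. card {(u, v) \<in> A. f v \<le> f u} \<le> \<alpha> * (real n)\<^sup>2"
      by auto
  qed auto
  then obtain \<delta> :: "nat \<Rightarrow> real" where lim: "\<delta> \<longlonglongrightarrow> 0" and bad: "\<forall>\<^sub>F n in sequentially.
    card {A \<in> ?G n. cyclefree k {1..n} A \<and> \<not> ?P n A} \<le> \<delta> n * 2 powr (real n * (real n - 1) / 2)"
    by blast
  have eq: "{A \<in> ?G n. cyclefree k {1..n} A \<and> \<not> ?P n A} = {A \<in> oriented_cyclefree_sets k {1..n}. \<not> ?P n A}" for n
    unfolding oriented_cyclefree_sets_def cyclefree_def by blast
  show ?thesis
    by (rule typicalI[OF lim bad[unfolded eq] _ many_cyclefree_sets[OF k]]) simp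
qed

text \<open>With double edges possibly abundant, the order of the classes is not enough, so the
  colouring is kept, and balanced inside the container before passing to the digraph.\<close>

lemma typical_blow_up_digraphs:
  fixes \<alpha> :: real
  assumes k: "3 \<le> k" and \<alpha>: "0 < \<alpha>"
  shows "typical (\<lambda>n. cyclefree_sets k {1..n})
    (\<lambda>n A. \<exists>f c. balanced {1..n} f c \<and> card (A - blow_up_arcs f c) \<le> \<alpha> * (real n)\<^sup>2)" (is "typical _ ?P")
proof -
  have \<alpha>2: "0 < \<alpha> / 2"
    using \<alpha> by simp
  obtain \<epsilon>2 :: real where \<epsilon>2: "0 < \<epsilon>2" and blow: "\<And>(V :: nat set) D. near_extremal k \<epsilon>2 V D \<Longrightarrow>
      \<exists>f c. balanced V f c \<and> card (D - blow_up_arcs f c) \<le> \<alpha> / 2 * (card V)\<^sup>2"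
    using near_extremal_balanced[OF k(1) \<alpha>2, where 'a = nat] by blast
  define \<epsilon>0 where "\<epsilon>0 = min (\<alpha> / 2) \<epsilon>2"
  have \<epsilon>0: "0 < \<epsilon>0" "\<epsilon>0 \<le> \<alpha> / 2" "\<epsilon>0 \<le> \<epsilon>2"
    using \<alpha> \<epsilon>2 by (auto simp: \<epsilon>0_def)
  have "\<exists>\<delta> :: nat \<Rightarrow> real. \<delta> \<longlonglongrightarrow> 0 \<and> (\<forall>\<^sub>F n in sequentially.
    card {A \<in> Pow ({1..n} \<times> {1..n}). cyclefree k {1..n} A \<and> \<not> ?P n A} \<le> \<delta> n * 2 powr (real n * (real n - 1) / 2))"
  proof (rule bad_ratio[OF k(1) \<epsilon>2 \<epsilon>0(1), where ?n0.0 = "nat \<lceil>1 / \<epsilon>2\<rceil>"])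
    fix n D A
    assume n: "nat \<lceil>1 / \<epsilon>2\<rceil> \<le> n" "0 < n" and arc: "arc_set {1..n} D"
      and wk: "real (card (walks {1..n} D k)) \<le> \<epsilon>0 * real n ^ k"
      and big: "\<not> real (card {A' \<in> Pow ({1..n} \<times> {1..n}). A' \<subseteq> D}) \<le> 2 powr ((1 / 2 - \<epsilon>2) * (real n)\<^sup>2)"
      and A: "A \<in> Pow ({1..n} \<times> {1..n})" "real (card (A - D)) \<le> \<epsilon>0 * (real n)\<^sup>2"
    have D: "D \<subseteq> {1..n} \<times> {1..n}" "finite D"
      using arc arc_set_finite by (auto simp: arc_set_def)
    have dense: "(1 / 2 - \<epsilon>2) * (real n)\<^sup>2 \<le> card D"
      using big unfolding card_Pow_sets[OF D] by simp
    have wk2: "real (card (walks {1..n} D k)) \<le> \<epsilon>2 * real (card {1..n} ^ k)"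
      using wk mult_right_mono[OF \<epsilon>0(3), of "real (n ^ k)"] by simp
    have "near_extremal k \<epsilon>2 {1..n} D"
      unfolding near_extremal_def using arc n wk2 dense by (auto simp: nat_le_iff ceiling_le_iff)
    then obtain f c where f: "balanced {1..n} f c" "card (D - blow_up_arcs f c) \<le> \<alpha> / 2 * (real n)\<^sup>2"
      using blow by fastforce
    have finA: "finite A"
      using A(1) by (auto intro: finite_subset)
    have "A - blow_up_arcs f c \<subseteq> (D - blow_up_arcs f c) \<union> (A - D)"
      by auto
    then have "card (A - blow_up_arcs f c) \<le> card ((D - blow_up_arcs f c) \<union> (A - D))"
      using D finA by (intro card_mono) auto
    also have "\<dots> \<le> card (D - blow_up_arcs f c) + card (A - D)"
      by (rule card_Un_le)
    finally have "real (card (A - blow_up_arcs f c)) \<le> real (card (D - blow_up_arcs f c) + card (A - D))"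
      by (rule of_nat_mono)
    also have "\<dots> \<le> \<alpha> / 2 * (real n)\<^sup>2 + \<epsilon>0 * (real n)\<^sup>2"
      using f(2) A(2) by simp
    also have "\<dots> \<le> \<alpha> / 2 * (real n)\<^sup>2 + \<alpha> / 2 * (real n)\<^sup>2"
      using \<epsilon>0(2) by (intro add_left_mono mult_right_mono) auto
    finally show "\<exists>f c. balanced {1..n} f c \<and> card (A - blow_up_arcs f c) \<le> \<alpha> * (real n)\<^sup>2"
      using f(1) by auto
  qed auto
  then obtain \<delta> :: "nat \<Rightarrow> real" where lim: "\<delta> \<longlonglongrightarrow> 0" and bad: "\<forall>\<^sub>F n in sequentially.
    card {A \<in> Pow ({1..n} \<times> {1..n}). cyclefree k {1..n} A \<and> \<not> ?P n A} \<le> \<delta> n * 2 powr (real n * (real n - 1) / 2)"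
    by blast
  have eq: "{A \<in> Pow ({1..n} \<times> {1..n}). cyclefree k {1..n} A \<and> \<not> ?P n A} = {A \<in> cyclefree_sets k {1..n}. \<not> ?P n A}" for n
    unfolding cyclefree_sets_def cyclefree_def by blast
  show ?thesis
  proof (rule typicalI[OF lim bad[unfolded eq]])
    show "2 powr (real n * (real n - 1) / 2) \<le> card (cyclefree_sets k {1..n})" for n
      using many_cyclefree_sets[OF k(1), of n] card_oriented_le[of k n] by linarith
  qed simp
qed

section \<open>Orderings and blow ups of labelled digraphs\<close>

lemma transitive_optimal_exists:
  "\<exists>\<sigma>. transitive_optimal n G \<sigma> \<and> bij_betw \<sigma> {1..n} {1..n} \<and>
    (\<forall>\<tau>. bij_betw \<tau> {1..n} {1..n} \<longrightarrow> card (backwards_edges G \<sigma>) \<le> card (backwards_edges G \<tau>))"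
proof -
  have "bij_betw id {1..n} {1..n}"
    by simp
  from ex_has_least_nat[of "\<lambda>\<tau>. bij_betw \<tau> {1..n} {1..n}", OF this, of "\<lambda>\<tau>. card (backwards_edges G \<tau>)"]
  obtain \<sigma> where "bij_betw \<sigma> {1..n} {1..n}"
    "\<forall>\<tau>. bij_betw \<tau> {1..n} {1..n} \<longrightarrow> card (backwards_edges G \<sigma>) \<le> card (backwards_edges G \<tau>)"
    by (elim exE conjE) (rule that)
  then show ?thesis
    unfolding transitive_optimal_def is_arg_min_linorder by (intro exI[of _ \<sigma>] conjI)
qed

text \<open>A topological order of the strict comparisons under \<open>f\<close> breaks the
  ties.\<close>

lemma order_to_bijection:
  fixes f :: "nat \<Rightarrow> nat"
  shows "\<exists>\<tau>. bij_betw \<tau> {1..n} {1..n} \<and> (\<forall>u\<in>{1..n}. \<forall>v\<in>{1..n}. f u < f v \<longrightarrow> \<tau> u < \<tau> v)"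
proof -
  let ?A = "{(u, v). u \<in> {1..n} \<and> v \<in> {1..n} \<and> f u < f v}"
  have "acyclic ?A"
    by (rule acyclic_subset[OF wf_acyclic[OF wf_measure[of f]]]) (auto simp: measure_def)
  moreover have "?A \<subseteq> {1..n} \<times> {1..n}"
    by auto
  ultimately obtain p where p: "bij_betw p {1..n} {..<card {1..n}}" "\<forall>(u, v)\<in>?A. p u < p v"
    using topological_order[of "{1..n}" ?A] by blast
  have "bij_betw Suc {..<n} {1..n}"
    by (simp add: bij_betw_def image_Suc_lessThan)
  then have "bij_betw (Suc \<circ> p) {1..n} {1..n}"
    using p(1) by (intro bij_betw_trans[of p]) auto
  then show ?thesis
    using p(2) by (intro exI[of _ "Suc \<circ> p"]) auto
qed

text \<open>However ties of \<open>f\<close> are broken, only arcs with \<open>f v \<le> f u\<close>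
  can be backwards, and an optimal ordering does no worse.\<close>

lemma backwards_edges_le:
  fixes f :: "nat \<Rightarrow> nat" and x :: real
  assumes A: "A \<subseteq> {1..n} \<times> {1..n}" and f: "card {(u, v) \<in> A. f v \<le> f u} \<le> x"
    and opt: "\<forall>\<tau>. bij_betw \<tau> {1..n} {1..n} \<longrightarrow> card (backwards_edges (digraph_of n A) \<sigma>) \<le> card (backwards_edges (digraph_of n A) \<tau>)"
  shows "card (backwards_edges (digraph_of n A) \<sigma>) \<le> x"
proof -
  obtain \<tau> where \<tau>: "bij_betw \<tau> {1..n} {1..n}" "\<forall>u\<in>{1..n}. \<forall>v\<in>{1..n}. f u < f v \<longrightarrow> \<tau> u < \<tau> v"
    using order_to_bijection by blast
  have "backwards_edges (digraph_of n A) \<tau> \<subseteq> {(u, v) \<in> A. f v \<le> f u}"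
  proof
    fix p assume p: "p \<in> backwards_edges (digraph_of n A) \<tau>"
    then obtain u v where uv: "p = (u, v)" "(u, v) \<in> A" "\<tau> v < \<tau> u"
      by (auto simp: backwards_edges_def)
    then have "u \<in> {1..n}" "v \<in> {1..n}"
      using A by auto
    then have "\<not> f u < f v"
      using \<tau>(2) uv(3) by (meson less_asym)
    then show "p \<in> {(u, v) \<in> A. f v \<le> f u}"
      using uv by simp
  qed
  moreover have "finite {(u, v) \<in> A. f v \<le> f u}"
  proof (rule finite_subset)
    show "{(u, v) \<in> A. f v \<le> f u} \<subseteq> A"
      by blast
    show "finite A"
      using A by (rule finite_subset) simp
  qed
  ultimately have "card (backwards_edges (digraph_of n A) \<tau>) \<le> card {(u, v) \<in> A. f v \<le> f u}"
    by (rule card_mono[rotated])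
  then have "card (backwards_edges (digraph_of n A) \<sigma>) \<le> card {(u, v) \<in> A. f v \<le> f u}"
    by (rule le_trans[OF opt[rule_format, OF \<tau>(1)]])
  then show ?thesis
    using f by linarith
qed

lemma delete_arcs:
  assumes "finite X" "X \<subseteq> A"
  shows "(digraph_of n A, digraph_of n (A - X)) \<in> edge_change ^^ card X"
  using assms
proof (induction X rule: finite_induct)
  case (insert x X)
  let ?G = "digraph_of n (A - X)" and ?H = "digraph_of n (A - insert x X)"
  have "x \<in> parcs ?G" "parcs ?H = parcs ?G - {x}"
    using insert.prems insert.hyps(2) by auto
  then have "\<exists>e\<in>parcs ?G. parcs ?H = parcs ?G - {e}"
    by blast
  then have "(?G, ?H) \<in> edge_change"
    unfolding edge_change_def by simp
  moreover have "(digraph_of n A, ?G) \<in> edge_change ^^ card X"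
    using insert.IH insert.prems by simp
  ultimately have "(digraph_of n A, ?H) \<in> edge_change ^^ Suc (card X)"
    by (rule relpow_Suc_I[rotated])
  then show ?case
    using insert.hyps by simp
qed simp

text \<open>The keys in use are renumbered increasingly by 1 to \<open>t\<close>. Balance tolerates
  a difference of one, so a class with a single vertex is complete balanced bipartite with one empty
  side, and the bipartite alternative covers every class.\<close>

lemma transitive_bipartite_blow_up_digraph_of:
  assumes "balanced {1..n} f c"
  shows "transitive_bipartite_blow_up (digraph_of n (blow_up_arcs f c \<inter> {1..n} \<times> {1..n}))"
    (is "transitive_bipartite_blow_up ?G")
proof -
  let ?V = "{1..n}"
  define t where "t = card (f ` ?V)"
  have "acyclic {(x, y). x \<in> f ` ?V \<and> y \<in> f ` ?V \<and> x < y}"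
    by (rule acyclic_subset[OF wf_acyclic[OF wf_measure[of id]]]) (auto simp: measure_def)
  then obtain p where p: "bij_betw p (f ` ?V) {..<t}" and
    mono: "\<forall>(x, y)\<in>{(x, y). x \<in> f ` ?V \<and> y \<in> f ` ?V \<and> x < y}. p x < p y"
    using topological_order[of "f ` ?V" "{(x, y). x \<in> f ` ?V \<and> y \<in> f ` ?V \<and> x < y}"] unfolding t_def by blast
  define A where "A i = {v \<in> ?V. Suc (p (f v)) = i}" for i
  have lt: "f u < f v" if "u \<in> ?V" "v \<in> ?V" "p (f u) < p (f v)" for u v
  proof (rule ccontr)
    assume "\<not> f u < f v"
    then consider "f v < f u" | "f u = f v"
      by linarith
    then show False
      using mono that by cases (force, simp)
  qed
  have inj: "f u = f v" if "u \<in> ?V" "v \<in> ?V" "p (f u) = p (f v)" for u v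
    using p that by (auto simp: bij_betw_def inj_on_def)
  have pt: "p (f v) < t" if "v \<in> ?V" for v
    using p that by (auto simp: bij_betw_def)
  have ne: "\<exists>v\<in>?V. A i = {u \<in> ?V. f u = f v} \<and> v \<in> A i" if i: "i \<in> {1..t}" for i
  proof -
    have "i - 1 \<in> p ` (f ` ?V)"
      using p i by (auto simp: bij_betw_def)
    then obtain v where v: "v \<in> ?V" "p (f v) = i - 1"
      by auto
    have Suc: "Suc (p (f v)) = i"
      using v(2) i by simp
    have "Suc (p (f u)) = i \<longleftrightarrow> f u = f v" if "u \<in> ?V" for u
      using inj[OF that v(1)] Suc by (metis nat.inject)
    then have "A i = {u \<in> ?V. f u = f v}"
      unfolding A_def by (rule Collect_cong[OF conj_cong[OF refl]])
    then show ?thesis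
      using v(1) by (intro bexI[of _ v]) simp_all
  qed
  have pd: "pair_digraph ?G"
    unfolding pair_digraph_iff by (auto simp: blow_up_arcs_def irrefl_def)
  have bip: "complete_balanced_bipartite (induce_subgraph (with_proj ?G) (A i))" if i: "i \<in> {1..t}" for i
  proof -
    obtain v where v: "v \<in> ?V" "A i = {u \<in> ?V. f u = f v}"
      using ne[OF i] by blast
    let ?U = "colour_class ?V f c (f v) True" and ?W = "colour_class ?V f c (f v) False"
    let ?H = "\<lparr>pverts = A i, parcs = ?U \<times> ?W \<union> ?W \<times> ?U\<rparr>"
    have "(x, y) \<in> blow_up_arcs f c \<inter> ?V \<times> ?V \<and> x \<in> A i \<and> y \<in> A i \<longleftrightarrow> (x, y) \<in> ?U \<times> ?W \<union> ?W \<times> ?U" for x y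
      unfolding v(2) by (cases "c x"; cases "c y"; cases "f x = f v"; cases "f y = f v")
        (simp_all add: colour_class_def blow_up_arcs_def)
    then have "{e \<in> parcs ?G. fst e \<in> A i \<and> snd e \<in> A i} = ?U \<times> ?W \<union> ?W \<times> ?U"
      by (intro set_eqI) (simp only: mem_Collect_eq parcs_digraph_of split_paired_all fst_conv snd_conv)
    then have ind: "induce_subgraph (with_proj ?G) (A i) = with_proj ?H"
      by (simp add: induce_subgraph_def with_proj_def)
    have parts: "A i = ?U \<union> ?W" "?U \<inter> ?W = {}" "finite (A i)"
      by (auto simp: v(2) colour_class_def)
    have K1: "complete_bipartite_digraph (card ?U) (card ?W) (with_proj ?H)"
      unfolding complete_bipartite_digraph_pair_def using parts
      by (intro conjI exI[of _ ?U] exI[of _ ?W]) auto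
    \<comment> \<open>Either colour may be the smaller one, and the definition of balance names the
      smaller side first.\<close>
    have K2: "complete_bipartite_digraph (card ?W) (card ?U) (with_proj ?H)"
      unfolding complete_bipartite_digraph_pair_def using parts
      by (intro conjI exI[of _ ?W] exI[of _ ?U]) auto
    have "card ?U \<le> card ?W + 1" "card ?W \<le> card ?U + 1"
      using assms by (auto simp: balanced_def)
    then show ?thesis
      unfolding complete_balanced_bipartite_def ind using K1 K2 by (meson linear)
  qed
  have UN: "(\<Union>i\<in>{1..t}. A i) = pverts ?G"
    using pt by (auto simp: A_def Suc_le_eq)
  have disj: "disjoint_family_on A {1..t}"
    by (auto simp: disjoint_family_on_def A_def)
  have arcs: "parcs ?G \<inter> (A i \<times> A j \<union> A j \<times> A i) = A i \<times> A j" if "i < j" for i j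
  proof -
    have "f u < f v" if "u \<in> A i" "v \<in> A j" for u v
      using that \<open>i < j\<close> by (intro lt) (auto simp: A_def)
    then have "A i \<times> A j \<subseteq> blow_up_arcs f c" "A j \<times> A i \<inter> blow_up_arcs f c \<subseteq> A i \<times> A j"
      by (force simp: blow_up_arcs_def)+
    moreover have "A i \<subseteq> ?V" "A j \<subseteq> ?V"
      by (auto simp: A_def)
    ultimately show ?thesis
      unfolding parcs_digraph_of by blast
  qed
  show ?thesis
    unfolding transitive_bipartite_blow_up_def
  proof (intro conjI exI[of _ t] exI[of _ A] ballI impI)
    show "A i \<noteq> {}" if "i \<in> {1..t}" for i
      using ne[OF that] by blast
    show "card (A i) = 1 \<or> complete_balanced_bipartite (induce_subgraph (with_proj ?G) (A i))" if "i \<in> {1..t}" for i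
      using bip[OF that] ..
    show "parcs ?G \<inter> (A i \<times> A j \<union> A j \<times> A i) = A i \<times> A j" if "i < j" for i j
      using that by (rule arcs)
  qed (rule pd UN disj)+
qed

text \<open>Deletions suffice: without its arcs outside the blow up, the digraph is a spanning
  subgraph of it.\<close>

lemma near_blow_up_subgraph_digraph_of:
  fixes x :: real
  assumes A: "A \<subseteq> {1..n} \<times> {1..n}" and bal: "balanced {1..n} f c"
    and card: "card (A - blow_up_arcs f c) \<le> x"
  shows "near_blow_up_subgraph (digraph_of n A) x"
proof -
  let ?X = "A - blow_up_arcs f c"
  let ?H = "digraph_of n (A - ?X)" and ?B = "digraph_of n (blow_up_arcs f c \<inter> {1..n} \<times> {1..n})"
  have "finite ?X"
    using A by (intro finite_subset[of ?X "{1..n} \<times> {1..n}"]) auto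
  then have del: "(digraph_of n A, ?H) \<in> edge_change ^^ card ?X"
    by (rule delete_arcs) auto
  have "wf_digraph (with_proj ?H)" "wf_digraph (with_proj ?B)"
    using A by (unfold_locales; auto)+
  then have "spanning (with_proj ?H) (with_proj ?B)"
    using A by (auto simp: spanning_def subgraph_def compatible_def)
  then show ?thesis
    unfolding near_blow_up_subgraph_def
    using card del transitive_bipartite_blow_up_digraph_of[OF bal]
    by (intro exI[of _ "card ?X"] exI[of _ ?H] exI[of _ ?B] conjI)
qed

lemma typical_almost_all:
  assumes "\<And>n. F n = digraph_of n ` \<A> n" "\<And>n. finite (\<A> n)" "\<And>n. \<A> n \<noteq> {}" "typical \<A> Q"
    "\<And>n A. A \<in> \<A> n \<Longrightarrow> Q n A \<Longrightarrow> P n (digraph_of n A)"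
  shows "almost_all F P"
proof -
  obtain \<delta> where "\<delta> \<longlonglongrightarrow> 0" "\<forall>\<^sub>F n in sequentially. real (card {A \<in> \<A> n. \<not> Q n A}) \<le> \<delta> n * real (card (\<A> n))"
    using assms(4) unfolding typical_def by blast
  then show ?thesis
    using assms(1-3,5) by (intro almost_all_digraph_ofI[of F \<A> \<delta> Q P])
qed

theorem theorem1p3:
  fixes k :: nat
  assumes "k \<ge> 3"
  shows "\<exists>c::real. c > 0 \<and> (\<forall>\<alpha>::real. \<alpha> > 0 \<longrightarrow>
    almost_all (cycle_free_oriented_graphs k)
      (\<lambda>n G. \<exists>\<sigma>. transitive_optimal n G \<sigma> \<and>
         c * real n / log 2 (real n) \<le> real (card (backwards_edges G \<sigma>)) \<and>
         real (card (backwards_edges G \<sigma>)) \<le> \<alpha> * (real n)\<^sup>2) \<and>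
    almost_all (cycle_free_digraphs k)
      (\<lambda>n G. \<exists>\<sigma>. transitive_optimal n G \<sigma> \<and>
         c * real n / log 2 (real n) \<le> real (card (backwards_edges G \<sigma>))) \<and>
    (even k \<longrightarrow> almost_all (cycle_free_digraphs k)
      (\<lambda>n G. \<exists>\<sigma>. transitive_optimal n G \<sigma> \<and>
         real (card (backwards_edges G \<sigma>)) \<le> \<alpha> * (real n)\<^sup>2)) \<and>
    (odd k \<longrightarrow> almost_all (cycle_free_digraphs k)
      (\<lambda>n G. near_blow_up_subgraph G (\<alpha> * (real n)\<^sup>2))))"
proof -
  have k: "0 < k"
    using assms by simp
  let ?O = "\<lambda>n. oriented_cyclefree_sets k {1..n}" and ?C = "\<lambda>n. cyclefree_sets k {1..n}"
  obtain c :: real where c: "0 < c" and low: "\<And>\<A>. \<A> = ?O \<or> \<A> = ?C \<Longrightarrow>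
    typical \<A> (\<lambda>n A. \<forall>\<sigma>. bij_betw \<sigma> {1..n} {1..n} \<longrightarrow> c * n / log 2 n \<le> card {(i, j) \<in> A. \<sigma> i > \<sigma> j})"
    using typical_many_backwards[OF assms] by blast
  have finO: "finite (?O n)" and finC: "finite (?C n)" for n :: nat
    by (simp_all add: finite_cyclefree_sets)
  have neO: "?O n \<noteq> {}" for n :: nat
  proof
    assume "?O n = {}"
    then have "2 powr (real n * (real n - 1) / 2) \<le> (0::real)"
      using many_cyclefree_sets[OF assms, of n] by simp
    then show False
      using powr_gt_zero[of 2 "real n * (real n - 1) / 2"] by linarith
  qed
  have neC: "?C n \<noteq> {}" for n :: nat
    using neO[of n] oriented_cyclefree_subset[of k "{1..n}"] by blast
  have O_sub: "A \<subseteq> {1..n} \<times> {1..n}" if "A \<in> ?O n" for A and n :: nat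
    using that by (simp add: oriented_cyclefree_sets_def cyclefree_def)
  have C_sub: "A \<subseteq> {1..n} \<times> {1..n}" if "A \<in> ?C n" for A and n :: nat
    using that by (simp add: cyclefree_sets_def cyclefree_def)
  have be: "backwards_edges (digraph_of n A) \<sigma> = {(i, j) \<in> A. \<sigma> i > \<sigma> j}" for n A \<sigma>
    by (simp add: backwards_edges_def)
  show ?thesis
  proof (intro exI[of _ c] conjI allI impI c)
    fix \<alpha> :: real assume \<alpha>: "0 < \<alpha>"
    show "almost_all (cycle_free_oriented_graphs k)
      (\<lambda>n G. \<exists>\<sigma>. transitive_optimal n G \<sigma> \<and>
         c * real n / log 2 (real n) \<le> real (card (backwards_edges G \<sigma>)) \<and>
         real (card (backwards_edges G \<sigma>)) \<le> \<alpha> * (real n)\<^sup>2)"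
    proof (rule typical_almost_all[OF cycle_free_oriented_graphs_eq[OF k] finO neO
          typical_conj[OF finO low[OF disjI1[OF refl]] typical_order_oriented[OF assms \<alpha>]]], elim conjE exE)
      fix n :: nat and A and f :: "nat \<Rightarrow> nat"
      assume A: "A \<in> ?O n" and lo: "\<forall>\<sigma>. bij_betw \<sigma> {1..n} {1..n} \<longrightarrow>
          c * n / log 2 n \<le> card {(i, j) \<in> A. \<sigma> i > \<sigma> j}"
        and f: "card {(u, v) \<in> A. f v \<le> f u} \<le> \<alpha> * (real n)\<^sup>2"
      obtain \<sigma> where \<sigma>: "transitive_optimal n (digraph_of n A) \<sigma>" "bij_betw \<sigma> {1..n} {1..n}"
        "\<forall>\<tau>. bij_betw \<tau> {1..n} {1..n} \<longrightarrow> card (backwards_edges (digraph_of n A) \<sigma>) \<le> card (backwards_edges (digraph_of n A) \<tau>)"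
        using transitive_optimal_exists[of n "digraph_of n A"] by (elim exE conjE)
      have "c * n / log 2 n \<le> card (backwards_edges (digraph_of n A) \<sigma>)"
        using lo[rule_format, OF \<sigma>(2)] unfolding be .
      then show "\<exists>\<sigma>. transitive_optimal n (digraph_of n A) \<sigma> \<and>
         c * real n / log 2 (real n) \<le> real (card (backwards_edges (digraph_of n A) \<sigma>)) \<and>
         real (card (backwards_edges (digraph_of n A) \<sigma>)) \<le> \<alpha> * (real n)\<^sup>2"
        using \<sigma>(1) backwards_edges_le[OF O_sub[OF A] f \<sigma>(3)] by (intro exI[of _ \<sigma>] conjI)
    qed
    show "almost_all (cycle_free_digraphs k)
      (\<lambda>n G. \<exists>\<sigma>. transitive_optimal n G \<sigma> \<and>
         c * real n / log 2 (real n) \<le> real (card (backwards_edges G \<sigma>)))"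
    proof (rule typical_almost_all[OF cycle_free_digraphs_eq[OF k] finC neC low[OF disjI2[OF refl]]])
      fix n :: nat and A
      assume lo: "\<forall>\<sigma>. bij_betw \<sigma> {1..n} {1..n} \<longrightarrow> c * n / log 2 n \<le> card {(i, j) \<in> A. \<sigma> i > \<sigma> j}"
      obtain \<sigma> where \<sigma>: "transitive_optimal n (digraph_of n A) \<sigma>" "bij_betw \<sigma> {1..n} {1..n}"
        using transitive_optimal_exists[of n "digraph_of n A"] by (elim exE conjE)
      have "c * n / log 2 n \<le> card (backwards_edges (digraph_of n A) \<sigma>)"
        using lo[rule_format, OF \<sigma>(2)] unfolding be .
      then show "\<exists>\<sigma>. transitive_optimal n (digraph_of n A) \<sigma> \<and>
         c * real n / log 2 (real n) \<le> real (card (backwards_edges (digraph_of n A) \<sigma>))"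
        using \<sigma>(1) by (intro exI[of _ \<sigma>] conjI)
    qed
    show "almost_all (cycle_free_digraphs k)
      (\<lambda>n G. \<exists>\<sigma>. transitive_optimal n G \<sigma> \<and> real (card (backwards_edges G \<sigma>)) \<le> \<alpha> * (real n)\<^sup>2)"
      if "even k"
    proof (rule typical_almost_all[OF cycle_free_digraphs_eq[OF k] finC neC
          typical_order_digraphs[OF assms that \<alpha>]], elim exE)
      fix n :: nat and A and f :: "nat \<Rightarrow> nat"
      assume A: "A \<in> ?C n" and f: "card {(u, v) \<in> A. f v \<le> f u} \<le> \<alpha> * (real n)\<^sup>2"
      obtain \<sigma> where \<sigma>: "transitive_optimal n (digraph_of n A) \<sigma>"
        "\<forall>\<tau>. bij_betw \<tau> {1..n} {1..n} \<longrightarrow> card (backwards_edges (digraph_of n A) \<sigma>) \<le> card (backwards_edges (digraph_of n A) \<tau>)"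
        using transitive_optimal_exists[of n "digraph_of n A"] by (elim exE conjE)
      show "\<exists>\<sigma>. transitive_optimal n (digraph_of n A) \<sigma> \<and>
         real (card (backwards_edges (digraph_of n A) \<sigma>)) \<le> \<alpha> * (real n)\<^sup>2"
        using \<sigma>(1) backwards_edges_le[OF C_sub[OF A] f \<sigma>(2)] by (intro exI[of _ \<sigma>] conjI)
    qed
    show "almost_all (cycle_free_digraphs k) (\<lambda>n G. near_blow_up_subgraph G (\<alpha> * (real n)\<^sup>2))" if "odd k"
    proof (rule typical_almost_all[OF cycle_free_digraphs_eq[OF k] finC neC
          typical_blow_up_digraphs[OF assms \<alpha>]], elim exE conjE)
      fix n :: nat and A f c
      assume "A \<in> ?C n" "balanced {1..n} f c" "card (A - blow_up_arcs f c) \<le> \<alpha> * (real n)\<^sup>2"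
      then show "near_blow_up_subgraph (digraph_of n A) (\<alpha> * (real n)\<^sup>2)"
        by (intro near_blow_up_subgraph_digraph_of C_sub)
    qed
  qed
qed

end
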